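(* Let $d\ge 2$, let $\beta\in(0,2]$, and let $B(|v-v_*|,\cos\theta)=|v-v_*|^\beta\, b(\cos\theta)$, where $b\ge 0$ is not almost everywhere zero and $b\in L^1\big([-1,1],(1-z^2)^{\frac{d-3}{2}}\,\mathrm{d}z\big)$. Let $f$ be an energy-conserving solution on $[0,+\infty)$ to the spatially homogeneous Boltzmann equation $\partial_t f=Q(f,f)$ with collision kernel $B$ and initial data $f(0,\cdot)=f_0\ge 0$ satisfying $f_0\in L^1(\mathbb{R}^d,(1+|v|^2)\,\mathrm{d}v)$. Assume moreover that for some $s\in[\beta,2]$ and some constants $a_0,C_0>0$, $$\int_{\mathbb{R}^d} f_0(v)\,\exp\big(a_0|v|^s\big)\,\mathrm{d}v\le C_0.$$ Then there are constants $C,a>0$, depending only on $b$, $\beta$, the initial mass $\int_{\mathbb{R}^d} f_0(v)\,\mathrm{d}v$, the initial energy $\int_{\mathbb{R}^d}|v|^2 f_0(v)\,\mathrm{d}v$, and $a_0$, $C_0$, such that $$\int_{\mathbb{R}^d} f(t,v)\,\exp\big(a|v|^s\big)\,\mathrm{d}v\le C\qquad\text{for all } t\ge 0.$$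
   Context: The dimension $d\ge2$ is fixed. For a nonnegative function $f=f(v)$ on $\mathbb{R}^d$, the collision operator is $$Q(f,f)(v):=\int_{\mathbb{R}^d\times\mathbb{S}^{d-1}}B(|v-v_*|,\cos\theta)\,\big(f(v'_* )f(v')-f(v_* )f(v)\big)\,\mathrm{d}v_*\,\mathrm{d}\sigma,$$ where $$v'=\frac{v+v_*}{2}+\frac{|v-v_*|}{2}\sigma,\qquad v'_*=\frac{v+v_*}{2}-\frac{|v-v_*|}{2}\sigma,\qquad \cos\theta=\frac{v-v_*}{|v-v_*|}\cdot\sigma .$$ A solution on $[0,+\infty)$ with initial data $f_0$ is a nonnegative measurable $f=f(t,v)$ with $f\in C([0,\infty);L^1(\mathbb{R}^d))\cap L^\infty_{\mathrm{loc}}([0,\infty);L^1((1+|v|^2)\,\mathrm{d}v))$ such that $f(t,\cdot)=f_0+\int_0^t Q(f,f)(\tau,\cdot)\,\mathrm{d}\tau$ in $L^1(\mathbb{R}^d)$ for all $t\ge0$. It is energy-conserving if $\int_{\mathbb{R}^d}|v|^2f(t,v)\,\mathrm{d}v=\int_{\mathbb{R}^d}|v|^2f_0(v)\,\mathrm{d}v$ for all $t\ge 0$. *)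

theory Defs
  imports "HOL-Analysis.Analysis"
begin

text \<open>
  Surface measure on the unit sphere, as the cone measure
  \<open>\<sigma>(A) = d |{r x. 0 < r < 1, x \<in> A}|\<close>.  This is the usual normalisation: the total mass
  is \<open>d\<close> times the volume of the unit ball.
\<close>
definition sphere_measure :: "'a::euclidean_space measure" where
  "sphere_measure = scale_measure (of_nat DIM('a))
     (distr (restrict_space lborel (ball 0 1 - {0})) (restrict_space borel (sphere 0 1))
        (\<lambda>x. x /\<^sub>R norm x))"

lemma space_sphere_measure: "space (sphere_measure :: 'a::euclidean_space measure) = sphere 0 1"
  by (simp add: sphere_measure_def space_scale_measure space_restrict_space)

lemma emeasure_sphere_measure:
  fixes A :: "'a::euclidean_space set"
  assumes A: "A \<in> sets borel" "A \<subseteq> sphere 0 1"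
  shows "emeasure sphere_measure A =
    of_nat DIM('a) * emeasure lborel {x \<in> ball 0 1 - {0}. x /\<^sub>R norm x \<in> A}"
proof -
  let ?M = "restrict_space lborel (ball 0 1 - {0}) :: 'a measure"
  have m: "(\<lambda>x. x /\<^sub>R norm x) \<in> measurable ?M (restrict_space borel (sphere 0 1))"
    by (intro measurable_restrict_space2 measurable_restrict_space1)
       (auto simp: space_restrict_space)
  have s: "A \<in> sets (restrict_space borel (sphere 0 1))"
    using A by (auto simp: sets_restrict_space_iff)
  have "(\<lambda>x. x /\<^sub>R norm x) -` A \<inter> space ?M = {x \<in> ball 0 1 - {0}. x /\<^sub>R norm x \<in> A}"
    by (auto simp: space_restrict_space)
  then show ?thesis
    unfolding sphere_measure_def using m s
    by (simp add: emeasure_distr) (subst emeasure_restrict_space; auto)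
qed

lemma emeasure_sphere_measure_space:
  "emeasure sphere_measure (sphere 0 1 :: 'a::euclidean_space set)
     = of_nat DIM('a) * emeasure lborel (ball 0 1 :: 'a set)"
proof -
  have "{x \<in> ball 0 1 - {0}. x /\<^sub>R norm x \<in> sphere 0 1} = ball 0 1 - {0::'a}"
    by auto
  moreover have "emeasure lborel (ball 0 1 - {0::'a}) = emeasure lborel (ball 0 1 :: 'a set)"
    by (rule emeasure_Diff_null_set) auto
  ultimately show ?thesis
    by (subst emeasure_sphere_measure) auto
qed

definition post_vel :: "'a::euclidean_space \<Rightarrow> 'a \<Rightarrow> 'a \<Rightarrow> 'a" where
  "post_vel v w \<sigma> = (v + w) /\<^sub>R 2 + (norm (v - w) / 2) *\<^sub>R \<sigma>"

definition post_vel_star :: "'a::euclidean_space \<Rightarrow> 'a \<Rightarrow> 'a \<Rightarrow> 'a" where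
  "post_vel_star v w \<sigma> = (v + w) /\<^sub>R 2 - (norm (v - w) / 2) *\<^sub>R \<sigma>"

definition cos_dev :: "'a::euclidean_space \<Rightarrow> 'a \<Rightarrow> 'a \<Rightarrow> real" where
  "cos_dev v w \<sigma> = ((v - w) /\<^sub>R norm (v - w)) \<bullet> \<sigma>"

text \<open>
  Here \<open>w\<close> plays the role of \<open>v\<^sub>*\<close>.  The product measure is completed, so that the
  integral is meaningful for Lebesgue measurable, not only Borel measurable, \<open>f\<close> and \<open>B\<close>.
\<close>
definition collision_op ::
    "(real \<Rightarrow> real \<Rightarrow> real) \<Rightarrow> ('a::euclidean_space \<Rightarrow> real) \<Rightarrow> 'a \<Rightarrow> real" where
  "collision_op B f v =
     (LINT (w, \<sigma>) | completion (lborel \<Otimes>\<^sub>M sphere_measure).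
        B (norm (v - w)) (cos_dev v w \<sigma>) *
        (f (post_vel_star v w \<sigma>) * f (post_vel v w \<sigma>) - f w * f v))"

text \<open>
  Elements of \<open>L\<^sup>1\<close> are represented by functions, equality in \<open>L\<^sup>1\<close> being equality almost everywhere.
  The last conjunct is the integral equation: the \<open>L\<^sup>1\<close>-valued time integral of the collision term
  exists (the collision term is integrable on \<open>[0,t] \<times> \<real>\<^sup>d\<close>) and, by Fubini, it is computed
  pointwise for almost every \<open>v\<close>.
\<close>
definition boltzmann_solution ::
    "(real \<Rightarrow> real \<Rightarrow> real) \<Rightarrow> ('a::euclidean_space \<Rightarrow> real) \<Rightarrow> (real \<Rightarrow> 'a \<Rightarrow> real) \<Rightarrow> bool" where
  "boltzmann_solution B f0 f \<longleftrightarrow>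
     (\<forall>t\<ge>0. \<forall>v. 0 \<le> f t v) \<and>
     (\<lambda>(t, v). f t v) \<in> borel_measurable (lebesgue_on ({0..} \<times> UNIV)) \<and>
     (\<forall>t\<ge>0. integrable lebesgue (f t)) \<and>
     (\<forall>t\<ge>0. ((\<lambda>s. LINT v|lebesgue. \<bar>f s v - f t v\<bar>) \<longlongrightarrow> 0) (at t within {0..})) \<and>
     (\<forall>T\<ge>0. \<exists>K::real. AE t in lebesgue_on {0..T}.
        (\<integral>\<^sup>+ v. ennreal (f t v * (1 + (norm v)\<^sup>2)) \<partial>lebesgue) \<le> ennreal K) \<and>
     (\<forall>t\<ge>0.
        integrable (lebesgue_on ({0..t} \<times> UNIV)) (\<lambda>(\<tau>, v). collision_op B (f \<tau>) v) \<and>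
        (AE v in lebesgue.
           f t v = f0 v + (LINT \<tau>|lebesgue_on {0..t}. collision_op B (f \<tau>) v)))"

definition energy_conserving ::
    "('a::euclidean_space \<Rightarrow> real) \<Rightarrow> (real \<Rightarrow> 'a \<Rightarrow> real) \<Rightarrow> bool" where
  "energy_conserving f0 f \<longleftrightarrow>
     (\<forall>t\<ge>0. (\<integral>\<^sup>+ v. ennreal ((norm v)\<^sup>2 * f t v) \<partial>lebesgue) =
             (\<integral>\<^sup>+ v. ennreal ((norm v)\<^sup>2 * f0 v) \<partial>lebesgue))"

end

theory Submission
  imports Defs
begin

text \<open>
  Testing the equation with a bounded function and using that the collision map preserves the
  measure gives the weak form, whose integrand is \<open>|v - w|\<^sup>\<beta>\<close> times gain minus loss.  Only the sum over
  the exchange \<open>v \<leftrightarrow> w\<close> matters, and conservation of energy makes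
  \<open>n\<^sup>q |v|\<^sup>2 - |v|\<^sup>2 min(|v|\<^sup>2, n)\<^sup>q\<close> an admissible test function; Gronwall's inequality and \<open>n \<rightarrow> \<infinity>\<close>
  give all moments locally in time, starting from the moments of the initial datum.

  Averaging over the sphere makes the gain of \<open>|v|\<^sup>2\<^sup>p\<close> at most
  \<open>\<epsilon> (|v|\<^sup>2 + |w|\<^sup>2)\<^sup>p\<close> times the total mass of \<open>b\<close> once \<open>p\<close> is large, because
  \<open>|v'|\<^sup>2 < (1 - \<delta>) (|v|\<^sup>2 + |w|\<^sup>2)\<close> outside small caps.  Hence every high moment decreases when it is
  large, which yields moment bounds uniform in time.  The same estimate is then applied to
  \<open>X = \<Sum>k=k\<^sub>0..n. a\<^sup>k |v|\<^sup>s\<^sup>k / k!\<close>: with \<open>Y\<close> the same sum weighted by \<open>|v|\<^sup>\<beta>\<close> the gain is of order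
  \<open>\<epsilon> X Y\<close>, since \<open>|v|\<^sup>s\<close> is subadditive in \<open>|v|\<^sup>2\<close>, while the loss is of order \<open>M Y\<close>.  With \<open>\<epsilon>\<close> small first and
  then \<open>a\<close> small, \<open>X\<close> cannot cross a level independent of \<open>n\<close>, and \<open>n \<rightarrow> \<infinity>\<close> finishes the proof.
\<close>

section \<open>Polar coordinates and the distribution of the cosine on the sphere\<close>

text \<open>The equation is available only against bounded test functions, and at positive times
  nothing beyond the energy is known to be finite, so powers and exponentials cannot be tested
  directly. Conservation of energy opens the way: n^q |v|^2 - |v|^2 min(|v|^2, n)^q vanishes once
  |v|^2 \<ge> n, and since the energy does not move, its increments are minus those of the truncated
  moment. The other obstacle is uniformity: \<open>C\<close> and \<open>a\<close> have to be fixed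
  before s and the solution. Thresholds are therefore computed with \<beta> instead of s, and
  circularity is avoided because the barrier level \<open>A1\<close> depends only on M, E and
  \<open>C0\<close>. It determines \<epsilon>, which determines \<open>k0\<close>, which determines
  the degree p of the one polynomial moment needed; the bound of that moment enters the choice of a.
  The terms of degree below \<open>k0\<close> have no small angular factor; all but the constant one
  contain a power of a, and that moment pays for them.\<close>

lemma measurable_sphere_measure_ident:
  "(\<lambda>x. x) \<in> (sphere_measure :: 'a::euclidean_space measure) \<rightarrow>\<^sub>M borel"
  unfolding measurable_cong_sets[OF sets_scale_measure refl] sphere_measure_def
  by (simp add: measurable_restrict_space1)

text \<open>\<open>sphere_measure\<close> has the Borel sets of the sphere as its sigma-algebra. Its
  image on the whole space has all Borel sets, so functions defined everywhere need no restriction;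
  the price is that unit length holds only almost everywhere.\<close>

definition usphere :: "'a::euclidean_space measure" where
  "usphere = distr sphere_measure borel (\<lambda>x. x)"

lemma sets_usphere [simp, measurable_cong]: "sets usphere = sets borel"
  by (simp add: usphere_def)

lemma space_usphere [simp]: "space usphere = UNIV"
  by (simp add: usphere_def)

lemma nn_integral_usphere:
  fixes g :: "'a::euclidean_space \<Rightarrow> ennreal"
  assumes [measurable]: "g \<in> borel_measurable borel"
  shows "(\<integral>\<^sup>+ x. g x \<partial>usphere) =
    of_nat DIM('a) * (\<integral>\<^sup>+ x. g (x /\<^sub>R norm x) * indicator {x. x \<noteq> 0 \<and> norm x < 1} x \<partial>lborel)"
proof -
  let ?M = "restrict_space lborel (ball 0 1 - {0}) :: 'a measure"
  have m: "(\<lambda>x. x /\<^sub>R norm x) \<in> measurable ?M (restrict_space borel (sphere 0 1))"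
    by (intro measurable_restrict_space2 measurable_restrict_space1)
       (auto simp: space_restrict_space)
  have g: "g \<in> borel_measurable (restrict_space borel (sphere 0 1))"
    by (intro measurable_restrict_space1) measurable
  have S: "{x::'a. x \<noteq> 0 \<and> norm x < 1} = ball 0 1 - {0}" by auto
  have "(\<integral>\<^sup>+ x. g x \<partial>usphere) = (\<integral>\<^sup>+ x. g x \<partial>sphere_measure)"
    unfolding usphere_def by (intro nn_integral_distr measurable_sphere_measure_ident) auto
  also have "\<dots> = of_nat DIM('a) * (\<integral>\<^sup>+ x. g (x /\<^sub>R norm x) * indicator {x. x \<noteq> 0 \<and> norm x < 1} x \<partial>lborel)"
    unfolding sphere_measure_def S
    using m g
    by (subst nn_integral_scale_measure) (simp_all add: nn_integral_distr nn_integral_restrict_space)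
  finally show ?thesis .
qed

lemma emeasure_usphere_UNIV:
  "emeasure (usphere :: 'a::euclidean_space measure) UNIV = of_nat DIM('a) * emeasure lborel (ball 0 1 :: 'a set)"
  unfolding usphere_def
  by (subst emeasure_distr[OF measurable_sphere_measure_ident])
     (simp_all add: space_sphere_measure emeasure_sphere_measure_space)

lemma finite_measure_usphere: "finite_measure (usphere :: 'a::euclidean_space measure)"
proof
  have "emeasure (lborel::'a measure) (ball 0 1) < \<infinity>"
    by (rule emeasure_lborel_ball_finite)
  then show "emeasure (usphere :: 'a::euclidean_space measure) (space usphere) \<noteq> \<infinity>"
    by (auto simp: emeasure_usphere_UNIV ennreal_mult_eq_top_iff)
qed

lemma emeasure_usphere_pos: "emeasure (usphere :: 'a::euclidean_space measure) UNIV > 0"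
proof -
  have "emeasure (lborel::'a measure) (ball 0 1) \<noteq> 0"
    using open_not_negligible[of "ball (0::'a) 1"]
    by (auto simp: negligible_iff_null_sets null_sets_def)
  then show ?thesis
    by (simp add: emeasure_usphere_UNIV zero_less_iff_neq_zero)
qed

lemma nn_integral_lborel_translate:
  fixes g :: "'a::euclidean_space \<Rightarrow> ennreal"
  assumes [measurable]: "g \<in> borel_measurable borel"
  shows "(\<integral>\<^sup>+ x. g (c + x) \<partial>lborel) = (\<integral>\<^sup>+ x. g x \<partial>lborel)"
proof -
  have "(\<integral>\<^sup>+ x. g x \<partial>lborel) = (\<integral>\<^sup>+ x. g x \<partial>distr lborel borel ((+) c))"
    by (simp add: lborel_distr_plus)
  also have "\<dots> = (\<integral>\<^sup>+ x. g (c + x) \<partial>lborel)"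
    by (subst nn_integral_distr) auto
  finally show ?thesis by simp
qed

lemma nn_integral_lborel_scale:
  fixes g :: "'a::euclidean_space \<Rightarrow> ennreal"
  assumes [measurable]: "g \<in> borel_measurable borel" and "c \<noteq> 0"
  shows "(\<integral>\<^sup>+ x. g x \<partial>lborel) = ennreal (\<bar>c\<bar> ^ DIM('a)) * (\<integral>\<^sup>+ x. g (c *\<^sub>R x) \<partial>lborel)"
  by (subst lborel_affine[OF \<open>c \<noteq> 0\<close>, of 0])
     (simp add: nn_integral_density nn_integral_distr nn_integral_cmult ennreal_power)

text \<open>In polar coordinates a point is reached through all dilations t > 1, with this weight in
  dimension n; total mass 1 is what makes the radial weight come out right. The primitive is -1 /
  t^n.\<close>

lemma nn_integral_inverse_power:
  assumes "0 < n"
  shows "(\<integral>\<^sup>+ t. ennreal (real n / t ^ Suc n) * indicator {1<..} t \<partial>lborel) = 1"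
proof -
  have "(\<integral>\<^sup>+ t. ennreal (real n / t ^ Suc n) * indicator {1<..} t \<partial>lborel)
      = (\<integral>\<^sup>+ t. ennreal (real n / t ^ Suc n) * indicator {1..} t \<partial>lborel)"
    by (intro nn_integral_cong_AE, use AE_lborel_singleton[of "1::real"] in eventually_elim)
      (auto split: split_indicator)
  also have "\<dots> = ennreal (0 - (- 1 / 1 ^ n))"
  proof (rule nn_integral_FTC_atLeast[where F="\<lambda>t. - 1 / t ^ n"])
    show "DERIV (\<lambda>t. - 1 / t ^ n) x :> real n / x ^ Suc n" if "1 \<le> x" for x :: real
    proof -
      from assms obtain m where m: "n = Suc m" by (cases n) auto
      have "DERIV (\<lambda>t. - inverse (t ^ n)) x :> - (- (inverse (x ^ n) * (real n * x ^ (n - Suc 0)) * inverse (x ^ n)))"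
        using that by (intro DERIV_minus DERIV_inverse' DERIV_pow) auto
      also have "- (- (inverse (x ^ n) * (real n * x ^ (n - Suc 0)) * inverse (x ^ n))) = real n / x ^ Suc n"
        using that unfolding m by (simp add: divide_simps)
      finally show ?thesis by (simp add: divide_inverse)
    qed
    have "((\<lambda>t::real. - inverse (t ^ n)) \<longlongrightarrow> - 0) at_top"
      using filterlim_pow_at_top[OF assms filterlim_ident] by (intro tendsto_minus tendsto_inverse_0_at_top)
    then show "((\<lambda>t::real. - 1 / t ^ n) \<longlongrightarrow> 0) at_top"
      by (simp add: divide_inverse)
  qed auto
  finally show ?thesis by simp
qed

text \<open>
  Writing the sphere as the cone over the unit ball, \<open>r x/|x|\<close> with \<open>|x| < 1\<close> is reached by scaling
  \<open>y = r x\<close> first and then substituting \<open>r = |y| t\<close>.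
\<close>
lemma nn_integral_polar:
  fixes F :: "'a::euclidean_space \<Rightarrow> ennreal"
  assumes [measurable]: "F \<in> borel_measurable borel"
  shows "(\<integral>\<^sup>+ u. F u \<partial>lborel) =
    (\<integral>\<^sup>+ r. ennreal (r ^ (DIM('a) - 1)) * indicator {0<..} r *
       (\<integral>\<^sup>+ s. F (r *\<^sub>R s) \<partial>usphere) \<partial>lborel)"
proof -
  let ?d = "DIM('a)"
  obtain m where m: "?d = Suc m" using DIM_positive[where 'a='a] by (cases ?d) auto
  have step1: "ennreal (r ^ (?d - 1)) * (\<integral>\<^sup>+ s. F (r *\<^sub>R s) \<partial>usphere) =
     (\<integral>\<^sup>+ y. ennreal (real ?d / r) * F (r *\<^sub>R (y /\<^sub>R norm y)) * indicator {y. y \<noteq> 0 \<and> norm y < r} y \<partial>lborel)"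
    if r: "r > 0" for r :: real
  proof -
    have "(\<integral>\<^sup>+ x. F (r *\<^sub>R (x /\<^sub>R norm x)) * indicator {x. x \<noteq> 0 \<and> norm x < 1} x \<partial>lborel)
        = ennreal (\<bar>1 / r\<bar> ^ ?d) * (\<integral>\<^sup>+ x. F (r *\<^sub>R (((1/r) *\<^sub>R x) /\<^sub>R norm ((1/r) *\<^sub>R x))) *
            indicator {x. x \<noteq> 0 \<and> norm x < 1} ((1/r) *\<^sub>R x) \<partial>lborel)"
    proof (rule nn_integral_lborel_scale)
      show "(\<lambda>x. F (r *\<^sub>R (x /\<^sub>R norm x)) * indicator {x. x \<noteq> 0 \<and> norm x < 1} x) \<in> borel_measurable borel"
        by measurable
    qed (use r in auto)
    also have "\<dots> = ennreal ((1 / r) ^ ?d) * (\<integral>\<^sup>+ x. F (r *\<^sub>R (x /\<^sub>R norm x)) *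
            indicator {y. y \<noteq> 0 \<and> norm y < r} x \<partial>lborel)"
      using r by (intro arg_cong2[where f="(*)"] nn_integral_cong)
        (auto split: split_indicator simp: field_simps)
    finally have *: "(\<integral>\<^sup>+ s. F (r *\<^sub>R s) \<partial>usphere) =
       of_nat ?d * (ennreal ((1 / r) ^ ?d) * (\<integral>\<^sup>+ x. F (r *\<^sub>R (x /\<^sub>R norm x)) *
            indicator {y. y \<noteq> 0 \<and> norm y < r} x \<partial>lborel))"
      by (subst nn_integral_usphere) auto
    have c: "ennreal (r ^ (?d - 1)) * (of_nat ?d * ennreal ((1 / r) ^ ?d)) = ennreal (real ?d / r)"
    proof -
      have "r ^ (?d - 1) * (real ?d * (1 / r) ^ ?d) = real ?d / r"
        using r unfolding m by (simp add: field_simps)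
      then show ?thesis
        using r unfolding ennreal_of_nat_eq_real_of_nat by (simp add: ennreal_mult'[symmetric])
    qed
    show ?thesis
      unfolding * using c
      by (simp add: nn_integral_cmult[symmetric] mult.assoc[symmetric])
  qed
  have "(\<integral>\<^sup>+ r. ennreal (r ^ (?d - 1)) * indicator {0<..} r *
       (\<integral>\<^sup>+ s. F (r *\<^sub>R s) \<partial>usphere) \<partial>lborel)
     = (\<integral>\<^sup>+ r. \<integral>\<^sup>+ y. ennreal (real ?d / r) * F (r *\<^sub>R (y /\<^sub>R norm y)) *
          indicator {z. snd z > 0 \<and> fst z \<noteq> 0 \<and> norm (fst z) < snd z} (y, r) \<partial>lborel \<partial>lborel)"
  proof (intro nn_integral_cong)
    fix r :: real
    show "ennreal (r ^ (?d - 1)) * indicator {0<..} r * (\<integral>\<^sup>+ s. F (r *\<^sub>R s) \<partial>usphere) =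
      (\<integral>\<^sup>+ y. ennreal (real ?d / r) * F (r *\<^sub>R (y /\<^sub>R norm y)) *
          indicator {z. snd z > 0 \<and> fst z \<noteq> 0 \<and> norm (fst z) < snd z} (y, r) \<partial>lborel)"
    proof (cases "r > 0")
      case True
      then show ?thesis
        using step1[OF True] by (auto intro!: nn_integral_cong split: split_indicator)
    qed auto
  qed
  also have "\<dots> = (\<integral>\<^sup>+ y. \<integral>\<^sup>+ r. ennreal (real ?d / r) * F (r *\<^sub>R (y /\<^sub>R norm y)) *
          indicator {z. snd z > 0 \<and> fst z \<noteq> 0 \<and> norm (fst z) < snd z} (y, r) \<partial>lborel \<partial>lborel)"
    by (intro lborel_pair.Fubini') measurable
  also have "\<dots> = (\<integral>\<^sup>+ y. \<integral>\<^sup>+ t. ennreal (real ?d / t) * F (t *\<^sub>R y) * indicator {1<..} t \<partial>lborel \<partial>lborel)"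
  proof (rule nn_integral_cong_AE, use AE_lborel_singleton[of "0::'a"] in eventually_elim)
    fix y :: 'a assume y: "y \<noteq> 0"
    have "(\<integral>\<^sup>+ r. ennreal (real ?d / r) * F (r *\<^sub>R (y /\<^sub>R norm y)) *
          indicator {z. snd z > 0 \<and> fst z \<noteq> 0 \<and> norm (fst z) < snd z} (y, r) \<partial>lborel)
       = ennreal \<bar>norm y\<bar> * (\<integral>\<^sup>+ t. ennreal (real ?d / (0 + norm y * t)) *
             F ((0 + norm y * t) *\<^sub>R (y /\<^sub>R norm y)) *
          indicator {z. snd z > 0 \<and> fst z \<noteq> 0 \<and> norm (fst z) < snd z} (y, 0 + norm y * t) \<partial>lborel)"
    proof (rule nn_integral_real_affine)
      show "(\<lambda>r. ennreal (real ?d / r) * F (r *\<^sub>R (y /\<^sub>R norm y)) *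
          indicator {z. snd z > 0 \<and> fst z \<noteq> 0 \<and> norm (fst z) < snd z} (y, r)) \<in> borel_measurable borel"
        unfolding indicator_def mem_Collect_eq fst_conv snd_conv of_bool_def by measurable
    qed (use y in simp)
    also have "\<dots> = (\<integral>\<^sup>+ t. ennreal \<bar>norm y\<bar> * (ennreal (real ?d / (0 + norm y * t)) *
             F ((0 + norm y * t) *\<^sub>R (y /\<^sub>R norm y)) *
          indicator {z. snd z > 0 \<and> fst z \<noteq> 0 \<and> norm (fst z) < snd z} (y, 0 + norm y * t)) \<partial>lborel)"
      unfolding indicator_def mem_Collect_eq fst_conv snd_conv of_bool_def
      by (intro nn_integral_cmult[symmetric]) measurable
    also have "\<dots> = (\<integral>\<^sup>+ t. ennreal (real ?d / t) * F (t *\<^sub>R y) * indicator {1<..} t \<partial>lborel)"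
    proof (intro nn_integral_cong)
      fix t :: real
      have "ennreal (norm y) * ennreal (real ?d / (norm y * t)) = ennreal (real ?d / t)" if "t > 1"
        using y that by (simp add: ennreal_mult'[symmetric])
      moreover have e: "(norm y * t) *\<^sub>R (y /\<^sub>R norm y) = t *\<^sub>R y" using y by simp
      moreover have "0 < norm y * t \<and> norm y < norm y * t \<longleftrightarrow> 1 < t"
        using y by (auto simp: zero_less_mult_iff)
      ultimately show "ennreal \<bar>norm y\<bar> * (ennreal (real ?d / (0 + norm y * t)) *
             F ((0 + norm y * t) *\<^sub>R (y /\<^sub>R norm y)) *
          indicator {z. snd z > 0 \<and> fst z \<noteq> 0 \<and> norm (fst z) < snd z} (y, 0 + norm y * t)) =
          ennreal (real ?d / t) * F (t *\<^sub>R y) * indicator {1<..} t"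
        unfolding add_0_left e using y
        by (auto split: split_indicator simp: mult.assoc[symmetric])
    qed
    finally show "(\<integral>\<^sup>+ r. ennreal (real ?d / r) * F (r *\<^sub>R (y /\<^sub>R norm y)) *
          indicator {z. snd z > 0 \<and> fst z \<noteq> 0 \<and> norm (fst z) < snd z} (y, r) \<partial>lborel) =
        (\<integral>\<^sup>+ t. ennreal (real ?d / t) * F (t *\<^sub>R y) * indicator {1<..} t \<partial>lborel)" .
  qed
  also have "\<dots> = (\<integral>\<^sup>+ t. \<integral>\<^sup>+ y. ennreal (real ?d / t) * F (t *\<^sub>R y) * indicator {1<..} t \<partial>lborel \<partial>lborel)"
    by (intro lborel_pair.Fubini') measurable
  \<comment> \<open>For fixed t the dilation costs t^(-d), so the integral of F factors out and only
    the weight d / t^(d+1) is left, whose integral is 1.\<close>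
  also have "\<dots> = (\<integral>\<^sup>+ t. ennreal (real ?d / t ^ Suc ?d) * indicator {1<..} t * (\<integral>\<^sup>+ y. F y \<partial>lborel) \<partial>lborel)"
  proof (intro nn_integral_cong)
    fix t :: real
    show "(\<integral>\<^sup>+ y. ennreal (real ?d / t) * F (t *\<^sub>R y) * indicator {1<..} t \<partial>lborel) =
       ennreal (real ?d / t ^ Suc ?d) * indicator {1<..} t * (\<integral>\<^sup>+ y. F y \<partial>lborel)"
    proof (cases "1 < t")
      case True
      have "ennreal (real ?d / t ^ Suc ?d) * (\<integral>\<^sup>+ y. F y \<partial>lborel) =
         ennreal (real ?d / t ^ Suc ?d) * (ennreal (\<bar>t\<bar> ^ ?d) * (\<integral>\<^sup>+ y. F (t *\<^sub>R y) \<partial>lborel))"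
        using True by (subst nn_integral_lborel_scale[of F t]) auto
      also have "\<dots> = ennreal (real ?d / t) * (\<integral>\<^sup>+ y. F (t *\<^sub>R y) \<partial>lborel)"
        using True by (simp add: mult.assoc[symmetric] ennreal_mult'[symmetric])
      finally show ?thesis using True by (simp add: nn_integral_cmult)
    qed auto
  qed
  also have "\<dots> = (\<integral>\<^sup>+ y. F y \<partial>lborel)"
    by (subst nn_integral_multc) (simp_all add: nn_integral_inverse_power del: power_Suc)
  finally show ?thesis by simp
qed

interpretation usphere: finite_measure "usphere :: 'a::euclidean_space measure"
  by (rule finite_measure_usphere)

lemma AE_usphere_norm: "AE s in (usphere :: 'a::euclidean_space measure). norm s = 1"
  unfolding usphere_def
  by (subst AE_distr_iff[OF measurable_sphere_measure_ident]) (auto simp: space_sphere_measure)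

text \<open>Writing u = r w, the radial weight sees only r, and the product of two copies of the
  sphere measure is symmetric in w and s. This exchange of directions is the heart of the invariance
  of the collision map.\<close>

lemma nn_integral_usphere_swap:
  fixes H :: "'a::euclidean_space \<times> 'a \<Rightarrow> ennreal"
  assumes [measurable]: "H \<in> borel_measurable borel"
  shows "(\<integral>\<^sup>+ u. \<integral>\<^sup>+ s. H (u, s) \<partial>usphere \<partial>lborel) =
    (\<integral>\<^sup>+ u. \<integral>\<^sup>+ s. H (norm u *\<^sub>R s, u /\<^sub>R norm u) \<partial>usphere \<partial>lborel)"
proof -
  interpret sp: pair_sigma_finite "usphere :: 'a measure" "usphere :: 'a measure" ..
  have [measurable]: "H \<in> borel_measurable (borel \<Otimes>\<^sub>M borel)"
    by (simp add: borel_prod)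
  have "(\<integral>\<^sup>+ u. \<integral>\<^sup>+ s. H (u, s) \<partial>usphere \<partial>lborel) =
     (\<integral>\<^sup>+ r. ennreal (r ^ (DIM('a) - 1)) * indicator {0<..} r *
       (\<integral>\<^sup>+ w. \<integral>\<^sup>+ s. H (r *\<^sub>R w, s) \<partial>usphere \<partial>usphere) \<partial>lborel)"
    by (intro nn_integral_polar) measurable
  also have "\<dots> = (\<integral>\<^sup>+ r. ennreal (r ^ (DIM('a) - 1)) * indicator {0<..} r *
       (\<integral>\<^sup>+ w. \<integral>\<^sup>+ s. H (r *\<^sub>R s, w) \<partial>usphere \<partial>usphere) \<partial>lborel)"
    by (intro nn_integral_cong arg_cong2[where f="(*)"] refl sp.Fubini') measurable
  also have "\<dots> = (\<integral>\<^sup>+ r. ennreal (r ^ (DIM('a) - 1)) * indicator {0<..} r *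
       (\<integral>\<^sup>+ w. \<integral>\<^sup>+ s. H (norm (r *\<^sub>R w) *\<^sub>R s, (r *\<^sub>R w) /\<^sub>R norm (r *\<^sub>R w)) \<partial>usphere \<partial>usphere) \<partial>lborel)"
  proof (intro nn_integral_cong)
    fix r :: real
    have "(\<integral>\<^sup>+ w. \<integral>\<^sup>+ s. H (r *\<^sub>R s, w) \<partial>usphere \<partial>usphere) =
        (\<integral>\<^sup>+ w. \<integral>\<^sup>+ s. H (norm (r *\<^sub>R w) *\<^sub>R s, (r *\<^sub>R w) /\<^sub>R norm (r *\<^sub>R w)) \<partial>usphere \<partial>usphere)"
      if "r > 0"
      by (rule nn_integral_cong_AE, use AE_usphere_norm in eventually_elim) (use that in simp)
    then show "ennreal (r ^ (DIM('a) - 1)) * indicator {0<..} r *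
       (\<integral>\<^sup>+ w. \<integral>\<^sup>+ s. H (r *\<^sub>R s, w) \<partial>usphere \<partial>usphere) =
      ennreal (r ^ (DIM('a) - 1)) * indicator {0<..} r *
       (\<integral>\<^sup>+ w. \<integral>\<^sup>+ s. H (norm (r *\<^sub>R w) *\<^sub>R s, (r *\<^sub>R w) /\<^sub>R norm (r *\<^sub>R w)) \<partial>usphere \<partial>usphere)"
      by (auto split: split_indicator)
  qed
  also have "\<dots> = (\<integral>\<^sup>+ u. \<integral>\<^sup>+ s. H (norm u *\<^sub>R s, u /\<^sub>R norm u) \<partial>usphere \<partial>lborel)"
    by (intro nn_integral_polar[symmetric]) measurable
  finally show ?thesis .
qed

lemma nn_integral_usphere_uminus:
  fixes g :: "'a::euclidean_space \<Rightarrow> ennreal"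
  assumes [measurable]: "g \<in> borel_measurable borel"
  shows "(\<integral>\<^sup>+ s. g (- s) \<partial>usphere) = (\<integral>\<^sup>+ s. g s \<partial>usphere)"
proof -
  have "(\<integral>\<^sup>+ x. g (x /\<^sub>R norm x) * indicator {x. x \<noteq> 0 \<and> norm x < 1} x \<partial>lborel) =
      (\<integral>\<^sup>+ x. g (- (x /\<^sub>R norm x)) * indicator {x. x \<noteq> 0 \<and> norm x < 1} x \<partial>lborel)"
  proof (subst nn_integral_lborel_scale[of _ "-1"])
    show "(\<lambda>x. g (x /\<^sub>R norm x) * indicator {x. x \<noteq> 0 \<and> norm x < 1} x) \<in> borel_measurable borel"
      by measurable
  qed (auto intro!: nn_integral_cong split: split_indicator)
  then show ?thesis by (simp add: nn_integral_usphere)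
qed

text \<open>Integration along the lines parallel to e without coordinates on the orthogonal
  hyperplane: the slab 0 < x \<bullet> e < 1 has thickness one and so stands in for a copy of the
  hyperplane.\<close>

lemma nn_integral_lborel_lines:
  fixes F :: "'a::euclidean_space \<Rightarrow> ennreal"
  assumes [measurable]: "F \<in> borel_measurable borel" and e: "norm e = 1"
  shows "(\<integral>\<^sup>+ x. F x \<partial>lborel) =
    (\<integral>\<^sup>+ x. indicator {x. 0 < x \<bullet> e \<and> x \<bullet> e < 1} x *
      (\<integral>\<^sup>+ z. F (z *\<^sub>R e + (x - (x \<bullet> e) *\<^sub>R e)) \<partial>lborel) \<partial>lborel)"
proof -
  let ?S = "{x. 0 < x \<bullet> e \<and> x \<bullet> e < 1}"
  have ee: "e \<bullet> e = 1" using e by (simp add: dot_square_norm)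
  have "(\<integral>\<^sup>+ x. indicator ?S x * (\<integral>\<^sup>+ z. F (z *\<^sub>R e + (x - (x \<bullet> e) *\<^sub>R e)) \<partial>lborel) \<partial>lborel)
     = (\<integral>\<^sup>+ x. \<integral>\<^sup>+ z. indicator ?S x * F (x + z *\<^sub>R e) \<partial>lborel \<partial>lborel)"
  proof (intro nn_integral_cong)
    fix x :: 'a
    have "(\<integral>\<^sup>+ z. F (z *\<^sub>R e + (x - (x \<bullet> e) *\<^sub>R e)) \<partial>lborel) =
       ennreal \<bar>1\<bar> * (\<integral>\<^sup>+ z. F ((x \<bullet> e + 1 * z) *\<^sub>R e + (x - (x \<bullet> e) *\<^sub>R e)) \<partial>lborel)"
      by (rule nn_integral_real_affine) auto
    also have "\<dots> = (\<integral>\<^sup>+ z. F (x + z *\<^sub>R e) \<partial>lborel)"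
      by (simp add: algebra_simps)
    finally show "indicator ?S x * (\<integral>\<^sup>+ z. F (z *\<^sub>R e + (x - (x \<bullet> e) *\<^sub>R e)) \<partial>lborel) =
        (\<integral>\<^sup>+ z. indicator ?S x * F (x + z *\<^sub>R e) \<partial>lborel)"
      by (simp add: nn_integral_cmult)
  qed
  also have "\<dots> = (\<integral>\<^sup>+ z. \<integral>\<^sup>+ x. indicator ?S x * F (x + z *\<^sub>R e) \<partial>lborel \<partial>lborel)"
    by (rule lborel_pair.Fubini'[symmetric]) measurable
  also have "\<dots> = (\<integral>\<^sup>+ z. \<integral>\<^sup>+ x. indicator ?S (x - z *\<^sub>R e) * F x \<partial>lborel \<partial>lborel)"
  proof (rule nn_integral_cong)
    fix z :: real
    have "(\<integral>\<^sup>+ x. indicator ?S (z *\<^sub>R e + x - z *\<^sub>R e) * F (z *\<^sub>R e + x) \<partial>lborel) =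
       (\<integral>\<^sup>+ x. indicator ?S (x - z *\<^sub>R e) * F x \<partial>lborel)"
      by (rule nn_integral_lborel_translate) measurable
    then show "(\<integral>\<^sup>+ x. indicator ?S x * F (x + z *\<^sub>R e) \<partial>lborel) =
       (\<integral>\<^sup>+ x. indicator ?S (x - z *\<^sub>R e) * F x \<partial>lborel)"
      by (simp add: add.commute)
  qed
  also have "\<dots> = (\<integral>\<^sup>+ x. \<integral>\<^sup>+ z. indicator ?S (x - z *\<^sub>R e) * F x \<partial>lborel \<partial>lborel)"
    by (rule lborel_pair.Fubini'[symmetric]) measurable
  \<comment> \<open>For each x the shifts z that bring x back into the slab form an interval of
    length one.\<close>
  also have "\<dots> = (\<integral>\<^sup>+ x. (\<integral>\<^sup>+ z. indicator {x \<bullet> e - 1<..<x \<bullet> e} z \<partial>lborel) * F x \<partial>lborel)"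
  proof (intro nn_integral_cong)
    fix x :: 'a
    have "indicator ?S (x - z *\<^sub>R e) = (indicator {x \<bullet> e - 1<..<x \<bullet> e} z :: ennreal)" for z
      by (auto split: split_indicator simp: inner_diff_left ee)
    then show "(\<integral>\<^sup>+ z. indicator ?S (x - z *\<^sub>R e) * F x \<partial>lborel) =
      (\<integral>\<^sup>+ z. indicator {x \<bullet> e - 1<..<x \<bullet> e} z \<partial>lborel) * F x"
      by (simp add: nn_integral_multc)
  qed
  also have "\<dots> = (\<integral>\<^sup>+ x. F x \<partial>lborel)"
    by simp
  finally show ?thesis by simp
qed

text \<open>Here \<rho> is the distance from the axis, z the height and t = z / sqrt (z^2 +
  \<rho>^2) the cosine of the angle. Then dt = \<rho>^2 (z^2 + \<rho>^2)^(-3/2) dz and 1 - t^2 =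
  \<rho>^2 / (z^2 + \<rho>^2), which gives dz = \<rho> (1 - t^2)^(-3/2) dt.\<close>

lemma nn_integral_cos_substitution:
  fixes g :: "real \<Rightarrow> real"
  assumes [measurable]: "g \<in> borel_measurable borel" and g: "\<And>t. 0 \<le> g t" and \<rho>: "0 < \<rho>"
  shows "(\<integral>\<^sup>+ z. ennreal (g (z / sqrt (z\<^sup>2 + \<rho>\<^sup>2))) * indicator {z. z\<^sup>2 + \<rho>\<^sup>2 \<le> 1} z \<partial>lborel) =
    (\<integral>\<^sup>+ t. ennreal (g t * (\<rho> * (1 - t\<^sup>2) powr (- 3 / 2))) * indicator {t. t\<^sup>2 + \<rho>\<^sup>2 \<le> 1} t \<partial>lborel)"
proof (cases "\<rho> \<le> 1")
  case False
  then have "\<not> t\<^sup>2 + \<rho>\<^sup>2 \<le> 1" for t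
  proof -
    have "1 < \<rho>\<^sup>2" using False by (simp add: one_less_power)
    then show ?thesis using zero_le_power2[of t] by linarith
  qed
  then show ?thesis by simp
next
  case True
  define Z where "Z = sqrt (1 - \<rho>\<^sup>2)"
  have \<rho>1: "\<rho>\<^sup>2 \<le> 1" using True \<rho> by (simp add: power_le_one)
  have Z: "0 \<le> Z" "Z\<^sup>2 = 1 - \<rho>\<^sup>2" using \<rho>1 by (simp_all add: Z_def)
  have iv: "{z. z\<^sup>2 + \<rho>\<^sup>2 \<le> 1} = {-Z..Z}"
  proof -
    have "z\<^sup>2 + \<rho>\<^sup>2 \<le> 1 \<longleftrightarrow> \<bar>z\<bar> \<le> Z" for z
      using Z by (metis Z_def add.commute add_le_imp_le_diff le_diff_eq real_sqrt_abs real_sqrt_le_iff)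
    then have "z\<^sup>2 + \<rho>\<^sup>2 \<le> 1 \<longleftrightarrow> - Z \<le> z \<and> z \<le> Z" for z
      by (metis abs_le_iff minus_le_iff)
    then show ?thesis by (simp add: set_eq_iff)
  qed
  define G where "G = (\<lambda>z::real. z / sqrt (z\<^sup>2 + \<rho>\<^sup>2))"
  define G' where "G' = (\<lambda>z::real. \<rho>\<^sup>2 / (sqrt (z\<^sup>2 + \<rho>\<^sup>2)) ^ 3)"
  have q: "0 < z\<^sup>2 + \<rho>\<^sup>2" for z using \<rho> by (simp add: add_nonneg_pos)
  \<comment> \<open>At the ends of the chord of the unit ball the root equals 1, so they are fixed
    points, and the condition on z turns into the same condition on t.\<close>
  have GZ: "G Z = Z" "G (- Z) = - Z" using Z \<rho> by (auto simp: G_def)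
  have dG: "(G has_real_derivative G' z) (at z)" for z
  proof -
    define r where "r = sqrt (z\<^sup>2 + \<rho>\<^sup>2)"
    have r: "0 < r" "r\<^sup>2 = z\<^sup>2 + \<rho>\<^sup>2" using q[of z] by (auto simp: r_def)
    have "((\<lambda>z. z\<^sup>2 + \<rho>\<^sup>2) has_real_derivative 2 * z) (at z)"
      by (auto intro!: derivative_eq_intros)
    then have "((\<lambda>z. sqrt (z\<^sup>2 + \<rho>\<^sup>2)) has_real_derivative (inverse r / 2) * (2 * z)) (at z)"
      unfolding r_def
      by (rule DERIV_chain2[where f=sqrt and g="\<lambda>z. z\<^sup>2 + \<rho>\<^sup>2", OF DERIV_real_sqrt[OF q]])
    then have "(G has_real_derivative (1 * r - z * (inverse r / 2 * (2 * z))) / (r * r)) (at z)"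
      unfolding G_def using DERIV_divide[OF DERIV_ident] r(1) by (fastforce simp: r_def)
    also have "(1 * r - z * (inverse r / 2 * (2 * z))) / (r * r) = (r\<^sup>2 - z\<^sup>2) / r ^ 3"
      using r(1) by (simp add: field_simps power2_eq_square power3_eq_cube)
    also have "\<dots> = G' z" by (simp add: G'_def r(2) flip: r_def)
    finally show ?thesis .
  qed
  have key: "G' z * (\<rho> * (1 - (G z)\<^sup>2) powr (- 3 / 2)) = 1" for z
  proof -
    define r where "r = sqrt (z\<^sup>2 + \<rho>\<^sup>2)"
    have r: "0 < r" "r\<^sup>2 = z\<^sup>2 + \<rho>\<^sup>2" using q[of z] by (auto simp: r_def)
    have "1 - (G z)\<^sup>2 = (r\<^sup>2 - z\<^sup>2) / r\<^sup>2"
      using r(1) by (simp add: G_def power_divide diff_divide_distrib flip: r_def)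
    also have "\<dots> = (\<rho> / r)\<^sup>2"
      using r(2) by (simp add: power_divide)
    also have "\<dots> = (\<rho> / r) powr 2" using r(1) \<rho> by (simp add: powr_numeral)
    finally have "(1 - (G z)\<^sup>2) powr (- 3 / 2) = (\<rho> / r) powr (- 3)"
      by (simp only: powr_powr) simp
    also have "\<dots> = inverse ((\<rho> / r) powr 3)" by (rule powr_minus)
    also have "(\<rho> / r) powr 3 = (\<rho> / r) ^ 3" using r(1) \<rho> by (intro powr_numeral) simp
    also have "inverse ((\<rho> / r) ^ 3) = (r / \<rho>) ^ 3" by (simp add: power_inverse[symmetric])
    finally show ?thesis using r(1) \<rho>
      by (simp add: G'_def flip: r_def) (simp add: field_simps power2_eq_square power3_eq_cube)
  qed
  have "(\<integral>\<^sup>+ t. ennreal (g t * (\<rho> * (1 - t\<^sup>2) powr (- 3 / 2))) * indicator {G (- Z)..G Z} t \<partial>lborel)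
     = (\<integral>\<^sup>+ z. ennreal (g (G z) * (\<rho> * (1 - (G z)\<^sup>2) powr (- 3 / 2)) * G' z) * indicator {- Z..Z} z \<partial>lborel)"
    unfolding nn_integral_set_ennreal
  proof (rule nn_integral_substitution)
    show "continuous_on {- Z..Z} G'"
      unfolding G'_def using q by (intro continuous_intros) (auto simp: less_le)
    show "set_borel_measurable borel {G (- Z)..G Z} (\<lambda>t. g t * (\<rho> * (1 - t\<^sup>2) powr (- 3 / 2)))"
      unfolding set_borel_measurable_def by measurable
    show "0 \<le> G' x" for x using q[of x] by (simp add: G'_def)
  qed (use dG Z in auto)
  also have "\<dots> = (\<integral>\<^sup>+ z. ennreal (g (G z)) * indicator {- Z..Z} z \<partial>lborel)"
  proof -
    have "g (G z) * (\<rho> * (1 - (G z)\<^sup>2) powr (- 3 / 2)) * G' z = g (G z)" for z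
      using key[of z] by (metis mult.assoc mult.commute mult.right_neutral)
    then show ?thesis by (simp only:)
  qed
  finally show ?thesis unfolding iv GZ by (simp add: G_def)
qed

text \<open>The cone over the sphere is cut into lines parallel to e and the height is replaced by
  the cosine t. For fixed t what remains is the integral of the distance from the axis over a
  cross-section of radius R = sqrt (1 - t^2). It scales like R^d, and with the factor (1 -
  t^2)^(-3/2) of the substitution this is the exponent (d - 3) / 2.\<close>

lemma nn_integral_usphere_cos_aux:
  fixes e :: "'a::euclidean_space"
  assumes dim: "DIM('a) \<ge> 2" and e: "norm e = 1"
  obtains \<kappa> :: ennreal where "\<And>g. g \<in> borel_measurable borel \<Longrightarrow> (\<And>t. 0 \<le> g t) \<Longrightarrow>
    (\<integral>\<^sup>+ s. ennreal (g (e \<bullet> s)) \<partial>usphere) =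
    \<kappa> * (\<integral>\<^sup>+ t. ennreal (g t * (1 - t\<^sup>2) powr ((real DIM('a) - 3) / 2)) * indicator {-1<..<1} t \<partial>lborel)"
proof
  let ?d = "DIM('a)"
  let ?S = "{x. 0 < x \<bullet> e \<and> x \<bullet> e < 1}"
  define P where "P = (\<lambda>x. x - (x \<bullet> e) *\<^sub>R e)"
  define J where "J = (\<lambda>R. \<integral>\<^sup>+ x. indicator ?S x * (ennreal (norm (P x)) * indicator {x. norm (P x) \<le> R} x) \<partial>lborel)"
  have Peq: "x - (x \<bullet> e) *\<^sub>R e = P x" for x by (simp add: P_def)
  have ee: "e \<bullet> e = 1" using e by (simp add: dot_square_norm)
  have [measurable]: "P \<in> borel_measurable borel" by (simp add: P_def)
  have Pline: "P (z *\<^sub>R e + P x) = P x" for z x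
    by (simp add: P_def algebra_simps inner_simps ee)
  have eline: "(z *\<^sub>R e + P x) \<bullet> e = z" for z x
    by (simp add: P_def inner_simps ee)
  have Pe: "P x \<bullet> e = 0" for x by (simp add: P_def inner_simps ee)
  have normline: "(norm (z *\<^sub>R e + P x))\<^sup>2 = z\<^sup>2 + (norm (P x))\<^sup>2" for z x
    unfolding power2_norm_eq_inner
    by (simp add: inner_simps ee Pe inner_commute[of e "P x"] power2_eq_square)
  have Pscale: "P (c *\<^sub>R x) = c *\<^sub>R P x" for c x
    by (simp add: P_def algebra_simps)
  \<comment> \<open>The thickness L of the slab enters linearly. This is used below because scaling
    also changes the thickness.\<close>
  have K: "(\<integral>\<^sup>+ x. indicator {x. 0 < x \<bullet> e \<and> x \<bullet> e < L} x * (ennreal (norm (P x)) * indicator {x. norm (P x) \<le> 1} x) \<partial>lborel)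
      = ennreal L * J 1" if "0 < L" for L
  proof -
    have "(\<integral>\<^sup>+ x. indicator {x. 0 < x \<bullet> e \<and> x \<bullet> e < L} x * (ennreal (norm (P x)) * indicator {x. norm (P x) \<le> 1} x) \<partial>lborel)
      = (\<integral>\<^sup>+ x. indicator ?S x * (\<integral>\<^sup>+ z. indicator {0<..<L} z * (ennreal (norm (P x)) * indicator {x. norm (P x) \<le> 1} x) \<partial>lborel) \<partial>lborel)"
    proof (subst nn_integral_lborel_lines[OF _ e])
      show "(\<lambda>x. indicator {x. 0 < x \<bullet> e \<and> x \<bullet> e < L} x * (ennreal (norm (P x)) * indicator {x. norm (P x) \<le> 1} x)) \<in> borel_measurable borel"
        by measurable
    qed (simp only: Peq Pline eline, simp add: indicator_def eline Pline)
    also have "\<dots> = (\<integral>\<^sup>+ x. ennreal L * (indicator ?S x * (ennreal (norm (P x)) * indicator {x. norm (P x) \<le> 1} x)) \<partial>lborel)"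
    proof (rule nn_integral_cong)
      fix x
      have "(\<integral>\<^sup>+ z. indicator {0<..<L} z * (ennreal (norm (P x)) * indicator {x. norm (P x) \<le> 1} x) \<partial>lborel)
        = ennreal L * (ennreal (norm (P x)) * indicator {x. norm (P x) \<le> 1} x)"
        using that by (subst nn_integral_multc) auto
      then show "indicator ?S x * (\<integral>\<^sup>+ z. indicator {0<..<L} z * (ennreal (norm (P x)) * indicator {x. norm (P x) \<le> 1} x) \<partial>lborel)
        = ennreal L * (indicator ?S x * (ennreal (norm (P x)) * indicator {x. norm (P x) \<le> 1} x))"
        by (simp only: mult.left_commute)
    qed
    also have "\<dots> = ennreal L * J 1"
      unfolding J_def by (intro nn_integral_cmult) measurable
    finally show ?thesis .
  qed
  \<comment> \<open>Scaling by R yields R^d from the volume, R from the distance and 1 / R from the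
    thickness of the slab.\<close>
  have J: "J R = ennreal (R ^ ?d) * J 1" if R: "0 < R" for R
  proof -
    have "J R = ennreal (\<bar>R\<bar> ^ ?d) * (\<integral>\<^sup>+ x. indicator ?S (R *\<^sub>R x) *
        (ennreal (norm (P (R *\<^sub>R x))) * indicator {x. norm (P x) \<le> R} (R *\<^sub>R x)) \<partial>lborel)"
      unfolding J_def
    proof (rule nn_integral_lborel_scale)
      show "(\<lambda>x. indicator ?S x * (ennreal (norm (P x)) * indicator {x. norm (P x) \<le> R} x)) \<in> borel_measurable borel"
        by measurable
    qed (use R in simp)
    also have "\<dots> = ennreal (R ^ ?d) * (\<integral>\<^sup>+ x. ennreal R * (indicator {x. 0 < x \<bullet> e \<and> x \<bullet> e < 1 / R} x *
        (ennreal (norm (P x)) * indicator {x. norm (P x) \<le> 1} x)) \<partial>lborel)"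
    proof (rule arg_cong2[where f="(*)"])
      have 1: "0 < (R *\<^sub>R x) \<bullet> e \<and> (R *\<^sub>R x) \<bullet> e < 1 \<longleftrightarrow> 0 < x \<bullet> e \<and> x \<bullet> e < 1 / R" for x
        using R by (simp add: zero_less_mult_iff pos_less_divide_eq mult.commute)
      have 2: "norm (P (R *\<^sub>R x)) = R * norm (P x)" "R * norm (P x) \<le> R \<longleftrightarrow> norm (P x) \<le> 1" for x
        using R by (simp_all add: Pscale)
      show "(\<integral>\<^sup>+ x. indicator ?S (R *\<^sub>R x) *
        (ennreal (norm (P (R *\<^sub>R x))) * indicator {x. norm (P x) \<le> R} (R *\<^sub>R x)) \<partial>lborel) =
        (\<integral>\<^sup>+ x. ennreal R * (indicator {x. 0 < x \<bullet> e \<and> x \<bullet> e < 1 / R} x *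
        (ennreal (norm (P x)) * indicator {x. norm (P x) \<le> 1} x)) \<partial>lborel)"
        unfolding indicator_def mem_Collect_eq 1 2 using R by (simp add: ennreal_mult mult_ac)
    qed (use R in simp)
    also have "\<dots> = ennreal (R ^ ?d) * (ennreal R * (ennreal (1 / R) * J 1))"
    proof -
      have "(\<integral>\<^sup>+ x. ennreal R * (indicator {x. 0 < x \<bullet> e \<and> x \<bullet> e < 1 / R} x *
        (ennreal (norm (P x)) * indicator {x. norm (P x) \<le> 1} x)) \<partial>lborel) =
        ennreal R * (\<integral>\<^sup>+ x. indicator {x. 0 < x \<bullet> e \<and> x \<bullet> e < 1 / R} x *
        (ennreal (norm (P x)) * indicator {x. norm (P x) \<le> 1} x) \<partial>lborel)"
        by (rule nn_integral_cmult) measurable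
      then show ?thesis using R by (simp only: K zero_less_divide_1_iff)
    qed
    also have "\<dots> = ennreal (R ^ ?d) * J 1"
      using R by (simp add: mult.assoc[symmetric] ennreal_mult'[symmetric])
    finally show ?thesis .
  qed
  \<comment> \<open>The axis is a line, hence a null set because d \<ge> 2.\<close>
  have null: "AE x in lborel. norm (P x) > 0"
  proof -
    have "negligible (span {e})"
      by (rule negligible_lowdim) (use dim dim_le_card[of "{e}"] in simp)
    then have "span {e} \<in> null_sets lebesgue" by (simp add: negligible_iff_null_sets)
    then have "AE x in lebesgue. x \<notin> span {e}" by (rule AE_not_in)
    then have "AE x in lebesgue. norm (P x) > 0"
    proof eventually_elim
      case (elim x)
      have "P x \<noteq> 0"
      proof
        assume "P x = 0"
        then have "x = (x \<bullet> e) *\<^sub>R e" by (simp add: P_def)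
        then have "x \<in> span {e}" by (metis span_base span_scale singletonI)
        then show False using elim by simp
      qed
      then show ?case by simp
    qed
    then show ?thesis by (simp add: AE_completion_iff)
  qed
  fix g :: "real \<Rightarrow> real" assume [measurable]: "g \<in> borel_measurable borel" and g: "\<And>t. 0 \<le> g t"
  let ?w = "\<lambda>t::real. (1 - t\<^sup>2) powr (- 3 / 2)"
  have sph: "AE x in (lborel::'a measure). norm x \<noteq> 1"
  proof -
    have "sphere (0::'a) 1 \<in> null_sets lebesgue"
      using negligible_sphere[of "0::'a" 1] by (simp add: negligible_iff_null_sets)
    then have "AE x in lebesgue. x \<notin> sphere (0::'a) 1" by (rule AE_not_in)
    then show ?thesis by (simp add: AE_completion_iff)
  qed
  have "(\<integral>\<^sup>+ s. ennreal (g (e \<bullet> s)) \<partial>usphere) =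
    of_nat ?d * (\<integral>\<^sup>+ x. ennreal (g (e \<bullet> (x /\<^sub>R norm x))) * indicator {x. x \<noteq> 0 \<and> norm x < 1} x \<partial>lborel)"
    by (rule nn_integral_usphere) measurable
  also have "(\<integral>\<^sup>+ x. ennreal (g (e \<bullet> (x /\<^sub>R norm x))) * indicator {x. x \<noteq> 0 \<and> norm x < 1} x \<partial>lborel)
      = (\<integral>\<^sup>+ x. ennreal (g ((x \<bullet> e) / norm x)) * indicator {x. (norm x)\<^sup>2 \<le> 1} x \<partial>lborel)"
    by (rule nn_integral_cong_AE, use sph AE_lborel_singleton[of "0::'a"] in eventually_elim)
      (auto split: split_indicator simp: inner_commute divide_inverse mult.commute power_le_one_iff abs_square_le_1)
  also have "\<dots> = (\<integral>\<^sup>+ x. indicator ?S x * (\<integral>\<^sup>+ z. ennreal (g (z / sqrt (z\<^sup>2 + (norm (P x))\<^sup>2))) *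
        indicator {z. z\<^sup>2 + (norm (P x))\<^sup>2 \<le> 1} z \<partial>lborel) \<partial>lborel)"
  proof (subst nn_integral_lborel_lines[OF _ e])
    have n: "norm (z *\<^sub>R e + P x) = sqrt (z\<^sup>2 + (norm (P x))\<^sup>2)" for z x
      using normline[of z x] by (metis norm_ge_zero real_sqrt_unique)
    show "(\<integral>\<^sup>+ x. indicator ?S x * (\<integral>\<^sup>+ z. ennreal (g ((z *\<^sub>R e + (x - (x \<bullet> e) *\<^sub>R e)) \<bullet> e / norm (z *\<^sub>R e + (x - (x \<bullet> e) *\<^sub>R e)))) *
        indicator {x. (norm x)\<^sup>2 \<le> 1} (z *\<^sub>R e + (x - (x \<bullet> e) *\<^sub>R e)) \<partial>lborel) \<partial>lborel) =
      (\<integral>\<^sup>+ x. indicator ?S x * (\<integral>\<^sup>+ z. ennreal (g (z / sqrt (z\<^sup>2 + (norm (P x))\<^sup>2))) *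
        indicator {z. z\<^sup>2 + (norm (P x))\<^sup>2 \<le> 1} z \<partial>lborel) \<partial>lborel)"
      unfolding Peq eline by (simp add: n indicator_def)
  qed measurable
  also have "\<dots> = (\<integral>\<^sup>+ x. \<integral>\<^sup>+ t. indicator ?S x * (ennreal (g t * (norm (P x) * ?w t)) * indicator {t. t\<^sup>2 + (norm (P x))\<^sup>2 \<le> 1} t) \<partial>lborel \<partial>lborel)"
  proof (rule nn_integral_cong_AE, use null in eventually_elim)
    fix x assume "0 < norm (P x)"
    then have eq: "(\<integral>\<^sup>+ z. ennreal (g (z / sqrt (z\<^sup>2 + (norm (P x))\<^sup>2))) *
        indicator {z. z\<^sup>2 + (norm (P x))\<^sup>2 \<le> 1} z \<partial>lborel) =
      (\<integral>\<^sup>+ t. ennreal (g t * (norm (P x) * ?w t)) * indicator {t. t\<^sup>2 + (norm (P x))\<^sup>2 \<le> 1} t \<partial>lborel)"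
      by (intro nn_integral_cos_substitution g) measurable
    show "indicator ?S x * (\<integral>\<^sup>+ z. ennreal (g (z / sqrt (z\<^sup>2 + (norm (P x))\<^sup>2))) *
        indicator {z. z\<^sup>2 + (norm (P x))\<^sup>2 \<le> 1} z \<partial>lborel) =
       (\<integral>\<^sup>+ t. indicator ?S x * (ennreal (g t * (norm (P x) * ?w t)) * indicator {t. t\<^sup>2 + (norm (P x))\<^sup>2 \<le> 1} t) \<partial>lborel)"
      unfolding eq by (rule nn_integral_cmult[symmetric]) measurable
  qed
  also have "\<dots> = (\<integral>\<^sup>+ t. \<integral>\<^sup>+ x. indicator ?S x * (ennreal (g t * (norm (P x) * ?w t)) * indicator {x. t\<^sup>2 + (norm (P x))\<^sup>2 \<le> 1} x) \<partial>lborel \<partial>lborel)"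
    unfolding indicator_def mem_Collect_eq of_bool_def
    by (rule lborel_pair.Fubini'[symmetric]) measurable
  also have "\<dots> = (\<integral>\<^sup>+ t. J 1 * (ennreal (g t * (1 - t\<^sup>2) powr ((real ?d - 3) / 2)) * indicator {-1<..<1} t) \<partial>lborel)"
  proof (rule nn_integral_cong)
    fix t :: real
    show "(\<integral>\<^sup>+ x. indicator ?S x * (ennreal (g t * (norm (P x) * ?w t)) * indicator {x. t\<^sup>2 + (norm (P x))\<^sup>2 \<le> 1} x) \<partial>lborel) =
      J 1 * (ennreal (g t * (1 - t\<^sup>2) powr ((real ?d - 3) / 2)) * indicator {-1<..<1} t)"
    proof (cases "\<bar>t\<bar> < 1")
      case True
      define R where "R = sqrt (1 - t\<^sup>2)"
      have t2: "0 < 1 - t\<^sup>2" using True by (simp add: abs_square_less_1)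
      then have R: "0 < R" "R\<^sup>2 = 1 - t\<^sup>2" by (auto simp: R_def)
      have cond: "t\<^sup>2 + (norm (P x))\<^sup>2 \<le> 1 \<longleftrightarrow> norm (P x) \<le> R" for x
      proof -
        have "norm (P x) \<le> R \<longleftrightarrow> (norm (P x))\<^sup>2 \<le> R\<^sup>2"
          using R(1) by (simp add: power_mono_iff)
        then show ?thesis using R by (simp add: algebra_simps)
      qed
      have "(\<integral>\<^sup>+ x. indicator ?S x * (ennreal (g t * (norm (P x) * ?w t)) * indicator {x. t\<^sup>2 + (norm (P x))\<^sup>2 \<le> 1} x) \<partial>lborel)
         = (\<integral>\<^sup>+ x. ennreal (g t * ?w t) * (indicator ?S x * (ennreal (norm (P x)) * indicator {x. norm (P x) \<le> R} x)) \<partial>lborel)"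
      proof (rule nn_integral_cong)
        fix x
        have "ennreal (g t * (norm (P x) * ?w t)) = ennreal (g t * ?w t) * ennreal (norm (P x))"
          using g[of t] by (simp add: ennreal_mult'[symmetric] mult_ac)
        then show "indicator ?S x * (ennreal (g t * (norm (P x) * ?w t)) * indicator {x. t\<^sup>2 + (norm (P x))\<^sup>2 \<le> 1} x)
         = ennreal (g t * ?w t) * (indicator ?S x * (ennreal (norm (P x)) * indicator {x. norm (P x) \<le> R} x))"
          unfolding cond by (simp only: mult_ac)
      qed
      also have "\<dots> = ennreal (g t * ?w t) * J R"
        unfolding J_def by (rule nn_integral_cmult) measurable
      also have "\<dots> = J 1 * ennreal (g t * ?w t * R ^ ?d)"
      proof -
        have "ennreal (g t * ?w t * R ^ ?d) = ennreal (g t * ?w t) * ennreal (R ^ ?d)"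
          using R by (intro ennreal_mult'') simp
        then show ?thesis unfolding J[OF R(1)] by (simp only: mult_ac)
      qed
      also have "g t * ?w t * R ^ ?d = g t * (1 - t\<^sup>2) powr ((real ?d - 3) / 2)"
      proof -
        have "R ^ ?d = (1 - t\<^sup>2) powr (real ?d / 2)"
        proof -
          have "R ^ ?d = R powr real ?d" using R(1) by (simp add: powr_realpow)
          moreover have Rp: "R = (1 - t\<^sup>2) powr (1 / 2)" using t2 by (simp add: R_def powr_half_sqrt)
          moreover have "((1 - t\<^sup>2) powr (1 / 2)) powr real ?d = (1 - t\<^sup>2) powr (real ?d / 2)"
            by (simp add: powr_powr)
          ultimately show ?thesis by metis
        qed
        then have "?w t * R ^ ?d = (1 - t\<^sup>2) powr (- 3 / 2 + real ?d / 2)"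
          by (simp only: powr_add)
        also have "- 3 / 2 + real ?d / 2 = (real ?d - 3) / 2" by (simp add: diff_divide_distrib)
        finally show ?thesis by (simp only: mult.assoc)
      qed
      finally show ?thesis using True by (simp add: abs_less_iff)
    next
      case False
      have "indicator ?S x * (ennreal (g t * (norm (P x) * ?w t)) * indicator {x. t\<^sup>2 + (norm (P x))\<^sup>2 \<le> 1} x) = (0::ennreal)" for x
      proof (cases "t\<^sup>2 + (norm (P x))\<^sup>2 \<le> 1")
        case True
        have "t\<^sup>2 \<ge> 1" using False by (metis abs_square_less_1 linorder_not_le)
        then have "(norm (P x))\<^sup>2 \<le> 0" using True by linarith
        then show ?thesis by simp
      qed simp
      then have "(\<integral>\<^sup>+ x. indicator ?S x * (ennreal (g t * (norm (P x) * ?w t)) * indicator {x. t\<^sup>2 + (norm (P x))\<^sup>2 \<le> 1} x) \<partial>lborel) = 0"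
        by (simp only:) simp
      moreover have "indicator {-1<..<1} t = (0::ennreal)" using False by (auto simp: indicator_def abs_less_iff)
      ultimately show ?thesis by (simp only: mult_zero_right)
    qed
  qed
  also have "\<dots> = J 1 * (\<integral>\<^sup>+ t. ennreal (g t * (1 - t\<^sup>2) powr ((real ?d - 3) / 2)) * indicator {-1<..<1} t \<partial>lborel)"
    by (rule nn_integral_cmult) measurable
  finally show "(\<integral>\<^sup>+ s. ennreal (g (e \<bullet> s)) \<partial>usphere) =
     (of_nat ?d * J 1) * (\<integral>\<^sup>+ t. ennreal (g t * (1 - t\<^sup>2) powr ((real ?d - 3) / 2)) * indicator {-1<..<1} t \<partial>lborel)"
    by (simp add: mult.assoc)
qed


lemma ennreal_mult_finite_pos_cases:
  fixes a b :: ennreal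
  assumes "a * b \<noteq> 0" "a * b \<noteq> top"
  shows "a \<noteq> 0" "a \<noteq> top" "b \<noteq> 0" "b \<noteq> top"
  using assms by (auto simp: ennreal_mult_eq_top_iff ennreal_top_mult ennreal_mult_top)

text \<open>
  The constant is determined by the total mass of the sphere, so it does not depend on the axis \<open>e\<close>.
\<close>
lemma nn_integral_usphere_cos:
  assumes dim: "DIM('a::euclidean_space) \<ge> 2"
  obtains \<kappa> :: real where "0 < \<kappa>" "\<And>e g. norm (e::'a) = 1 \<Longrightarrow> g \<in> borel_measurable borel \<Longrightarrow> (\<And>t. 0 \<le> g t) \<Longrightarrow>
    (\<integral>\<^sup>+ s. ennreal (g (e \<bullet> s)) \<partial>usphere) =
    ennreal \<kappa> * (\<integral>\<^sup>+ t. ennreal (g t * (1 - t\<^sup>2) powr ((real DIM('a) - 3) / 2)) * indicator {-1<..<1} t \<partial>lborel)"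
proof -
  let ?W = "\<integral>\<^sup>+ t. ennreal ((1 - t\<^sup>2) powr ((real DIM('a) - 3) / 2)) * indicator {-1<..<1} t \<partial>lborel"
  let ?S = "emeasure (usphere :: 'a measure) UNIV"
  have S: "?S \<noteq> 0" "?S \<noteq> top"
    using emeasure_usphere_pos[where 'a='a] usphere.emeasure_finite[where 'a='a, of UNIV]
    by (auto simp: zero_less_iff_neq_zero)
  have *: "\<kappa> * ?W = ?S" if "\<And>g. g \<in> borel_measurable borel \<Longrightarrow> (\<And>t. 0 \<le> g t) \<Longrightarrow>
    (\<integral>\<^sup>+ s. ennreal (g (e \<bullet> s)) \<partial>usphere) =
    \<kappa> * (\<integral>\<^sup>+ t. ennreal (g t * (1 - t\<^sup>2) powr ((real DIM('a) - 3) / 2)) * indicator {-1<..<1} t \<partial>lborel)"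
    for \<kappa> and e :: 'a
    using that[of "\<lambda>_. 1"] by simp
  obtain e0 :: 'a where e0: "norm e0 = 1" using vector_choose_size[of 1] by auto
  obtain \<kappa> where \<kappa>: "\<And>g. g \<in> borel_measurable borel \<Longrightarrow> (\<And>t. 0 \<le> g t) \<Longrightarrow>
    (\<integral>\<^sup>+ s. ennreal (g (e0 \<bullet> s)) \<partial>usphere) =
    \<kappa> * (\<integral>\<^sup>+ t. ennreal (g t * (1 - t\<^sup>2) powr ((real DIM('a) - 3) / 2)) * indicator {-1<..<1} t \<partial>lborel)"
    by (rule nn_integral_usphere_cos_aux[OF dim e0], rule that, blast)
  have \<kappa>W: "\<kappa> * ?W = ?S" by (rule *[OF \<kappa>])
  note k = ennreal_mult_finite_pos_cases(1,2)[of \<kappa> ?W, unfolded \<kappa>W, OF S]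
  note W = ennreal_mult_finite_pos_cases(3,4)[of \<kappa> ?W, unfolded \<kappa>W, OF S]
  have uniq: "\<kappa>' = \<kappa>" if "\<kappa>' * ?W = ?S" for \<kappa>'
  proof -
    have "?W * \<kappa>' = ?W * \<kappa>" using that \<kappa>W by (simp only: mult.commute)
    then show ?thesis using W ennreal_mult_cancel_left by blast
  qed
  show thesis
  proof (rule that[of "enn2real \<kappa>"])
    show "0 < enn2real \<kappa>" using k by (simp add: enn2real_positive_iff less_top zero_less_iff_neq_zero)
    fix e :: 'a and g :: "real \<Rightarrow> real"
    assume e: "norm e = 1" and g: "g \<in> borel_measurable borel" "\<And>t. 0 \<le> g t"
    obtain \<kappa>' where \<kappa>': "\<And>g. g \<in> borel_measurable borel \<Longrightarrow> (\<And>t. 0 \<le> g t) \<Longrightarrow>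
      (\<integral>\<^sup>+ s. ennreal (g (e \<bullet> s)) \<partial>usphere) =
      \<kappa>' * (\<integral>\<^sup>+ t. ennreal (g t * (1 - t\<^sup>2) powr ((real DIM('a) - 3) / 2)) * indicator {-1<..<1} t \<partial>lborel)"
      by (rule nn_integral_usphere_cos_aux[OF dim e], rule that, blast)
    have "\<kappa>' = ennreal (enn2real \<kappa>)" using uniq[OF *[OF \<kappa>']] k by (simp add: less_top)
    then show "(\<integral>\<^sup>+ s. ennreal (g (e \<bullet> s)) \<partial>usphere) =
      ennreal (enn2real \<kappa>) * (\<integral>\<^sup>+ t. ennreal (g t * (1 - t\<^sup>2) powr ((real DIM('a) - 3) / 2)) * indicator {-1<..<1} t \<partial>lborel)"
      using \<kappa>'[OF g] by simp
  qed
qed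

section \<open>Angular averaging of high powers\<close>

text \<open>An equality of image measures, so that integrals, integrability and null sets of
  functions of the cosine transfer at once, with the same law for every axis.\<close>

lemma distr_usphere_cos:
  assumes dim: "DIM('a::euclidean_space) \<ge> 2"
  obtains \<kappa> :: real where "0 < \<kappa>" "\<And>e. norm (e::'a) = 1 \<Longrightarrow>
    distr usphere borel (\<lambda>s. e \<bullet> s) =
    density lborel (\<lambda>t. ennreal (\<kappa> * ((1 - t\<^sup>2) powr ((real DIM('a) - 3) / 2) * indicator {-1<..<1} t)))"
proof (rule nn_integral_usphere_cos[OF dim])
  fix \<kappa> :: real
  assume \<kappa>: "0 < \<kappa>" and *: "\<And>e g. norm (e::'a) = 1 \<Longrightarrow> g \<in> borel_measurable borel \<Longrightarrow> (\<And>t. 0 \<le> g t) \<Longrightarrow>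
    (\<integral>\<^sup>+ s. ennreal (g (e \<bullet> s)) \<partial>usphere) =
    ennreal \<kappa> * (\<integral>\<^sup>+ t. ennreal (g t * (1 - t\<^sup>2) powr ((real DIM('a) - 3) / 2)) * indicator {-1<..<1} t \<partial>lborel)"
  show thesis
  proof (rule that[OF \<kappa>], rule measure_eqI)
    fix e :: 'a and A assume e: "norm e = 1" and "A \<in> sets (distr usphere borel (\<lambda>s. e \<bullet> s))"
    then have A[measurable]: "A \<in> sets borel" by simp
    let ?w = "\<lambda>t. (1 - t\<^sup>2) powr ((real DIM('a) - 3) / 2)"
    have "emeasure (distr usphere borel (\<lambda>s. e \<bullet> s)) A = (\<integral>\<^sup>+ t. indicator A t \<partial>distr usphere borel (\<lambda>s. e \<bullet> s))"
      by simp
    also have "\<dots> = (\<integral>\<^sup>+ s. ennreal (indicat_real A (e \<bullet> s)) \<partial>usphere)"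
      by (subst nn_integral_distr) (auto simp: ennreal_indicator)
    also have "\<dots> = ennreal \<kappa> * (\<integral>\<^sup>+ t. ennreal (indicat_real A t * ?w t) * indicator {-1<..<1} t \<partial>lborel)"
      by (rule *[OF e]) auto
    also have "\<dots> = (\<integral>\<^sup>+ t. ennreal \<kappa> * (ennreal (indicat_real A t * ?w t) * indicator {-1<..<1} t) \<partial>lborel)"
      by (rule nn_integral_cmult[symmetric]) measurable
    also have "\<dots> = (\<integral>\<^sup>+ t. ennreal (\<kappa> * (?w t * indicator {-1<..<1} t)) * indicator A t \<partial>lborel)"
      using \<kappa> by (intro nn_integral_cong) (auto simp: ennreal_mult' split: split_indicator)
    also have "\<dots> = emeasure (density lborel (\<lambda>t. ennreal (\<kappa> * (?w t * indicator {-1<..<1} t)))) A"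
      by (rule emeasure_density[symmetric]) measurable
    finally show "emeasure (distr usphere borel (\<lambda>s. e \<bullet> s)) A =
      emeasure (density lborel (\<lambda>t. ennreal (\<kappa> * (?w t * indicator {-1<..<1} t)))) A" .
  qed simp
qed

text \<open>All that the estimates use of the angular factor: a nonnegative Borel function, its
  integral L over the sphere for every axis, and smallness of its mass near the two poles of any
  other axis, uniformly in both axes. \<open>dim_type\<close> ties the locale to the velocity space,
  which neither b nor L mentions.\<close>

locale angular_kernel =
  fixes dim_type :: "'a::euclidean_space itself" and b :: "real \<Rightarrow> real" and L :: real
  assumes b_meas [measurable]: "b \<in> borel_measurable borel"
    and b_nonneg: "\<And>z. 0 \<le> b z"
    and L_pos: "0 < L"
    and b_integrable: "\<And>e::'a. norm e = 1 \<Longrightarrow> integrable usphere (\<lambda>s. b (e \<bullet> s))"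
    and b_integral: "\<And>e::'a. norm e = 1 \<Longrightarrow> (LINT s|usphere. b (e \<bullet> s)) = L"
    and b_cap: "\<And>\<epsilon>. 0 < \<epsilon> \<Longrightarrow> \<exists>\<delta>. 0 < \<delta> \<and> \<delta> < 1 \<and>
      (\<forall>e e'::'a. norm e = 1 \<longrightarrow> norm e' = 1 \<longrightarrow>
        (LINT s|usphere. b (e \<bullet> s) * indicator {s. 1 - \<delta> < \<bar>e' \<bullet> s\<bar>} s) \<le> \<epsilon>)"

text \<open>
  The cap \<open>{1 - \<delta> < \<bar>e' \<bullet> s\<bar>}\<close> has small measure and \<open>b (e \<bullet> s)\<close> has a distribution which does not
  depend on \<open>e\<close>, so the bound is uniform by splitting \<open>b\<close> at a high level \<open>K\<close>.
\<close>
lemma angular_kernelI: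
  fixes b :: "real \<Rightarrow> real" and N :: "real measure"
  assumes [measurable]: "b \<in> borel_measurable borel" and b0: "\<And>z. 0 \<le> b z"
    and N: "\<And>e::'a::euclidean_space. norm e = 1 \<Longrightarrow> distr usphere borel (\<lambda>s. e \<bullet> s) = N"
    and ends: "AE t in N. \<bar>t\<bar> < 1"
    and int: "integrable N b" and pos: "\<not> (AE t in N. b t = 0)"
  shows "angular_kernel TYPE('a) b (LINT t|N. b t)"
proof
  obtain e0 :: 'a where e0: "norm e0 = 1" using vector_choose_size[of 1] by auto
  have sN[simp, measurable_cong]: "sets N = sets borel" using N[OF e0] by auto
  interpret N: finite_measure N
    unfolding N[OF e0, symmetric] by (rule usphere.finite_measure_distr) simp
  show "0 < (LINT t|N. b t)"
  proof -
    have "(LINT t|N. b t) \<noteq> 0"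
      using integral_nonneg_eq_0_iff_AE[OF int] b0 pos by auto
    moreover have "0 \<le> (LINT t|N. b t)" using b0 by (intro integral_nonneg_AE) auto
    ultimately show ?thesis by simp
  qed
  fix \<epsilon> :: real assume \<epsilon>: "0 < \<epsilon>"
  \<comment> \<open>Origin of the level K: by dominated convergence the part of b above a high level
    has a small integral.\<close>
  have "(\<lambda>n::nat. LINT t|N. b t * indicator {t. real n < b t} t) \<longlonglongrightarrow> (LINT t|N. 0)"
  proof (rule integral_dominated_convergence[OF _ _ int])
    show "AE t in N. (\<lambda>n::nat. b t * indicator {t. real n < b t} t) \<longlonglongrightarrow> 0"
    proof (intro AE_I2 tendsto_eventually)
      fix t
      obtain n0 :: nat where "b t \<le> real n0" using real_arch_simple by blast
      then show "\<forall>\<^sub>F n in sequentially. b t * indicator {t. real n < b t} t = 0"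
        by (intro eventually_sequentiallyI[of n0]) (auto simp: indicator_def)
    qed
  qed (use b0 in \<open>auto simp: indicator_def\<close>)
  then have "\<forall>\<^sub>F n in sequentially. (LINT t|N. b t * indicator {t. real n < b t} t) < \<epsilon> / 2"
    using \<epsilon> by (intro order_tendstoD) auto
  then obtain K :: nat where K: "(LINT t|N. b t * indicator {t. real K < b t} t) < \<epsilon> / 2"
    by (meson eventually_sequentially order_refl)
  \<comment> \<open>Origin of the cap size: N does not charge the endpoints, by \<open>ends\<close>,
    so the caps shrink to a null set.\<close>
  have "(\<lambda>n::nat. LINT t|N. indicator {t. 1 - 1 / real (n + 2) < \<bar>t\<bar>} t :: real) \<longlonglongrightarrow> (LINT t|N. 0)"
  proof (rule integral_dominated_convergence[where w="\<lambda>_. 1"])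
    show "AE t in N. (\<lambda>n::nat. indicator {t. 1 - 1 / real (n + 2) < \<bar>t\<bar>} t :: real) \<longlonglongrightarrow> 0"
      using ends
    proof eventually_elim
      case (elim t)
      have "(\<lambda>n. 1 - 1 / real (n + 2)) \<longlonglongrightarrow> 1 - 0"
        by (intro tendsto_intros LIMSEQ_ignore_initial_segment[OF lim_1_over_n])
      then have "\<forall>\<^sub>F n in sequentially. \<bar>t\<bar> < 1 - 1 / real (n + 2)"
        using elim by (intro order_tendstoD) auto
      then show ?case
        by (intro tendsto_eventually) (auto elim!: eventually_mono simp: indicator_def)
    qed
  qed (auto simp: indicator_def)
  \<comment> \<open>K + 1 instead of K keeps the divisor positive when K = 0.\<close>
  then have "\<forall>\<^sub>F n in sequentially. (LINT t|N. indicator {t. 1 - 1 / real (n + 2) < \<bar>t\<bar>} t :: real) < \<epsilon> / (2 * (real K + 1))"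
    using \<epsilon> by (intro order_tendstoD) auto
  then obtain n :: nat where n: "(LINT t|N. indicator {t. 1 - 1 / real (n + 2) < \<bar>t\<bar>} t :: real) < \<epsilon> / (2 * (real K + 1))"
    by (meson eventually_sequentially order_refl)
  define \<delta> where "\<delta> = 1 / real (n + 2)"
  have \<delta>: "0 < \<delta>" "\<delta> < 1" by (auto simp: \<delta>_def)
  have Nint: "(LINT s|usphere. g (e \<bullet> s)) = (LINT t|N. g t)" if "norm e = 1" "g \<in> borel_measurable borel"
    for e :: 'a and g :: "real \<Rightarrow> real"
    unfolding N[OF that(1), symmetric] using that(2) by (subst integral_distr) auto
  have Nable: "integrable usphere (\<lambda>s. g (e \<bullet> s)) \<longleftrightarrow> integrable N g" if "norm e = 1" "g \<in> borel_measurable borel"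
    for e :: 'a and g :: "real \<Rightarrow> real"
    unfolding N[OF that(1), symmetric] using that(2) by (subst integrable_distr_eq) auto
  show "\<exists>\<delta>. 0 < \<delta> \<and> \<delta> < 1 \<and> (\<forall>e e'::'a. norm e = 1 \<longrightarrow> norm e' = 1 \<longrightarrow>
        (LINT s|usphere. b (e \<bullet> s) * indicator {s. 1 - \<delta> < \<bar>e' \<bullet> s\<bar>} s) \<le> \<epsilon>)"
  proof (intro exI[of _ \<delta>] conjI \<delta> allI impI)
    fix e e' :: 'a assume e: "norm e = 1" "norm e' = 1"
    have 1: "integrable usphere (\<lambda>s. b (e \<bullet> s) * indicator {t. real K < b t} (e \<bullet> s))"
      by (subst Nable[OF e(1), where g="\<lambda>t. b t * indicator {t. real K < b t} t"])
         (auto intro!: integrable_real_mult_indicator int)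
    have 2: "integrable usphere (\<lambda>s. indicator {t. 1 - \<delta> < \<bar>t\<bar>} (e' \<bullet> s) :: real)"
      by (subst Nable[OF e(2), where g="indicator {t. 1 - \<delta> < \<bar>t\<bar>}"])
         (auto intro!: integrable_real_indicator simp: N.emeasure_finite less_top[symmetric])
    \<comment> \<open>Where b exceeds K its tail in the cosine of e is used; elsewhere it is at most
      K on the cap of e'.\<close>
    have "(LINT s|usphere. b (e \<bullet> s) * indicator {s. 1 - \<delta> < \<bar>e' \<bullet> s\<bar>} s) \<le>
      (LINT s|usphere. b (e \<bullet> s) * indicator {t. real K < b t} (e \<bullet> s) + real K * indicator {t. 1 - \<delta> < \<bar>t\<bar>} (e' \<bullet> s))"
    proof (rule integral_mono)
      show "integrable usphere (\<lambda>s. b (e \<bullet> s) * indicator {s. 1 - \<delta> < \<bar>e' \<bullet> s\<bar>} s)"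
        using Nable[OF e(1), of b] int by (intro integrable_real_mult_indicator) auto
    qed (use 1 2 b0 in \<open>auto simp: indicator_def not_less\<close>)
    also have "\<dots> = (LINT s|usphere. b (e \<bullet> s) * indicator {t. real K < b t} (e \<bullet> s)) +
       real K * (LINT s|usphere. indicator {t. 1 - \<delta> < \<bar>t\<bar>} (e' \<bullet> s))"
      using 1 2 by (subst Bochner_Integration.integral_add) auto
    also have "\<dots> = (LINT t|N. b t * indicator {t. real K < b t} t) + real K * (LINT t|N. indicator {t. 1 - \<delta> < \<bar>t\<bar>} t)"
      using Nint[OF e(1), of "\<lambda>t. b t * indicator {t. real K < b t} t"] Nint[OF e(2), of "indicator {t. 1 - \<delta> < \<bar>t\<bar>}"]
      by simp
    also have "\<dots> \<le> \<epsilon> / 2 + real K * (\<epsilon> / (2 * (real K + 1)))"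
      using K n by (intro add_mono mult_left_mono) (auto simp: \<delta>_def)
    also have "\<dots> \<le> \<epsilon>" using \<epsilon> by (simp add: field_simps)
    finally show "(LINT s|usphere. b (e \<bullet> s) * indicator {s. 1 - \<delta> < \<bar>e' \<bullet> s\<bar>} s) \<le> \<epsilon>" .
  qed
next
  fix e :: 'a assume e: "norm e = 1"
  show "integrable usphere (\<lambda>s. b (e \<bullet> s))"
    using int unfolding N[OF e, symmetric] by (subst (asm) integrable_distr_eq) auto
  show "(LINT s|usphere. b (e \<bullet> s)) = (LINT t|N. b t)"
    unfolding N[OF e, symmetric] by (subst integral_distr) auto
qed (use b0 in auto)

section \<open>Geometry of one collision and the gain term\<close>

lemma post_vel_uminus: "post_vel v w (- s) = post_vel_star v w s"
  by (simp add: post_vel_def post_vel_star_def)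

lemma norm_post_vel:
  fixes v w s :: "'a::euclidean_space"
  assumes s: "norm s = 1"
  shows "(norm (post_vel v w s))\<^sup>2 = ((norm v)\<^sup>2 + (norm w)\<^sup>2) / 2 + norm (v - w) / 2 * ((v + w) \<bullet> s)"
proof -
  have s1: "s \<bullet> s = 1" using s by (simp add: dot_square_norm)
  have "(norm (post_vel v w s))\<^sup>2 =
     (norm (v + w))\<^sup>2 / 4 + norm (v - w) / 2 * ((v + w) \<bullet> s) + (norm (v - w))\<^sup>2 / 4"
  proof -
    have "(norm (a + c *\<^sub>R s))\<^sup>2 = (norm a)\<^sup>2 + 2 * c * (a \<bullet> s) + c\<^sup>2" for a c
      unfolding power2_norm_eq_inner
      by (simp add: inner_add_left inner_add_right s1 inner_commute[of s a] power2_eq_square distrib_left)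
    from this[of "(v + w) /\<^sub>R 2" "norm (v - w) / 2"] show ?thesis
      unfolding post_vel_def by (simp add: power_mult_distrib power_divide power_inverse[symmetric] inner_scaleR_left)
  qed
  moreover have "(norm (v + w))\<^sup>2 + (norm (v - w))\<^sup>2 = 2 * ((norm v)\<^sup>2 + (norm w)\<^sup>2)"
    unfolding power2_norm_eq_inner by (simp add: inner_simps inner_commute)
  ultimately show ?thesis by simp
qed

lemma norm_post_vel_sum:
  fixes v w s :: "'a::euclidean_space"
  assumes s: "norm s = 1"
  shows "(norm (post_vel v w s))\<^sup>2 + (norm (post_vel_star v w s))\<^sup>2 = (norm v)\<^sup>2 + (norm w)\<^sup>2"
  using norm_post_vel[OF s, of v w] norm_post_vel[of "- s" v w] s by (simp add: post_vel_uminus)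

lemma norm_post_vel_le:
  fixes v w s :: "'a::euclidean_space"
  assumes s: "norm s = 1"
  shows "(norm (post_vel v w s))\<^sup>2 \<le> (norm v)\<^sup>2 + (norm w)\<^sup>2"
  using norm_post_vel_sum[OF s, of v w] by (smt (verit) zero_le_power2)

text \<open>The axis is the direction of the total momentum v + w, arbitrary if that vanishes. In
  the formula for |v'|^2 the cross term is at most |v - w| |v + w| |e \<bullet> s| / 2, and |v - w|
  |v + w| is at most half of |v - w|^2 + |v + w|^2, which is the total energy |v|^2 + |w|^2.\<close>

lemma norm_post_vel_cap:
  fixes v w :: "'a::euclidean_space"
  obtains e where "norm e = 1" "\<And>s. norm s = 1 \<Longrightarrow>
    (norm (post_vel v w s))\<^sup>2 \<le> ((norm v)\<^sup>2 + (norm w)\<^sup>2) * ((1 + \<bar>e \<bullet> s\<bar>) / 2)"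
proof -
  obtain e where e: "norm e = 1" "v + w = norm (v + w) *\<^sub>R e"
  proof (cases "v + w = 0")
    case True
    obtain e0 :: 'a where "norm e0 = 1" using vector_choose_size[of 1] by auto
    then show ?thesis using True that by simp
  next
    case False
    then show ?thesis using that[of "(v + w) /\<^sub>R norm (v + w)"] by simp
  qed
  show thesis
  proof (rule that[OF e(1)])
    fix s :: 'a assume s: "norm s = 1"
    have "norm (v - w) * norm (v + w) \<le> ((norm (v - w))\<^sup>2 + (norm (v + w))\<^sup>2) / 2"
      using sum_squares_bound[of "norm (v - w)" "norm (v + w)"] by simp
    also have "\<dots> = (norm v)\<^sup>2 + (norm w)\<^sup>2"
      unfolding power2_norm_eq_inner by (simp add: inner_simps inner_commute)
    finally have E: "norm (v - w) * norm (v + w) \<le> (norm v)\<^sup>2 + (norm w)\<^sup>2" .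
    have "norm (v - w) / 2 * ((v + w) \<bullet> s) = norm (v - w) * norm (v + w) * ((e \<bullet> s) / 2)"
      by (subst e(2)) simp
    also have "\<dots> \<le> norm (v - w) * norm (v + w) * (\<bar>e \<bullet> s\<bar> / 2)"
      by (intro mult_left_mono) auto
    also have "\<dots> \<le> ((norm v)\<^sup>2 + (norm w)\<^sup>2) * (\<bar>e \<bullet> s\<bar> / 2)"
      by (intro mult_right_mono E) auto
    finally show "(norm (post_vel v w s))\<^sup>2 \<le> ((norm v)\<^sup>2 + (norm w)\<^sup>2) * ((1 + \<bar>e \<bullet> s\<bar>) / 2)"
      by (simp add: norm_post_vel[OF s] field_simps)
  qed
qed

text \<open>One outgoing particle only, and without the factor |v - w|^\<beta>; the other particle
  appears by exchanging v and w, see \<open>gain_swap\<close>.\<close>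

definition gain :: "(real \<Rightarrow> real) \<Rightarrow> ('a::euclidean_space \<Rightarrow> real) \<Rightarrow> 'a \<Rightarrow> 'a \<Rightarrow> real" where
  "gain b \<phi> v w = (LINT s|usphere. b (cos_dev v w s) * \<phi> (post_vel v w s))"

lemma borel_measurable_cos_dev [measurable (raw)]:
  assumes [measurable]: "f \<in> borel_measurable M" "g \<in> borel_measurable M" "h \<in> borel_measurable M"
  shows "(\<lambda>x. cos_dev (f x) (g x) (h x)) \<in> borel_measurable M"
  unfolding cos_dev_def by measurable

lemma borel_measurable_post_vel [measurable (raw)]:
  assumes [measurable]: "f \<in> borel_measurable M" "g \<in> borel_measurable M" "h \<in> borel_measurable M"
  shows "(\<lambda>x. post_vel (f x) (g x) (h x)) \<in> borel_measurable M"
  unfolding post_vel_def by measurable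

lemma borel_measurable_post_vel_star [measurable (raw)]:
  assumes [measurable]: "f \<in> borel_measurable M" "g \<in> borel_measurable M" "h \<in> borel_measurable M"
  shows "(\<lambda>x. post_vel_star (f x) (g x) (h x)) \<in> borel_measurable M"
  unfolding post_vel_star_def by measurable

lemma distr_usphere_uminus: "distr usphere borel uminus = (usphere :: 'a::euclidean_space measure)"
proof (rule measure_eqI)
  fix A :: "'a set" assume "A \<in> sets (distr usphere borel uminus)"
  then have [measurable]: "A \<in> sets borel" by simp
  have "emeasure (distr usphere borel uminus) A = (\<integral>\<^sup>+ s. indicator A s \<partial>distr usphere borel uminus)"
    by simp
  also have "\<dots> = (\<integral>\<^sup>+ s. indicator A (- s) \<partial>usphere)"
    by (subst nn_integral_distr) auto
  also have "\<dots> = (\<integral>\<^sup>+ s. indicator A s \<partial>usphere)"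
    by (rule nn_integral_usphere_uminus) measurable
  finally show "emeasure (distr usphere borel uminus) A = emeasure usphere A"
    by simp
qed simp

lemma integral_usphere_uminus:
  fixes g :: "'a::euclidean_space \<Rightarrow> real"
  assumes "g \<in> borel_measurable borel"
  shows "(LINT s|usphere. g (- s)) = (LINT s|usphere. g s)"
proof -
  have "(LINT s|usphere. g s) = (LINT s|distr usphere borel uminus. g s)"
    by (simp add: distr_usphere_uminus)
  also have "\<dots> = (LINT s|usphere. g (- s))"
    using assms by (subst integral_distr) auto
  finally show ?thesis by simp
qed

text \<open>Exchanging v and w changes the sign of the cosine and keeps \<open>post_vel\<close>.
  Reflecting s restores the cosine and turns \<open>post_vel\<close> into
  \<open>post_vel_star\<close>.\<close>

lemma gain_swap:
  fixes \<phi> :: "'a::euclidean_space \<Rightarrow> real"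
  assumes [measurable]: "b \<in> borel_measurable borel" "\<phi> \<in> borel_measurable borel"
  shows "gain b \<phi> w v = (LINT s|usphere. b (cos_dev v w s) * \<phi> (post_vel_star v w s))"
proof -
  have "cos_dev w v s = cos_dev v w (- s)" for s
    by (simp add: cos_dev_def norm_minus_commute inner_diff_left right_diff_distrib)
  moreover have "post_vel w v s = post_vel_star v w (- s)" for s
    by (simp add: post_vel_def post_vel_star_def norm_minus_commute add.commute)
  ultimately have "gain b \<phi> w v = (LINT s|usphere. b (cos_dev v w (- s)) * \<phi> (post_vel_star v w (- s)))"
    by (simp add: gain_def)
  also have "\<dots> = (LINT s|usphere. b (cos_dev v w s) * \<phi> (post_vel_star v w s))"
    by (rule integral_usphere_uminus[where g="\<lambda>s. b (cos_dev v w s) * \<phi> (post_vel_star v w s)"]) measurable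
  finally show ?thesis .
qed

context angular_kernel
begin

lemma kernel_integrable: "v \<noteq> (w::'a) \<Longrightarrow> integrable usphere (\<lambda>s. b (cos_dev v w s))"
  unfolding cos_dev_def by (rule b_integrable) simp

lemma kernel_integral: "v \<noteq> (w::'a) \<Longrightarrow> (LINT s|usphere. b (cos_dev v w s)) = L"
  unfolding cos_dev_def by (rule b_integral) simp

lemma kernel_mult_integrable:
  fixes v w :: 'a and g :: "'a \<Rightarrow> real"
  assumes "v \<noteq> w" and [measurable]: "g \<in> borel_measurable borel"
    and bd: "\<And>s. norm s = 1 \<Longrightarrow> \<bar>g s\<bar> \<le> C"
  shows "integrable usphere (\<lambda>s. b (cos_dev v w s) * g s)"
proof (rule Bochner_Integration.integrable_bound)
  show "integrable usphere (\<lambda>s. C * b (cos_dev v w s))"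
    using kernel_integrable[OF assms(1)] by simp
  show "AE s in usphere. norm (b (cos_dev v w s) * g s) \<le> norm (C * b (cos_dev v w s))"
    using AE_usphere_norm
  proof eventually_elim
    case (elim s)
    then have "\<bar>g s\<bar> * b (cos_dev v w s) \<le> \<bar>C\<bar> * b (cos_dev v w s)"
      by (intro mult_right_mono order_trans[OF bd abs_ge_self] b_nonneg)
    then show ?case using b_nonneg by (simp add: abs_mult mult.commute)
  qed
qed measurable

lemma kernel_mult_mono:
  fixes v w :: 'a and g h :: "'a \<Rightarrow> real"
  assumes "integrable usphere (\<lambda>s. b (cos_dev v w s) * g s)" "integrable usphere (\<lambda>s. b (cos_dev v w s) * h s)"
    and "\<And>s. norm s = 1 \<Longrightarrow> g s \<le> h s"
  shows "(LINT s|usphere. b (cos_dev v w s) * g s) \<le> (LINT s|usphere. b (cos_dev v w s) * h s)"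
proof (rule integral_mono_AE[OF assms(1,2)])
  show "AE s in usphere. b (cos_dev v w s) * g s \<le> b (cos_dev v w s) * h s"
    using AE_usphere_norm by eventually_elim (auto intro!: mult_left_mono assms(3) b_nonneg)
qed

lemma kernel_mult_le:
  fixes v w :: 'a and g :: "'a \<Rightarrow> real"
  assumes "v \<noteq> w" "g \<in> borel_measurable borel"
    and bd: "\<And>s. norm s = 1 \<Longrightarrow> g s \<le> C" "\<And>s. norm s = 1 \<Longrightarrow> \<bar>g s\<bar> \<le> C'"
  shows "(LINT s|usphere. b (cos_dev v w s) * g s) \<le> L * C"
proof -
  have "(LINT s|usphere. b (cos_dev v w s) * g s) \<le> (LINT s|usphere. b (cos_dev v w s) * C)"
  proof (rule kernel_mult_mono)
    show "integrable usphere (\<lambda>s. b (cos_dev v w s) * g s)"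
      using assms by (intro kernel_mult_integrable) auto
  qed (use kernel_integrable[OF assms(1)] bd in auto)
  then show ?thesis using kernel_integral[OF assms(1)] by simp
qed

text \<open>Half of \<epsilon> pays for the cap around the momentum axis, where nothing better than
  conservation of energy is used, and half for the rest, where the share of the energy is at most q
  < 1 and q^p is small. The threshold is independent of v and w because the cap estimate is uniform
  in both axes. The exponent is real because it will be k s / 2.\<close>

lemma gain_power_small:
  assumes "0 < \<epsilon>"
  obtains p0 :: real where "1 \<le> p0" "\<And>p v w. p0 \<le> p \<Longrightarrow> v \<noteq> (w::'a) \<Longrightarrow>
    gain b (\<lambda>u. ((norm u)\<^sup>2) powr p) v w \<le> \<epsilon> * L * ((norm v)\<^sup>2 + (norm w)\<^sup>2) powr p"
proof -
  have "0 < \<epsilon> * L / 2" using assms L_pos by simp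
  from b_cap[OF this] obtain \<delta> where \<delta>: "0 < \<delta>" "\<delta> < 1" and cap: "\<And>e e'::'a. norm e = 1 \<Longrightarrow> norm e' = 1 \<Longrightarrow>
        (LINT s|usphere. b (e \<bullet> s) * indicator {s. 1 - \<delta> < \<bar>e' \<bullet> s\<bar>} s) \<le> \<epsilon> * L / 2"
    by auto
  \<comment> \<open>This is (1 + (1 - \<delta>)) / 2, the factor of \<open>norm_post_vel_cap\<close>
    at the rim of the cap.\<close>
  define q where "q = 1 - \<delta> / 2"
  have q: "0 < q" "q < 1" using \<delta> by (auto simp: q_def)
  obtain n where n: "q ^ n < \<epsilon> / 2"
    using real_arch_pow_inv[of "\<epsilon> / 2" q] assms q by auto
  show thesis
  proof (rule that[of "max 1 (real n)"])
    fix p and v w :: 'a assume p: "max 1 (real n) \<le> p" and vw: "v \<noteq> w"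
    define E where "E = (norm v)\<^sup>2 + (norm w)\<^sup>2"
    have E: "0 \<le> E" by (simp add: E_def)
    have qp: "q powr p \<le> \<epsilon> / 2"
    proof -
      have "q powr p \<le> q powr real n" using p q by (intro powr_mono') auto
      also have "\<dots> = q ^ n" using q by (simp add: powr_realpow)
      finally show ?thesis using n by simp
    qed
    obtain e' where e': "norm e' = 1" and post: "\<And>s. norm s = 1 \<Longrightarrow>
      (norm (post_vel v w s))\<^sup>2 \<le> E * ((1 + \<bar>e' \<bullet> s\<bar>) / 2)"
      using norm_post_vel_cap[of v w] unfolding E_def by blast
    let ?e = "(v - w) /\<^sub>R norm (v - w)"
    have c: "cos_dev v w s = ?e \<bullet> s" for s by (simp add: cos_dev_def)
    have i1: "integrable usphere (\<lambda>s. b (cos_dev v w s) * indicator {s. 1 - \<delta> < \<bar>e' \<bullet> s\<bar>} s)"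
      by (rule kernel_mult_integrable[OF vw, where C=1]) auto
    have g1: "((norm (post_vel v w s))\<^sup>2) powr p \<le> E powr p * (\<epsilon> / 2 + indicator {s. 1 - \<delta> < \<bar>e' \<bullet> s\<bar>} s)"
      if s: "norm s = 1" for s
    proof (cases "1 - \<delta> < \<bar>e' \<bullet> s\<bar>")
      case True
      have "((norm (post_vel v w s))\<^sup>2) powr p \<le> E powr p"
        using p norm_post_vel_le[OF s, of v w] by (intro powr_mono2) (auto simp: E_def)
      also have "\<dots> \<le> E powr p * (\<epsilon> / 2 + 1)" using assms by (simp add: distrib_left)
      finally show ?thesis using True by simp
    next
      case False
      have "((norm (post_vel v w s))\<^sup>2) powr p \<le> (E * q) powr p"
      proof (intro powr_mono2)
        have "E * ((1 + \<bar>e' \<bullet> s\<bar>) / 2) \<le> E * q"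
          using False E by (intro mult_left_mono) (auto simp: q_def)
        then show "(norm (post_vel v w s))\<^sup>2 \<le> E * q" using post[OF s] by linarith
      qed (use p in auto)
      also have "\<dots> = E powr p * q powr p" by (rule powr_mult)
      also have "\<dots> \<le> E powr p * (\<epsilon> / 2)" using qp by (intro mult_left_mono) auto
      finally show ?thesis using False by simp
    qed
    have "gain b (\<lambda>u. ((norm u)\<^sup>2) powr p) v w \<le>
      (LINT s|usphere. b (cos_dev v w s) * (E powr p * (\<epsilon> / 2 + indicator {s. 1 - \<delta> < \<bar>e' \<bullet> s\<bar>} s)))"
      unfolding gain_def
    proof (rule kernel_mult_mono)
      show "integrable usphere (\<lambda>s. b (cos_dev v w s) * ((norm (post_vel v w s))\<^sup>2) powr p)"
        using p norm_post_vel_le[of _ v w]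
        by (intro kernel_mult_integrable[OF vw, where C="E powr p"]) (auto simp: E_def intro!: powr_mono2)
      show "integrable usphere (\<lambda>s. b (cos_dev v w s) * (E powr p * (\<epsilon> / 2 + indicator {s. 1 - \<delta> < \<bar>e' \<bullet> s\<bar>} s)))"
      proof (rule kernel_mult_integrable[OF vw, where C="E powr p * (\<epsilon> / 2 + 1)"])
        fix s :: 'a
        have "\<bar>\<epsilon> / 2 + indicator {s. 1 - \<delta> < \<bar>e' \<bullet> s\<bar>} s\<bar> \<le> \<epsilon> / 2 + 1"
          using assms by (simp add: indicator_def)
        then show "\<bar>E powr p * (\<epsilon> / 2 + indicator {s. 1 - \<delta> < \<bar>e' \<bullet> s\<bar>} s)\<bar> \<le> E powr p * (\<epsilon> / 2 + 1)"
          by (simp only: abs_mult abs_of_nonneg[OF powr_ge_zero]) (intro mult_left_mono, auto)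
      qed measurable
    qed (rule g1)
    also have "\<dots> = (LINT s|usphere. E powr p * (\<epsilon> / 2) * b (cos_dev v w s) +
        E powr p * (b (cos_dev v w s) * indicator {s. 1 - \<delta> < \<bar>e' \<bullet> s\<bar>} s))"
      by (simp add: algebra_simps)
    also have "\<dots> = E powr p * (\<epsilon> / 2) * (LINT s|usphere. b (cos_dev v w s)) +
        E powr p * (LINT s|usphere. b (cos_dev v w s) * indicator {s. 1 - \<delta> < \<bar>e' \<bullet> s\<bar>} s)"
      using i1 kernel_integrable[OF vw] by (subst Bochner_Integration.integral_add) auto
    also have "\<dots> \<le> E powr p * (\<epsilon> / 2) * L + E powr p * (\<epsilon> * L / 2)"
      unfolding c using cap[of ?e e'] vw e' kernel_integral[OF vw] assms
      by (intro add_mono mult_left_mono) (auto simp: c)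
    also have "\<dots> = \<epsilon> * L * E powr p" by simp
    finally show "gain b (\<lambda>u. ((norm u)\<^sup>2) powr p) v w \<le> \<epsilon> * L * ((norm v)\<^sup>2 + (norm w)\<^sup>2) powr p"
      unfolding E_def .
  qed simp
qed

end

section \<open>The collision map and the weak form\<close>

text \<open>The change of variables is made of two translations, v = w + u at fixed w and w = V - u
  / 2 at fixed u, with the order of integration exchanged around them, so no determinant has to be
  computed.\<close>

lemma nn_integral_center_of_mass:
  fixes G :: "'a::euclidean_space \<Rightarrow> 'a \<Rightarrow> ennreal"
  assumes [measurable]: "case_prod G \<in> borel_measurable (borel \<Otimes>\<^sub>M borel)"
  shows "(\<integral>\<^sup>+ v. \<integral>\<^sup>+ w. G v w \<partial>lborel \<partial>lborel) =
    (\<integral>\<^sup>+ V. \<integral>\<^sup>+ u. G (V + u /\<^sub>R 2) (V - u /\<^sub>R 2) \<partial>lborel \<partial>lborel)"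
proof -
  have "(\<integral>\<^sup>+ v. \<integral>\<^sup>+ w. G v w \<partial>lborel \<partial>lborel) = (\<integral>\<^sup>+ w. \<integral>\<^sup>+ v. G v w \<partial>lborel \<partial>lborel)"
    by (rule lborel_pair.Fubini'[symmetric]) measurable
  also have "\<dots> = (\<integral>\<^sup>+ w. \<integral>\<^sup>+ u. G (w + u) w \<partial>lborel \<partial>lborel)"
  proof (rule nn_integral_cong)
    fix w :: 'a
    show "(\<integral>\<^sup>+ v. G v w \<partial>lborel) = (\<integral>\<^sup>+ u. G (w + u) w \<partial>lborel)"
      by (rule nn_integral_lborel_translate[symmetric, where g="\<lambda>v. G v w"]) measurable
  qed
  also have "\<dots> = (\<integral>\<^sup>+ u. \<integral>\<^sup>+ w. G (w + u) w \<partial>lborel \<partial>lborel)"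
    by (rule lborel_pair.Fubini'[symmetric]) measurable
  also have "\<dots> = (\<integral>\<^sup>+ u. \<integral>\<^sup>+ V. G (V + u /\<^sub>R 2) (V - u /\<^sub>R 2) \<partial>lborel \<partial>lborel)"
  proof (rule nn_integral_cong)
    fix u :: 'a
    have h: "- (u /\<^sub>R 2) + V + u = V + u /\<^sub>R 2" "- (u /\<^sub>R 2) + V = V - u /\<^sub>R 2" for V
      using scaleR_half_double[of u] by (simp_all add: algebra_simps)
    have "(\<integral>\<^sup>+ V. G (- (u /\<^sub>R 2) + V + u) (- (u /\<^sub>R 2) + V) \<partial>lborel) = (\<integral>\<^sup>+ w. G (w + u) w \<partial>lborel)"
      by (rule nn_integral_lborel_translate[where g="\<lambda>w. G (w + u) w"]) measurable
    then show "(\<integral>\<^sup>+ w. G (w + u) w \<partial>lborel) = (\<integral>\<^sup>+ V. G (V + u /\<^sub>R 2) (V - u /\<^sub>R 2) \<partial>lborel)"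
      unfolding h(1) unfolding h(2) by (rule sym)
  qed
  also have "\<dots> = (\<integral>\<^sup>+ V. \<integral>\<^sup>+ u. G (V + u /\<^sub>R 2) (V - u /\<^sub>R 2) \<partial>lborel \<partial>lborel)"
    by (rule lborel_pair.Fubini'[symmetric]) measurable
  finally show ?thesis .
qed

text \<open>The third component keeps the old direction of v - w. With it the map is an involution
  for unit s and v \<noteq> w, and the cosine is unchanged.\<close>

definition collide :: "'a::euclidean_space \<times> 'a \<times> 'a \<Rightarrow> 'a \<times> 'a \<times> 'a" where
  "collide = (\<lambda>(v, w, s). (post_vel v w s, post_vel_star v w s, (v - w) /\<^sub>R norm (v - w)))"

abbreviation collision_measure :: "('a::euclidean_space \<times> 'a \<times> 'a) measure" where
  "collision_measure \<equiv> lborel \<Otimes>\<^sub>M (lborel \<Otimes>\<^sub>M usphere)"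

lemma measurable_collide [measurable]:
  "collide \<in> (collision_measure :: ('a::euclidean_space \<times> 'a \<times> 'a) measure) \<rightarrow>\<^sub>M collision_measure"
  unfolding collide_def by measurable

interpretation lborel_usphere: pair_sigma_finite "lborel :: 'a::euclidean_space measure" "usphere :: 'a measure" ..

interpretation collision: pair_sigma_finite "lborel :: 'a::euclidean_space measure" "lborel \<Otimes>\<^sub>M usphere :: ('a \<times> 'a) measure" ..

lemma nn_integral_collision_measure:
  assumes [measurable]: "F \<in> borel_measurable (collision_measure :: ('a::euclidean_space \<times> 'a \<times> 'a) measure)"
  shows "(\<integral>\<^sup>+ x. F x \<partial>collision_measure) = (\<integral>\<^sup>+ v. \<integral>\<^sup>+ w. \<integral>\<^sup>+ s. F (v, w, s) \<partial>usphere \<partial>lborel \<partial>lborel)"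
proof -
  have "(\<integral>\<^sup>+ x. F x \<partial>collision_measure) = (\<integral>\<^sup>+ v. \<integral>\<^sup>+ y. F (v, y) \<partial>(lborel \<Otimes>\<^sub>M usphere) \<partial>lborel)"
    by (rule sigma_finite_measure.nn_integral_fst[symmetric, OF sigma_finite_pair_measure[OF sigma_finite_lborel usphere.sigma_finite_measure_axioms]]) measurable
  also have "\<dots> = (\<integral>\<^sup>+ v. \<integral>\<^sup>+ w. \<integral>\<^sup>+ s. F (v, w, s) \<partial>usphere \<partial>lborel \<partial>lborel)"
    by (intro nn_integral_cong usphere.nn_integral_fst[symmetric]) measurable
  finally show ?thesis .
qed

text \<open>
  In centre of mass coordinates \<open>V\<close>, \<open>u = v - w\<close> the collision map exchanges the direction of \<open>u\<close> with \<open>s\<close>.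
\<close>
lemma distr_collide:
  "distr collision_measure collision_measure collide = (collision_measure :: ('a::euclidean_space \<times> 'a \<times> 'a) measure)"
proof (rule measure_eqI)
  fix A :: "('a \<times> 'a \<times> 'a) set"
  assume "A \<in> sets (distr collision_measure collision_measure collide)"
  then have A[measurable]: "A \<in> sets (collision_measure :: ('a \<times> 'a \<times> 'a) measure)" by simp
  define F :: "'a \<times> 'a \<times> 'a \<Rightarrow> ennreal" where "F = indicator A"
  have F[measurable]: "F \<in> borel_measurable collision_measure" unfolding F_def by measurable
  have F'[measurable]: "F \<in> borel_measurable (borel \<Otimes>\<^sub>M (borel \<Otimes>\<^sub>M borel))" using F by (simp cong: measurable_cong_sets)
  have "emeasure (distr collision_measure collision_measure collide) A = (\<integral>\<^sup>+ x. F x \<partial>distr collision_measure collision_measure collide)"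
    unfolding F_def by (subst nn_integral_indicator) (simp_all only: sets_distr A)
  also have "\<dots> = (\<integral>\<^sup>+ x. F (collide x) \<partial>collision_measure)"
    by (rule nn_integral_distr) auto
  also have "\<dots> = (\<integral>\<^sup>+ v. \<integral>\<^sup>+ w. \<integral>\<^sup>+ s. F (collide (v, w, s)) \<partial>usphere \<partial>lborel \<partial>lborel)"
    by (rule nn_integral_collision_measure) measurable
  also have "\<dots> = (\<integral>\<^sup>+ v. \<integral>\<^sup>+ w. \<integral>\<^sup>+ s. F (post_vel v w s, post_vel_star v w s, (v - w) /\<^sub>R norm (v - w)) \<partial>usphere \<partial>lborel \<partial>lborel)"
    by (simp add: collide_def)
  also have "\<dots> = (\<integral>\<^sup>+ V. \<integral>\<^sup>+ u. \<integral>\<^sup>+ s. F (post_vel (V + u /\<^sub>R 2) (V - u /\<^sub>R 2) s, post_vel_star (V + u /\<^sub>R 2) (V - u /\<^sub>R 2) s,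
      ((V + u /\<^sub>R 2) - (V - u /\<^sub>R 2)) /\<^sub>R norm ((V + u /\<^sub>R 2) - (V - u /\<^sub>R 2))) \<partial>usphere \<partial>lborel \<partial>lborel)"
    by (rule nn_integral_center_of_mass) measurable
  also have "\<dots> = (\<integral>\<^sup>+ V. \<integral>\<^sup>+ u. \<integral>\<^sup>+ s. F (V + (norm u *\<^sub>R s) /\<^sub>R 2, V - (norm u *\<^sub>R s) /\<^sub>R 2, u /\<^sub>R norm u) \<partial>usphere \<partial>lborel \<partial>lborel)"
  proof -
    have "(V + u /\<^sub>R 2) - (V - u /\<^sub>R 2) = u" "(V + u /\<^sub>R 2) + (V - u /\<^sub>R 2) = V + V" for V u :: 'a
      using scaleR_half_double[of u] by (simp_all add: algebra_simps)
    then show ?thesis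
      unfolding post_vel_def post_vel_star_def by (simp add: scaleR_right_distrib flip: scaleR_add_left)
  qed
  also have "\<dots> = (\<integral>\<^sup>+ V. \<integral>\<^sup>+ u. \<integral>\<^sup>+ s. F (V + u /\<^sub>R 2, V - u /\<^sub>R 2, s) \<partial>usphere \<partial>lborel \<partial>lborel)"
  proof (rule nn_integral_cong)
    fix V :: 'a
    have "(\<lambda>(u, s). F (V + u /\<^sub>R 2, V - u /\<^sub>R 2, s)) \<in> borel_measurable (borel \<Otimes>\<^sub>M borel)" by measurable
    then have "(\<lambda>(u, s). F (V + u /\<^sub>R 2, V - u /\<^sub>R 2, s)) \<in> borel_measurable borel" by (simp add: borel_prod)
    from nn_integral_usphere_swap[OF this]
    show "(\<integral>\<^sup>+ u. \<integral>\<^sup>+ s. F (V + (norm u *\<^sub>R s) /\<^sub>R 2, V - (norm u *\<^sub>R s) /\<^sub>R 2, u /\<^sub>R norm u) \<partial>usphere \<partial>lborel) =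
      (\<integral>\<^sup>+ u. \<integral>\<^sup>+ s. F (V + u /\<^sub>R 2, V - u /\<^sub>R 2, s) \<partial>usphere \<partial>lborel)"
      by simp
  qed
  also have "\<dots> = (\<integral>\<^sup>+ v. \<integral>\<^sup>+ w. \<integral>\<^sup>+ s. F (v, w, s) \<partial>usphere \<partial>lborel \<partial>lborel)"
    by (rule nn_integral_center_of_mass[symmetric]) measurable
  also have "\<dots> = (\<integral>\<^sup>+ x. F x \<partial>collision_measure)"
    by (rule nn_integral_collision_measure[symmetric]) measurable
  finally show "emeasure (distr collision_measure collision_measure collide) A = emeasure collision_measure A"
    unfolding F_def by (simp only: nn_integral_indicator A)
qed simp

section \<open>The weak form for a fixed density\<close>

lemma integrable_pair_mult:
  fixes f :: "'a \<Rightarrow> real" and g :: "'b \<Rightarrow> real"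
  assumes "sigma_finite_measure M" "sigma_finite_measure N"
    and f: "integrable M f" and g: "integrable N g"
  shows "integrable (M \<Otimes>\<^sub>M N) (\<lambda>(x, y). f x * g y)"
proof -
  interpret M: sigma_finite_measure M by fact
  interpret N: sigma_finite_measure N by fact
  interpret pair_sigma_finite M N ..
  have [measurable]: "f \<in> borel_measurable M" "g \<in> borel_measurable N" using f g by auto
  show ?thesis
  proof (rule Fubini_integrable)
    show "integrable M (\<lambda>x. LINT y|N. norm (case (x, y) of (x, y) \<Rightarrow> f x * g y))"
      using f by (simp add: abs_mult)
    show "AE x in M. integrable N (\<lambda>y. case (x, y) of (x, y) \<Rightarrow> f x * g y)"
      using g by simp
  qed measurable
qed

lemma integral_pair_mult:
  fixes f :: "'a \<Rightarrow> real" and g :: "'b \<Rightarrow> real"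
  assumes "sigma_finite_measure M" "sigma_finite_measure N"
    and f: "integrable M f" and g: "integrable N g"
  shows "(LINT (x, y)|(M \<Otimes>\<^sub>M N). f x * g y) = (LINT x|M. f x) * (LINT y|N. g y)"
proof -
  interpret M: sigma_finite_measure M by fact
  interpret N: sigma_finite_measure N by fact
  interpret pair_sigma_finite M N ..
  have "(LINT (x, y)|(M \<Otimes>\<^sub>M N). f x * g y) = (LINT x|M. LINT y|N. f x * g y)"
    using integral_fst'[OF integrable_pair_mult[OF assms], symmetric] by simp
  then show ?thesis by simp
qed

text \<open>The bound is a product of a function of v and one of w, so that double integrals are
  controlled by mass and energy; \<beta> \<le> 2 makes the energy sufficient.\<close>

lemma norm_diff_powr_le:
  fixes v w :: "'a::euclidean_space"
  assumes "0 < \<beta>" "\<beta> \<le> 2"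
  shows "norm (v - w) powr \<beta> \<le> 2 * ((1 + (norm v)\<^sup>2) * (1 + (norm w)\<^sup>2))"
proof -
  have "norm (v - w) powr \<beta> \<le> 1 + (norm (v - w))\<^sup>2"
  proof (cases "norm (v - w) \<le> 1")
    case True
    then have "norm (v - w) powr \<beta> \<le> 1" using assms by (intro powr_le1) auto
    then show ?thesis using zero_le_power2[of "norm (v - w)"] by linarith
  next
    case False
    then have "norm (v - w) powr \<beta> \<le> norm (v - w) powr 2" using assms by (intro powr_mono) auto
    then show ?thesis using False by (simp add: powr_numeral)
  qed
  also have "(norm (v - w))\<^sup>2 \<le> 2 * (norm v)\<^sup>2 + 2 * (norm w)\<^sup>2"
  proof -
    have "(norm (v - w))\<^sup>2 + (norm (v + w))\<^sup>2 = 2 * (norm v)\<^sup>2 + 2 * (norm w)\<^sup>2"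
      unfolding power2_norm_eq_inner by (simp add: inner_simps inner_commute)
    then show ?thesis using zero_le_power2[of "norm (v + w)"] by linarith
  qed
  also have "1 + (2 * (norm v)\<^sup>2 + 2 * (norm w)\<^sup>2) \<le> 2 * ((1 + (norm v)\<^sup>2) * (1 + (norm w)\<^sup>2))"
    by (simp add: algebra_simps)
  finally show ?thesis by simp
qed

lemma borel_measurable_gain [measurable]:
  assumes [measurable]: "b \<in> borel_measurable borel" "\<phi> \<in> borel_measurable borel"
  shows "(\<lambda>(v, w). gain b \<phi> v w) \<in> borel_measurable (borel \<Otimes>\<^sub>M borel)"
  unfolding gain_def by measurable

text \<open>The integrand before symmetrization: the gain at one outgoing particle minus the loss of
  v alone, with the sphere integral of b already written as L. On the diagonal the cosine is
  meaningless, but there the factor |v - w|^\<beta> is zero.\<close>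

definition weak_collision ::
    "(real \<Rightarrow> real) \<Rightarrow> real \<Rightarrow> real \<Rightarrow> ('a::euclidean_space \<Rightarrow> real) \<Rightarrow> 'a \<Rightarrow> 'a \<Rightarrow> real" where
  "weak_collision b L \<beta> \<phi> v w = norm (v - w) powr \<beta> * (gain b \<phi> v w - L * \<phi> v)"

lemma borel_measurable_weak_collision [measurable]:
  assumes [measurable]: "b \<in> borel_measurable borel" "\<phi> \<in> borel_measurable borel"
  shows "(\<lambda>(v, w). weak_collision b L \<beta> \<phi> v w) \<in> borel_measurable (borel \<Otimes>\<^sub>M borel)"
proof -
  have [measurable]: "(\<lambda>x. gain b \<phi> (fst x) (snd x)) \<in> borel_measurable (borel \<Otimes>\<^sub>M borel)"
    using borel_measurable_gain[OF assms] by (simp add: case_prod_beta')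
  show ?thesis unfolding weak_collision_def case_prod_beta' by measurable
qed

lemma weak_collision_same [simp]: "0 < \<beta> \<Longrightarrow> weak_collision b L \<beta> \<phi> v v = 0"
  by (simp add: weak_collision_def)

lemma (in angular_kernel) abs_weak_collision_le:
  fixes v w :: 'a
  assumes \<beta>: "0 < \<beta>" and [measurable]: "\<phi> \<in> borel_measurable borel"
    and bd: "\<And>s. norm s = 1 \<Longrightarrow> \<bar>\<phi> (post_vel v w s)\<bar> \<le> C" "\<bar>\<phi> v\<bar> \<le> C"
  shows "\<bar>weak_collision b L \<beta> \<phi> v w\<bar> \<le> norm (v - w) powr \<beta> * (2 * L * C)"
proof (cases "v = w")
  case False
  have i: "integrable usphere (\<lambda>s. b (cos_dev v w s) * \<phi> (post_vel v w s))"
    by (rule kernel_mult_integrable[OF False _ bd(1)]) measurable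
  have 1: "gain b \<phi> v w \<le> L * C"
    unfolding gain_def
  proof (rule kernel_mult_le[OF False, where C'=C])
    show "\<phi> (post_vel v w s) \<le> C" if "norm s = 1" for s using bd(1)[OF that] by simp
  qed (measurable, use bd(1) in auto)
  have 2: "- gain b \<phi> v w \<le> L * C"
  proof -
    have "(LINT s|usphere. b (cos_dev v w s) * - \<phi> (post_vel v w s)) \<le> L * C"
    proof (rule kernel_mult_le[OF False, where C'=C])
      show "- \<phi> (post_vel v w s) \<le> C" if "norm s = 1" for s using bd(1)[OF that] by simp
    qed (measurable, use bd(1) in auto)
    then show ?thesis by (simp add: gain_def)
  qed
  have "\<bar>L * \<phi> v\<bar> \<le> L * C" using L_pos bd(2) by (simp add: abs_mult)
  with 1 2 have "\<bar>gain b \<phi> v w - L * \<phi> v\<bar> \<le> 2 * L * C" by linarith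
  then show ?thesis
    unfolding weak_collision_def by (simp add: abs_mult mult_left_mono)
qed (use \<beta> in simp)

lemma AE_collision_measure_norm:
  "AE (v, w, s) in (collision_measure :: ('a::euclidean_space \<times> 'a \<times> 'a) measure). norm s = 1"
proof -
  have A: "AE y in (lborel \<Otimes>\<^sub>M usphere :: ('a \<times> 'a) measure). norm (snd y) = 1"
    by (rule lborel_usphere.AE_pair_measure) (measurable, rule AE_I2, simp add: AE_usphere_norm)
  have "AE x in (collision_measure :: ('a \<times> 'a \<times> 'a) measure). norm (snd (snd x)) = 1"
    by (rule collision.AE_pair_measure) (measurable, rule AE_I2, simp add: A)
  then show ?thesis by (simp add: case_prod_beta')
qed

lemma collide_collide:
  assumes s: "norm s = 1" and "v \<noteq> w"
  shows "norm (post_vel v w s - post_vel_star v w s) = norm (v - w)"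
    "cos_dev (post_vel v w s) (post_vel_star v w s) ((v - w) /\<^sub>R norm (v - w)) = cos_dev v w s"
    "post_vel (post_vel v w s) (post_vel_star v w s) ((v - w) /\<^sub>R norm (v - w)) = v"
proof -
  have d: "post_vel v w s - post_vel_star v w s = norm (v - w) *\<^sub>R s"
    unfolding post_vel_def post_vel_star_def by (simp flip: scaleR_add_left)
  show n: "norm (post_vel v w s - post_vel_star v w s) = norm (v - w)"
    unfolding d using s by simp
  show "cos_dev (post_vel v w s) (post_vel_star v w s) ((v - w) /\<^sub>R norm (v - w)) = cos_dev v w s"
    unfolding cos_dev_def n unfolding d using assms by (simp add: inner_commute)
  have a: "post_vel v w s + post_vel_star v w s = v + w"
    unfolding post_vel_def post_vel_star_def by (simp flip: scaleR_add_left)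
  show "post_vel (post_vel v w s) (post_vel_star v w s) ((v - w) /\<^sub>R norm (v - w)) = v"
    unfolding post_vel_def[of "post_vel v w s"] n a using assms scaleR_half_double[of v]
    by (simp add: algebra_simps flip: scaleR_add_left)
qed

text \<open>The Borel representative of a solution at one time, nonnegative at every point. Finite
  mass and energy are what a solution offers directly at a positive time.\<close>

definition regular_density :: "('a::euclidean_space \<Rightarrow> real) \<Rightarrow> bool" where
  "regular_density f \<longleftrightarrow> f \<in> borel_measurable borel \<and> (\<forall>v. 0 \<le> f v) \<and>
     integrable lborel f \<and> integrable lborel (\<lambda>v. (norm v)\<^sup>2 * f v)"

lemma regular_densityD:
  assumes "regular_density f"
  shows "f \<in> borel_measurable borel" "0 \<le> f v" "integrable lborel f"
    "integrable lborel (\<lambda>v. (1 + (norm v)\<^sup>2) * f v)"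
  using assms unfolding regular_density_def by (auto simp: distrib_right)

lemma finite_measure_regular_density:
  assumes "regular_density f"
  shows "finite_measure (density lborel (\<lambda>v. ennreal (f v)))"
proof
  have "(\<integral>\<^sup>+ v. ennreal (f v) \<partial>lborel) = ennreal (LINT v|lborel. f v)"
    using regular_densityD[OF assms] by (intro nn_integral_eq_integral) auto
  then show "emeasure (density lborel (\<lambda>v. ennreal (f v))) (space (density lborel (\<lambda>v. ennreal (f v)))) \<noteq> \<infinity>"
    using regular_densityD(1)[OF assms] by (simp add: emeasure_density)
qed

lemma pair_measure_regular_density:
  assumes f: "regular_density f"
  shows "density lborel (\<lambda>v. ennreal (f v)) \<Otimes>\<^sub>M density lborel (\<lambda>v. ennreal (f v)) =
    density (lborel \<Otimes>\<^sub>M lborel) (\<lambda>x. ennreal (f (fst x) * f (snd x)))"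
proof -
  note [measurable] = regular_densityD(1)[OF f]
  interpret finite_measure "density lborel (\<lambda>v. ennreal (f v))" by (rule finite_measure_regular_density[OF f])
  have "density lborel (\<lambda>v. ennreal (f v)) \<Otimes>\<^sub>M density lborel (\<lambda>v. ennreal (f v)) =
      density (lborel \<Otimes>\<^sub>M lborel) (\<lambda>(x, y). ennreal (f x) * ennreal (f y))"
    by (rule pair_measure_density) (simp_all add: sigma_finite_lborel sigma_finite_measure_axioms)
  also have "(\<lambda>(x, y). ennreal (f x) * ennreal (f y)) = (\<lambda>x. ennreal (f (fst x) * f (snd x)))"
    using regular_densityD(2)[OF f] by (auto simp: fun_eq_iff ennreal_mult')
  finally show ?thesis .
qed

context angular_kernel
begin

text \<open>Absolute integrability before averaging over the sphere. It permits gain and loss to be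
  separated, and the order of integration to be exchanged, for bounded test functions.\<close>

lemma collision_rate_integrable:
  fixes f :: "'a \<Rightarrow> real"
  assumes \<beta>: "0 < \<beta>" "\<beta> \<le> 2" and f: "regular_density f"
  shows "integrable collision_measure (\<lambda>(v, w, s). norm (v - w) powr \<beta> * b (cos_dev v w s) * (f v * f w))"
proof (rule integrableI_bounded)
  note [measurable] = regular_densityD(1)[OF f]
  note f0 = regular_densityD(2)[OF f]
  show "(\<lambda>(v, w, s). norm (v - w) powr \<beta> * b (cos_dev v w s) * (f v * f w)) \<in> borel_measurable collision_measure"
    by measurable
  let ?h = "\<lambda>v. (1 + (norm v)\<^sup>2) * f v"
  have h: "integrable (lborel \<Otimes>\<^sub>M lborel) (\<lambda>(v, w). ?h v * ?h w)"
    by (intro integrable_pair_mult sigma_finite_lborel regular_densityD(4)[OF f])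
  have "(\<integral>\<^sup>+ x. ennreal (norm (case x of (v, w, s) \<Rightarrow> norm (v - w) powr \<beta> * b (cos_dev v w s) * (f v * f w))) \<partial>collision_measure)
     = (\<integral>\<^sup>+ v. \<integral>\<^sup>+ w. \<integral>\<^sup>+ s. ennreal (norm (norm (v - w) powr \<beta> * b (cos_dev v w s) * (f v * f w))) \<partial>usphere \<partial>lborel \<partial>lborel)"
    by (subst nn_integral_collision_measure) simp_all
  also have "\<dots> \<le> (\<integral>\<^sup>+ v. \<integral>\<^sup>+ w. ennreal (2 * L * (?h v * ?h w)) \<partial>lborel \<partial>lborel)"
  proof (intro nn_integral_mono)
    fix v w :: 'a
    show "(\<integral>\<^sup>+ s. ennreal (norm (norm (v - w) powr \<beta> * b (cos_dev v w s) * (f v * f w))) \<partial>usphere) \<le> ennreal (2 * L * (?h v * ?h w))"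
    proof (cases "v = w")
      case False
      have "(\<integral>\<^sup>+ s. ennreal (norm (norm (v - w) powr \<beta> * b (cos_dev v w s) * (f v * f w))) \<partial>usphere) =
        (\<integral>\<^sup>+ s. ennreal (norm (v - w) powr \<beta> * (f v * f w) * b (cos_dev v w s)) \<partial>usphere)"
        using b_nonneg f0 by (simp add: abs_mult mult_ac)
      also have "\<dots> = ennreal (LINT s|usphere. norm (v - w) powr \<beta> * (f v * f w) * b (cos_dev v w s))"
        using b_nonneg f0 kernel_integrable[OF False] by (intro nn_integral_eq_integral) auto
      also have "(LINT s|usphere. norm (v - w) powr \<beta> * (f v * f w) * b (cos_dev v w s)) = norm (v - w) powr \<beta> * (f v * f w) * L"
        using kernel_integral[OF False] by simp
      also have "\<dots> \<le> 2 * ((1 + (norm v)\<^sup>2) * (1 + (norm w)\<^sup>2)) * (f v * f w) * L"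
        using norm_diff_powr_le[OF \<beta>, of v w] f0 L_pos by (intro mult_right_mono) auto
      finally show ?thesis by (simp add: mult_ac ennreal_leI)
    qed (use \<beta> in simp)
  qed
  also have "\<dots> = (\<integral>\<^sup>+ x. ennreal (2 * L * (?h (fst x) * ?h (snd x))) \<partial>(lborel \<Otimes>\<^sub>M lborel))"
    by (subst lborel.nn_integral_fst[symmetric]) simp_all
  also have "\<dots> < \<infinity>"
  proof -
    have "integrable (lborel \<Otimes>\<^sub>M lborel) (\<lambda>x. 2 * L * (?h (fst x) * ?h (snd x)))"
      using h by (simp add: case_prod_beta')
    then have "(\<integral>\<^sup>+ x. ennreal (norm (2 * L * (?h (fst x) * ?h (snd x)))) \<partial>(lborel \<Otimes>\<^sub>M lborel)) < \<infinity>"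
      unfolding integrable_iff_bounded by blast
    moreover have "(\<integral>\<^sup>+ x. ennreal (2 * L * (?h (fst x) * ?h (snd x))) \<partial>(lborel \<Otimes>\<^sub>M lborel)) \<le>
      (\<integral>\<^sup>+ x. ennreal (norm (2 * L * (?h (fst x) * ?h (snd x)))) \<partial>(lborel \<Otimes>\<^sub>M lborel))"
      by (intro nn_integral_mono ennreal_leI) simp
    ultimately show ?thesis by (rule le_less_trans[rotated])
  qed
  finally show "(\<integral>\<^sup>+ x. ennreal (norm (case x of (v, w, s) \<Rightarrow> norm (v - w) powr \<beta> * b (cos_dev v w s) * (f v * f w))) \<partial>collision_measure) < \<infinity>" .
qed

lemma weak_collision_integrable:
  fixes f :: "'a \<Rightarrow> real"
  assumes \<beta>: "0 < \<beta>" "\<beta> \<le> 2" and f: "regular_density f"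
    and [measurable]: "\<phi> \<in> borel_measurable borel" and \<phi>: "\<And>v. \<bar>\<phi> v\<bar> \<le> C"
  shows "integrable (lborel \<Otimes>\<^sub>M lborel) (\<lambda>(v, w). f v * f w * weak_collision b L \<beta> \<phi> v w)"
proof (rule Bochner_Integration.integrable_bound)
  note [measurable] = regular_densityD(1)[OF f]
  note f0 = regular_densityD(2)[OF f]
  let ?h = "\<lambda>v. (1 + (norm v)\<^sup>2) * f v"
  show "integrable (lborel \<Otimes>\<^sub>M lborel) (\<lambda>x. 4 * L * C * (case x of (v, w) \<Rightarrow> ?h v * ?h w))"
    by (intro integrable_mult_right integrable_pair_mult sigma_finite_lborel regular_densityD(4)[OF f])
  have C: "0 \<le> C" using \<phi>[of 0] by linarith
  show "AE x in lborel \<Otimes>\<^sub>M lborel. norm (case x of (v, w) \<Rightarrow> f v * f w * weak_collision b L \<beta> \<phi> v w) \<le>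
      norm (4 * L * C * (case x of (v, w) \<Rightarrow> ?h v * ?h w))"
  proof (rule AE_I2)
    fix x :: "'a \<times> 'a"
    obtain v w where x: "x = (v, w)" by (cases x)
    have "\<bar>weak_collision b L \<beta> \<phi> v w\<bar> \<le> norm (v - w) powr \<beta> * (2 * L * C)"
      using \<phi> by (intro abs_weak_collision_le \<beta>) auto
    also have "\<dots> \<le> 2 * ((1 + (norm v)\<^sup>2) * (1 + (norm w)\<^sup>2)) * (2 * L * C)"
      using norm_diff_powr_le[OF \<beta>, of v w] L_pos C by (intro mult_right_mono) auto
    finally have "f v * f w * \<bar>weak_collision b L \<beta> \<phi> v w\<bar> \<le> f v * f w * (2 * ((1 + (norm v)\<^sup>2) * (1 + (norm w)\<^sup>2)) * (2 * L * C))"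
      using f0 by (intro mult_left_mono) auto
    then show "norm (case x of (v, w) \<Rightarrow> f v * f w * weak_collision b L \<beta> \<phi> v w) \<le>
      norm (4 * L * C * (case x of (v, w) \<Rightarrow> ?h v * ?h w))"
      using f0 L_pos C by (simp add: x abs_mult algebra_simps)
  qed
  show "(\<lambda>(v, w). f v * f w * weak_collision b L \<beta> \<phi> v w) \<in> borel_measurable (lborel \<Otimes>\<^sub>M lborel)"
  proof -
    have [measurable]: "(\<lambda>x. weak_collision b L \<beta> \<phi> (fst x) (snd x)) \<in> borel_measurable (borel \<Otimes>\<^sub>M borel)"
      using borel_measurable_weak_collision[of b \<phi>] by (simp add: case_prod_beta')
    show ?thesis unfolding case_prod_beta' by measurable
  qed
qed

text \<open>The gain part is a function \<open>g3\<close> composed with \<open>collide\<close>, so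
  invariance of the measure moves the test function from v to v'. Boundedness of \<phi> makes both
  parts integrable on their own.\<close>

theorem weak_form_static:
  fixes f :: "'a \<Rightarrow> real"
  assumes \<beta>: "0 < \<beta>" "\<beta> \<le> 2" and f: "regular_density f"
    and [measurable]: "\<phi> \<in> borel_measurable borel" and \<phi>: "\<And>v. \<bar>\<phi> v\<bar> \<le> C"
  defines "Q \<equiv> \<lambda>v. LINT (w, s)|(lborel \<Otimes>\<^sub>M usphere). norm (v - w) powr \<beta> * b (cos_dev v w s) *
      (f (post_vel_star v w s) * f (post_vel v w s) - f w * f v)"
    and "\<mu> \<equiv> density lborel (\<lambda>v. ennreal (f v))"
  shows "(LINT v|lborel. \<phi> v * Q v) = (LINT (v, w)|(\<mu> \<Otimes>\<^sub>M \<mu>). weak_collision b L \<beta> \<phi> v w)"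
    "integrable (\<mu> \<Otimes>\<^sub>M \<mu>) (\<lambda>(v, w). weak_collision b L \<beta> \<phi> v w)"
proof -
  note [measurable] = regular_densityD(1)[OF f]
  note f0 = regular_densityD(2)[OF f]
  have C: "0 \<le> C" using \<phi>[of 0] by linarith
  let ?P = "collision_measure :: ('a \<times> 'a \<times> 'a) measure"
  define rate where "rate = (\<lambda>v w s. norm (v - w) powr \<beta> * b (cos_dev v (w::'a) s))"
  have [measurable]: "(\<lambda>x. rate (fst x) (fst (snd x)) (snd (snd x))) \<in> borel_measurable ?P"
    unfolding rate_def by measurable
  define g1 where "g1 = (\<lambda>x::'a\<times>'a\<times>'a. case x of (v, w, s) \<Rightarrow> rate v w s * (f v * f w) * \<phi> v)"
  define g3 where "g3 = (\<lambda>x::'a\<times>'a\<times>'a. case x of (v, w, s) \<Rightarrow> rate v w s * (f v * f w) * \<phi> (post_vel v w s))"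
  define h where "h = (\<lambda>x::'a\<times>'a\<times>'a. case x of (v, w, s) \<Rightarrow> \<phi> v * (rate v w s * (f (post_vel_star v w s) * f (post_vel v w s) - f w * f v)))"
  have m[measurable]: "g1 \<in> borel_measurable ?P" "g3 \<in> borel_measurable ?P" "h \<in> borel_measurable ?P"
    unfolding g1_def g3_def h_def rate_def by measurable
  have I0: "integrable ?P (\<lambda>(v, w, s). rate v w s * (f v * f w))"
    unfolding rate_def by (rule collision_rate_integrable[OF \<beta> f])
  have rate0: "0 \<le> rate v w s" for v w s unfolding rate_def using b_nonneg by simp
  have Ig: "integrable ?P g" if [measurable]: "g \<in> borel_measurable ?P"
    and g: "\<And>v w s. \<bar>g (v, w, s)\<bar> \<le> C * (rate v w s * (f v * f w))" for g
  proof (rule Bochner_Integration.integrable_bound)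
    show "integrable ?P (\<lambda>x. C * (case x of (v, w, s) \<Rightarrow> rate v w s * (f v * f w)))"
      using I0 by (rule integrable_mult_right)
    show "AE x in ?P. norm (g x) \<le> norm (C * (case x of (v, w, s) \<Rightarrow> rate v w s * (f v * f w)))"
      using g rate0 f0 C by (intro AE_I2) (auto simp: abs_mult)
  qed measurable
  have bd: "\<bar>rate v w s * (f v * f w) * c\<bar> \<le> C * (rate v w s * (f v * f w))" if "\<bar>c\<bar> \<le> C" for v w s c
  proof -
    have "\<bar>rate v w s * (f v * f w) * c\<bar> = rate v w s * (f v * f w) * \<bar>c\<bar>"
      using rate0 f0 by (simp add: abs_mult)
    also have "\<dots> \<le> rate v w s * (f v * f w) * C"
      using rate0 f0 that by (intro mult_left_mono) auto
    finally show ?thesis by (simp add: mult.commute)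
  qed
  have I1: "integrable ?P g1" and I3: "integrable ?P g3"
    by (rule Ig; use bd \<phi> in \<open>simp add: g1_def g3_def\<close>)+
  have I3c: "integrable ?P (\<lambda>x. g3 (collide x))"
    using I3 by (subst (asm) distr_collide[symmetric]) (subst (asm) integrable_distr_eq, simp_all)
  have E3c: "(LINT x|?P. g3 (collide x)) = (LINT x|?P. g3 x)"
    by (subst (2) distr_collide[symmetric]) (subst integral_distr, simp_all)
  \<comment> \<open>By the involution, \<open>g3\<close> at the collided point has the incoming v as
    the argument of \<phi> and the outgoing velocities as the arguments of f. On the diagonal both
    sides vanish with the rate.\<close>
  have hAE: "AE x in ?P. h x = g3 (collide x) - g1 x"
    using AE_collision_measure_norm
  proof eventually_elim
    case (elim x)
    obtain v w s where x: "x = (v, w, s)" by (cases x)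
    show ?case
    proof (cases "v = w")
      case True
      then show ?thesis using \<beta> elim
        by (simp add: x h_def g1_def g3_def collide_def rate_def post_vel_def post_vel_star_def)
    next
      case False
      have "norm s = 1" using elim by (simp add: x)
      note c = collide_collide[OF this False]
      show ?thesis
        unfolding x h_def g1_def g3_def collide_def rate_def prod.case c by (simp add: algebra_simps)
    qed
  qed
  have Ih: "integrable ?P h"
    by (rule integrable_cong_AE_imp[OF Bochner_Integration.integrable_diff[OF I3c I1]])
      (measurable, use hAE in \<open>auto elim: eventually_mono\<close>)
  have "(LINT v|lborel. \<phi> v * Q v) = (LINT v|lborel. LINT y|(lborel \<Otimes>\<^sub>M usphere). h (v, y))"
    unfolding Q_def h_def rate_def by (simp add: case_prod_beta')
  also have "\<dots> = (LINT x|?P. h x)"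
    by (rule collision.integral_fst'[OF Ih])
  also have "\<dots> = (LINT x|?P. g3 (collide x) - g1 x)"
    by (intro integral_cong_AE hAE) measurable
  also have "\<dots> = (LINT x|?P. g3 x - g1 x)"
    using I1 I3 I3c E3c by simp
  also have "\<dots> = (LINT v|lborel. LINT y|(lborel \<Otimes>\<^sub>M usphere). g3 (v, y) - g1 (v, y))"
    by (rule collision.integral_fst'[symmetric, OF Bochner_Integration.integrable_diff[OF I3 I1]])
  also have "\<dots> = (LINT v|lborel. LINT w|lborel. LINT s|usphere. g3 (v, w, s) - g1 (v, w, s))"
  proof (rule integral_cong_AE)
    show "AE v in lborel. (LINT y|(lborel \<Otimes>\<^sub>M usphere). g3 (v, y) - g1 (v, y)) =
      (LINT w|lborel. LINT s|usphere. g3 (v, w, s) - g1 (v, w, s))"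
      using collision.AE_integrable_fst'[OF Bochner_Integration.integrable_diff[OF I3 I1]]
      by eventually_elim (rule lborel_usphere.integral_fst'[symmetric])
  qed measurable
  also have "\<dots> = (LINT v|lborel. LINT w|lborel. f v * f w * weak_collision b L \<beta> \<phi> v w)"
  proof (intro Bochner_Integration.integral_cong refl)
    fix v w :: 'a
    show "(LINT s|usphere. g3 (v, w, s) - g1 (v, w, s)) = f v * f w * weak_collision b L \<beta> \<phi> v w"
    proof (cases "v = w")
      case True
      then show ?thesis using \<beta> by (simp add: g1_def g3_def rate_def)
    next
      case False
      have 1: "integrable usphere (\<lambda>s. b (cos_dev v w s) * \<phi> (post_vel v w s))"
        using \<phi> by (intro kernel_mult_integrable False) auto
      have 2: "integrable usphere (\<lambda>s. b (cos_dev v w s) * \<phi> v)"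
        using kernel_integrable[OF False] by simp
      have "(LINT s|usphere. g3 (v, w, s) - g1 (v, w, s)) = (LINT s|usphere. norm (v - w) powr \<beta> * (f v * f w) *
         (b (cos_dev v w s) * \<phi> (post_vel v w s) - b (cos_dev v w s) * \<phi> v))"
        by (intro Bochner_Integration.integral_cong refl) (simp add: g3_def g1_def rate_def algebra_simps)
      also have "\<dots> = norm (v - w) powr \<beta> * (f v * f w) * (gain b \<phi> v w - L * \<phi> v)"
        using 1 2 kernel_integral[OF False] by (simp add: gain_def)
      finally show ?thesis by (simp add: weak_collision_def)
    qed
  qed
  also have "\<dots> = (LINT (v, w)|(lborel \<Otimes>\<^sub>M lborel). f v * f w * weak_collision b L \<beta> \<phi> v w)"
    using lborel_pair.integral_fst'[OF weak_collision_integrable[OF \<beta> f _ \<phi>]] by simp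
  also have "\<dots> = (LINT x|(\<mu> \<Otimes>\<^sub>M \<mu>). (case x of (v, w) \<Rightarrow> weak_collision b L \<beta> \<phi> v w))"
    unfolding \<mu>_def pair_measure_regular_density[OF f]
    by (subst integral_density) (use f0 in \<open>auto simp: case_prod_beta'\<close>)
  finally show "(LINT v|lborel. \<phi> v * Q v) = (LINT (v, w)|(\<mu> \<Otimes>\<^sub>M \<mu>). weak_collision b L \<beta> \<phi> v w)" .
  show "integrable (\<mu> \<Otimes>\<^sub>M \<mu>) (\<lambda>(v, w). weak_collision b L \<beta> \<phi> v w)"
    unfolding \<mu>_def pair_measure_regular_density[OF f]
    using weak_collision_integrable[OF \<beta> f _ \<phi>]
    by (subst integrable_density) (use f0 in \<open>auto simp: case_prod_beta'\<close>)
qed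

end

section \<open>Borel representatives and completed measures\<close>

lemma borel_measurable_completion_AE:
  assumes "k \<in> M \<rightarrow>\<^sub>M borel" and ae: "AE x in M. K x = k x"
  shows "K \<in> borel_measurable (completion M)"
proof (rule measurableI)
  fix S :: "'b set" assume S: "S \<in> sets borel"
  show "K -` S \<inter> space (completion M) \<in> sets (completion M)"
  proof (rule completion.in_sets_AE)
    show "k -` S \<inter> space M \<in> sets (completion M)"
      using measurable_sets[OF assms(1) S] by auto
    show "AE x in completion M. x \<in> k -` S \<inter> space M \<longleftrightarrow> x \<in> K -` S \<inter> space (completion M)"
      using ae by (subst AE_completion_iff) (auto elim: eventually_mono)
  qed simp
qed simp

lemma integral_completion_AE:
  fixes K k :: "'a \<Rightarrow> real"
  assumes k: "k \<in> borel_measurable M" and ae: "AE x in M. K x = k x"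
  shows "(LINT x|completion M. K x) = (LINT x|M. k x)"
proof -
  have "(LINT x|completion M. K x) = (LINT x|completion M. k x)"
    using borel_measurable_completion_AE[OF k ae] measurable_completion[OF k] ae
    by (intro integral_cong_AE) (auto simp: AE_completion_iff)
  then show ?thesis by (simp add: integral_completion[OF k])
qed

lemma integrable_completion_AE:
  fixes K k :: "'a \<Rightarrow> real"
  assumes k: "k \<in> borel_measurable M" and ae: "AE x in M. K x = k x"
  shows "integrable (completion M) K \<longleftrightarrow> integrable M k"
proof -
  have "integrable (completion M) K \<longleftrightarrow> integrable (completion M) k"
    using borel_measurable_completion_AE[OF k ae] measurable_completion[OF k] ae
    by (intro integrable_cong_AE) (auto simp: AE_completion_iff)
  then show ?thesis by (simp add: integrable_completion[OF k])
qed

lemma distr_lborel_usphere: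
  "distr (lborel \<Otimes>\<^sub>M sphere_measure) (lborel \<Otimes>\<^sub>M usphere) (\<lambda>x. x) = (lborel \<Otimes>\<^sub>M usphere :: ('a::euclidean_space \<times> 'a) measure)"
proof -
  have "distr lborel lborel (\<lambda>x::'a. x) \<Otimes>\<^sub>M distr sphere_measure borel (\<lambda>x::'a. x) =
      distr (lborel \<Otimes>\<^sub>M sphere_measure) (lborel \<Otimes>\<^sub>M borel) (\<lambda>(x, y). (x, y))"
    by (rule pair_measure_distr)
       (auto simp: measurable_sphere_measure_ident usphere.sigma_finite_measure_axioms[unfolded usphere_def])
  moreover have "sets (lborel \<Otimes>\<^sub>M borel) = sets (lborel \<Otimes>\<^sub>M (usphere :: 'a measure))"
    by (intro sets_pair_measure_cong) auto
  ultimately show ?thesis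
    by (simp add: usphere_def[symmetric] distr_id2 cong: distr_cong)
qed

lemma integral_completion_sphere:
  fixes K k :: "'a::euclidean_space \<times> 'a \<Rightarrow> real"
  assumes k[measurable]: "k \<in> borel_measurable (lborel \<Otimes>\<^sub>M usphere)" and ae: "AE x in lborel \<Otimes>\<^sub>M usphere. K x = k x"
  shows "(LINT x|completion (lborel \<Otimes>\<^sub>M sphere_measure). K x) = (LINT x|(lborel \<Otimes>\<^sub>M usphere). k x)"
proof -
  have id: "(\<lambda>x. x) \<in> (lborel \<Otimes>\<^sub>M sphere_measure) \<rightarrow>\<^sub>M (lborel \<Otimes>\<^sub>M usphere :: ('a \<times> 'a) measure)"
  proof -
    have "(\<lambda>x. (fst x, (\<lambda>y. y) (snd x))) \<in> (lborel \<Otimes>\<^sub>M sphere_measure) \<rightarrow>\<^sub>M (lborel \<Otimes>\<^sub>M usphere :: ('a \<times> 'a) measure)"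
      by (intro measurable_Pair measurable_fst measurable_compose[OF measurable_snd])
        (simp_all add: measurable_sphere_measure_ident cong: measurable_cong_sets)
    then show ?thesis by simp
  qed
  have "AE x in lborel \<Otimes>\<^sub>M sphere_measure. K x = k x"
    using AE_distrD[OF id, unfolded distr_lborel_usphere, OF ae] .
  then have "(LINT x|completion (lborel \<Otimes>\<^sub>M sphere_measure). K x) = (LINT x|(lborel \<Otimes>\<^sub>M sphere_measure). k x)"
    using measurable_compose[OF id k] by (intro integral_completion_AE) auto
  also have "\<dots> = (LINT x|(lborel \<Otimes>\<^sub>M usphere). k x)"
    using integral_distr[OF id k] unfolding distr_lborel_usphere by simp
  finally show ?thesis .
qed

text \<open>The exceptional sets are those where f differs from g, at incoming or at outgoing
  velocities, and the cosines where the two angular functions differ. Invariance of the measure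
  under \<open>collide\<close> makes the outgoing one null, and the common law N of the cosine the
  last one.\<close>

lemma collision_op_eq_AE:
  fixes f g :: "'a::euclidean_space \<Rightarrow> real" and N :: "real measure"
  assumes \<beta>: "0 < \<beta>" and [measurable]: "g \<in> borel_measurable borel" "b \<in> borel_measurable borel"
    and f: "AE v in lborel. f v = g v"
    and N: "\<And>e::'a. norm e = 1 \<Longrightarrow> distr usphere borel (\<lambda>s. e \<bullet> s) = N"
    and b: "AE t in N. b0 t = b t"
  shows "AE v in lborel. collision_op (\<lambda>r z. r powr \<beta> * b0 z) f v =
    (LINT (w, s)|(lborel \<Otimes>\<^sub>M usphere). norm (v - w) powr \<beta> * b (cos_dev v w s) *
      (g (post_vel_star v w s) * g (post_vel v w s) - g w * g v))"
proof -
  let ?P = "collision_measure :: ('a \<times> 'a \<times> 'a) measure"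
  obtain e0 :: 'a where e0: "norm e0 = 1" using vector_choose_size[of 1] by auto
  have sN[simp]: "sets N = sets borel" "space N = UNIV" unfolding N[OF e0, symmetric] by auto
  obtain A where A: "{v. f v \<noteq> g v} \<subseteq> A" "emeasure lborel A = 0" and Am[measurable]: "A \<in> sets borel"
    using AE_E[OF f] by auto
  obtain Z where Z: "{t. b0 t \<noteq> b t} \<subseteq> Z" "emeasure N Z = 0" and Zm[measurable]: "Z \<in> sets borel"
    using AE_E[OF b] by auto
  have aeA: "AE v in lborel. v \<notin> A"
    using A(2) Am by (intro AE_not_in) (auto simp: null_sets_def)
  have aeZ: "AE s in usphere. e \<bullet> s \<notin> Z" if "norm e = 1" for e :: 'a
  proof (rule AE_distrD[where f="\<lambda>s. e \<bullet> s" and P="\<lambda>t. t \<notin> Z"])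
    show "AE t in distr usphere borel (\<lambda>s. e \<bullet> s). t \<notin> Z"
      unfolding N[OF that] using Z(2) Zm by (intro AE_not_in) (auto simp: null_sets_def)
  qed measurable
  have 1: "AE x in ?P. fst x \<notin> A \<and> fst (snd x) \<notin> A"
  proof (rule collision.AE_pair_measure)
    have w: "AE y in (lborel \<Otimes>\<^sub>M usphere :: ('a \<times> 'a) measure). fst y \<notin> A"
    proof (rule lborel_usphere.AE_pair_measure)
      show "AE w in lborel. AE s in usphere. fst (w, s) \<notin> A"
        using aeA by eventually_elim simp
    qed measurable
    show "AE v in lborel. AE y in (lborel \<Otimes>\<^sub>M usphere :: ('a \<times> 'a) measure). fst (v, y) \<notin> A \<and> fst (snd (v, y)) \<notin> A"
      using aeA by eventually_elim (use w in \<open>auto elim: eventually_mono\<close>)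
  qed measurable
  have 2: "AE x in ?P. fst (collide x) \<notin> A \<and> fst (snd (collide x)) \<notin> A"
    by (rule AE_distrD[OF measurable_collide, unfolded distr_collide, OF 1])
  have A3: "AE y in (lborel \<Otimes>\<^sub>M usphere). v = fst y \<or> cos_dev v (fst y) (snd y) \<notin> Z" for v :: 'a
  proof (rule lborel_usphere.AE_pair_measure)
    show "AE w in lborel. AE s in usphere. v = fst (w, s) \<or> cos_dev v (fst (w, s)) (snd (w, s)) \<notin> Z"
    proof (rule AE_I2)
      fix w :: 'a
      show "AE s in usphere. v = fst (w, s) \<or> cos_dev v (fst (w, s)) (snd (w, s)) \<notin> Z"
      proof (cases "v = w")
        case False
        then have "norm ((v - w) /\<^sub>R norm (v - w)) = 1" by simp
        from aeZ[OF this] show ?thesis by eventually_elim (simp add: cos_dev_def)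
      qed simp
    qed
  qed measurable
  have 3: "AE x in ?P. fst x = fst (snd x) \<or> cos_dev (fst x) (fst (snd x)) (snd (snd x)) \<notin> Z"
    by (rule collision.AE_pair_measure) (measurable, rule AE_I2, simp add: A3)
  have "AE x in ?P. (fst x \<notin> A \<and> fst (snd x) \<notin> A) \<and> (fst (collide x) \<notin> A \<and> fst (snd (collide x)) \<notin> A) \<and>
     (fst x = fst (snd x) \<or> cos_dev (fst x) (fst (snd x)) (snd (snd x)) \<notin> Z)"
    using 1 2 3 by eventually_elim blast
  from collision.AE_pair[OF this] show ?thesis
  proof eventually_elim
    case (elim v)
    have "AE y in lborel \<Otimes>\<^sub>M usphere. (case y of (w, s) \<Rightarrow> norm (v - w) powr \<beta> * b0 (cos_dev v w s) *
      (f (post_vel_star v w s) * f (post_vel v w s) - f w * f v)) = (case y of (w, s) \<Rightarrow> norm (v - w) powr \<beta> * b (cos_dev v w s) *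
      (g (post_vel_star v w s) * g (post_vel v w s) - g w * g v))"
      using elim
    proof eventually_elim
      case (elim y)
      obtain w s where y: "y = (w, s)" by (cases y)
      have "f v = g v" "f w = g w" "f (post_vel v w s) = g (post_vel v w s)" "f (post_vel_star v w s) = g (post_vel_star v w s)"
        using elim A(1) by (auto simp: y collide_def)
      \<comment> \<open>For v = w the cosine is 0 for every s and might lie in Z, but there the
        kernel vanishes.\<close>
      moreover have "v = w \<or> b0 (cos_dev v w s) = b (cos_dev v w s)"
        using elim Z(1) by (auto simp: y)
      ultimately show ?case using \<beta> by (auto simp: y)
    qed
    then show ?case
      unfolding collision_op_def by (intro integral_completion_sphere) measurable
  qed
qed

text \<open>Fubini for a merely Lebesgue measurable F: almost all sections of a Borel
  representative, in either direction, agree almost everywhere with those of F. The time integral is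
  a Henstock-Kurzweil one, the form used for flows.\<close>

lemma lebesgue_pair_integral:
  fixes F :: "real \<times> 'a::euclidean_space \<Rightarrow> real" and \<phi> :: "'a \<Rightarrow> real"
  assumes F: "integrable lebesgue F" and [measurable]: "\<phi> \<in> borel_measurable borel" and \<phi>: "\<And>v. \<bar>\<phi> v\<bar> \<le> C"
  shows "((\<lambda>\<tau>. LINT v|lebesgue. \<phi> v * F (\<tau>, v)) has_integral (LINT v|lebesgue. \<phi> v * (LINT \<tau>|lebesgue. F (\<tau>, v)))) UNIV"
    "integrable lebesgue (\<lambda>v. \<phi> v * (LINT \<tau>|lebesgue. F (\<tau>, v)))"
proof -
  obtain F' where F'[measurable]: "F' \<in> borel_measurable lborel" and ae: "AE x in lborel. F x = F' x"
    using completion_ex_borel_measurable_real[of F lborel] borel_measurable_integrable[OF F] by auto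
  have mF[measurable]: "F' \<in> borel_measurable (lborel \<Otimes>\<^sub>M lborel)"
    using F' by (simp add: lborel_prod)
  have iF': "integrable (lborel \<Otimes>\<^sub>M lborel) F'"
    using F integrable_completion_AE[OF F' ae] by (simp add: lborel_prod)
  have G: "integrable (lborel \<Otimes>\<^sub>M lborel) (\<lambda>(\<tau>, v). \<phi> v * F' (\<tau>, v))"
  proof (rule Bochner_Integration.integrable_bound)
    show "integrable (lborel \<Otimes>\<^sub>M lborel) (\<lambda>x. C * F' x)" using iF' by simp
    show "AE x in lborel \<Otimes>\<^sub>M lborel. norm (case x of (\<tau>, v) \<Rightarrow> \<phi> v * F' (\<tau>, v)) \<le> norm (C * F' x)"
      using \<phi> by (intro AE_I2) (auto simp: abs_mult intro!: mult_right_mono order_trans[OF \<phi> abs_ge_self])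
  qed measurable
  have ae1: "AE x in lborel \<Otimes>\<^sub>M lborel. F x = F' x" using ae unfolding lborel_prod .
  have s1: "AE \<tau> in lborel. AE v in lborel. F (\<tau>, v) = F' (\<tau>, v)"
    by (rule lborel_pair.AE_pair[OF ae1])
  have s2: "AE v in lborel. AE \<tau> in lborel. F (\<tau>, v) = F' (\<tau>, v)"
  proof -
    have sw: "distr (lborel \<Otimes>\<^sub>M lborel) (lborel \<Otimes>\<^sub>M lborel) (\<lambda>(v, \<tau>). (\<tau>, v)) = (lborel \<Otimes>\<^sub>M lborel :: (real \<times> 'a) measure)"
      by (rule lborel_pair.distr_pair_swap[symmetric])
    have "AE x in distr (lborel \<Otimes>\<^sub>M lborel) (lborel \<Otimes>\<^sub>M lborel) (\<lambda>(v::'a, \<tau>::real). (\<tau>, v)). F x = F' x"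
      unfolding sw by (rule ae1)
    from AE_distrD[OF measurable_pair_swap' this]
    have "AE x in lborel \<Otimes>\<^sub>M lborel. F (case x of (v, \<tau>) \<Rightarrow> (\<tau>, v)) = F' (case x of (v, \<tau>) \<Rightarrow> (\<tau>, v))" .
    from lborel_pair.AE_pair[OF this] show ?thesis by simp
  qed
  have t1: "AE \<tau> in lborel. (LINT v|lborel. \<phi> v * F' (\<tau>, v)) = (LINT v|lebesgue. \<phi> v * F (\<tau>, v))"
    using s1
  proof eventually_elim
    case (elim \<tau>)
    show ?case
      by (rule integral_completion_AE[symmetric]) (measurable, use elim in \<open>auto elim: eventually_mono\<close>)
  qed
  have t2: "AE v in lborel. \<phi> v * (LINT \<tau>|lebesgue. F (\<tau>, v)) = (LINT \<tau>|lborel. \<phi> v * F' (\<tau>, v))"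
    using s2
  proof eventually_elim
    case (elim v)
    have "(LINT \<tau>|lebesgue. F (\<tau>, v)) = (LINT \<tau>|lborel. F' (\<tau>, v))"
      by (rule integral_completion_AE) (measurable, use elim in \<open>auto elim: eventually_mono\<close>)
    then show ?case by simp
  qed
  have "((\<lambda>\<tau>. LINT v|lborel. \<phi> v * F' (\<tau>, v)) has_integral (LINT \<tau>|lborel. LINT v|lborel. \<phi> v * F' (\<tau>, v))) UNIV"
    using lborel_pair.integrable_fst'[OF G] by (intro has_integral_integral_lborel) simp
  also have "(LINT \<tau>|lborel. LINT v|lborel. \<phi> v * F' (\<tau>, v)) = (LINT v|lborel. LINT \<tau>|lborel. \<phi> v * F' (\<tau>, v))"
    by (rule lborel_pair.Fubini_integral[symmetric, OF G])
  also have "\<dots> = (LINT v|lebesgue. \<phi> v * (LINT \<tau>|lebesgue. F (\<tau>, v)))"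
    by (rule integral_completion_AE[symmetric, OF _ t2]) measurable
  finally show "((\<lambda>\<tau>. LINT v|lebesgue. \<phi> v * F (\<tau>, v)) has_integral (LINT v|lebesgue. \<phi> v * (LINT \<tau>|lebesgue. F (\<tau>, v)))) UNIV"
    using t1 by (subst (asm) has_integral_AE) auto
  show "integrable lebesgue (\<lambda>v. \<phi> v * (LINT \<tau>|lebesgue. F (\<tau>, v)))"
    by (subst integrable_completion_AE[OF _ t2]) (measurable, rule lborel_pair.integrable_snd[OF G])
qed

section \<open>Solutions as flows in weak form\<close>

text \<open>What is kept of a solution after passing to Borel representatives: a density for each
  time, constant energy, and the weak form for bounded test functions. The mass is prescribed only
  initially; the weak form with \<phi> = 1 preserves it.\<close>

locale moment_flow = angular_kernel dim_type b L
  for dim_type :: "'a::euclidean_space itself" and b :: "real \<Rightarrow> real" and L :: real +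
  fixes \<beta> M E :: real and g :: "real \<Rightarrow> 'a \<Rightarrow> real"
  assumes \<beta>: "0 < \<beta>" "\<beta> \<le> 2"
    and regular: "\<And>t. 0 \<le> t \<Longrightarrow> regular_density (g t)"
    and initial_mass: "(LINT v|lborel. g 0 v) = M"
    and energy: "\<And>t. 0 \<le> t \<Longrightarrow> (LINT v|lborel. (norm v)\<^sup>2 * g t v) = E"
    and weak_form: "\<And>\<phi> C t. \<phi> \<in> borel_measurable borel \<Longrightarrow> (\<And>v. \<bar>\<phi> v\<bar> \<le> C) \<Longrightarrow> 0 \<le> t \<Longrightarrow>
      ((\<lambda>\<tau>. LINT (v, w)|(density lborel (\<lambda>v. ennreal (g \<tau> v)) \<Otimes>\<^sub>M density lborel (\<lambda>v. ennreal (g \<tau> v))).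
          weak_collision b L \<beta> \<phi> v w)
        has_integral ((LINT v|lborel. g t v * \<phi> v) - (LINT v|lborel. g 0 v * \<phi> v))) {0..t}"

lemma integrable_bounded_mult:
  fixes f \<phi> :: "'a::euclidean_space \<Rightarrow> real"
  assumes f: "integrable lebesgue f" and [measurable]: "\<phi> \<in> borel_measurable borel" and \<phi>: "\<And>v. \<bar>\<phi> v\<bar> \<le> C"
  shows "integrable lebesgue (\<lambda>v. \<phi> v * f v)"
proof (rule Bochner_Integration.integrable_bound)
  show "integrable lebesgue (\<lambda>v. C * f v)" using f by simp
  have "\<phi> \<in> borel_measurable lebesgue" by (simp add: measurable_completion)
  then show "(\<lambda>v. \<phi> v * f v) \<in> borel_measurable lebesgue" using f by auto
qed (use \<phi> in \<open>auto simp: abs_mult intro!: AE_I2 mult_right_mono order_trans[OF \<phi> abs_ge_self]\<close>)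

text \<open>A representative is chosen for each time separately. Joint measurability of g in time is
  not claimed: the weak form integrates over time a number that the original f already
  determines.\<close>

lemma boltzmann_moment_flow:
  fixes f0 :: "'a::euclidean_space \<Rightarrow> real" and N :: "real measure"
  assumes "angular_kernel TYPE('a) b L" and \<beta>: "0 < \<beta>" "\<beta> \<le> 2"
    and N: "\<And>e::'a. norm e = 1 \<Longrightarrow> distr usphere borel (\<lambda>s. e \<bullet> s) = N"
    and b0: "AE t in N. b0 t = b t"
    and f0: "\<And>v. 0 \<le> f0 v" "integrable lebesgue (\<lambda>v. f0 v * (1 + (norm v)\<^sup>2))"
      "(LINT v|lebesgue. f0 v) = M" "(LINT v|lebesgue. (norm v)\<^sup>2 * f0 v) = E"
    and sol: "boltzmann_solution (\<lambda>r z. r powr \<beta> * b0 z) f0 f"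
    and en: "energy_conserving f0 f"
  obtains g where "moment_flow b L \<beta> M E g"
    "\<And>t. 0 \<le> t \<Longrightarrow> AE v in lborel. f t v = g t v" "AE v in lborel. f0 v = g 0 v"
proof -
  interpret angular_kernel "TYPE('a)" b L by fact
  define q where "q = (\<lambda>\<tau>. collision_op (\<lambda>r z. r powr \<beta> * b0 z) (f \<tau>))"
  have f_nonneg: "0 \<le> f t v" and f_int: "integrable lebesgue (f t)" if "0 \<le> t" for t v
    using sol that unfolding boltzmann_solution_def by auto
  have q_int: "integrable (lebesgue_on ({0..t} \<times> UNIV)) (\<lambda>(\<tau>, v). q \<tau> v)"
    and eq: "AE v in lebesgue. f t v = f0 v + (LINT \<tau>|lebesgue_on {0..t}. q \<tau> v)" if "0 \<le> t" for t
    using sol that unfolding boltzmann_solution_def q_def by auto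
  have nm[measurable]: "(\<lambda>v::'a. (norm v)\<^sup>2) \<in> borel_measurable lebesgue"
    by (intro measurable_completion) measurable
  have f0_meas: "(\<lambda>v. f0 v * (1 + (norm v)\<^sup>2)) \<in> borel_measurable lebesgue" using f0(2) by auto
  \<comment> \<open>Dividing by the weight recovers measurability of \<open>f0\<close>, which is
    given only for the weighted function.\<close>
  have "(\<lambda>v. f0 v * (1 + (norm v)\<^sup>2) * inverse (1 + (norm v)\<^sup>2)) \<in> borel_measurable lebesgue"
    by (intro borel_measurable_times f0_meas borel_measurable_inverse borel_measurable_add nm) auto
  moreover have "f0 v * (1 + (norm v)\<^sup>2) * inverse (1 + (norm v)\<^sup>2) = f0 v" for v
  proof -
    have "1 + (norm v)\<^sup>2 \<noteq> 0" using zero_le_power2[of "norm v"] by linarith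
    then show ?thesis by simp
  qed
  ultimately have f0m[measurable]: "f0 \<in> borel_measurable lebesgue" by simp
  have f0i: "integrable lebesgue f0"
    by (rule Bochner_Integration.integrable_bound[OF f0(2)])
       (use f0(1) in \<open>auto intro!: AE_I2 simp: distrib_left\<close>)
  have f0e: "integrable lebesgue (\<lambda>v. (norm v)\<^sup>2 * f0 v)"
    by (rule Bochner_Integration.integrable_bound[OF f0(2)])
       (use f0(1) in \<open>auto intro!: AE_I2 simp: distrib_left mult.commute\<close>)
  have en_f0: "(\<integral>\<^sup>+ v. ennreal ((norm v)\<^sup>2 * f0 v) \<partial>lebesgue) = ennreal E"
    using f0e f0(1,4) by (subst nn_integral_eq_integral) auto
  have f0_E: "0 \<le> E" using f0(1,4) by (auto intro!: integral_nonneg_AE)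
  have en_t: "(\<integral>\<^sup>+ v. ennreal ((norm v)\<^sup>2 * f t v) \<partial>lebesgue) = ennreal E" if "0 \<le> t" for t
    using en that en_f0 unfolding energy_conserving_def by simp
  have "\<forall>t. \<exists>h. 0 \<le> t \<longrightarrow> regular_density h \<and> (AE v in lborel. f t v = h v) \<and> (LINT v|lborel. (norm v)\<^sup>2 * h v) = E"
  proof (intro allI)
    fix t :: real
    show "\<exists>h. 0 \<le> t \<longrightarrow> regular_density h \<and> (AE v in lborel. f t v = h v) \<and> (LINT v|lborel. (norm v)\<^sup>2 * h v) = E"
    proof (cases "0 \<le> t")
      case True
      obtain h' where h'[measurable]: "h' \<in> borel_measurable lborel" and ae': "AE v in lborel. f t v = h' v"
        using completion_ex_borel_measurable_real[of "f t" lborel] borel_measurable_integrable[OF f_int[OF True]] by auto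
      \<comment> \<open>Cutting at 0 makes the representative nonnegative everywhere and changes it
        only on a null set, because \<open>f t\<close> is nonnegative.\<close>
      define h where "h = (\<lambda>v. max 0 (h' v))"
      have hm[measurable]: "h \<in> borel_measurable borel" unfolding h_def using h' by simp
      have ae: "AE v in lborel. f t v = h v"
        using ae' by eventually_elim (use f_nonneg[OF True] in \<open>metis h_def max.absorb2\<close>)
      have h0: "0 \<le> h v" for v by (simp add: h_def)
      have hi: "integrable lborel h"
        using f_int[OF True] integrable_completion_AE[OF _ ae] by simp
      have "(\<integral>\<^sup>+ v. ennreal ((norm v)\<^sup>2 * h v) \<partial>lborel) = (\<integral>\<^sup>+ v. ennreal ((norm v)\<^sup>2 * f t v) \<partial>lebesgue)"
        unfolding nn_integral_completion using ae by (intro nn_integral_cong_AE) (auto elim: eventually_mono)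
      also have "\<dots> = ennreal E" by (rule en_t[OF True])
      finally have he: "(\<integral>\<^sup>+ v. ennreal ((norm v)\<^sup>2 * h v) \<partial>lborel) = ennreal E" .
      have he_int: "integrable lborel (\<lambda>v. (norm v)\<^sup>2 * h v)"
        using he h0 by (intro integrableI_nonneg) auto
      moreover have "(LINT v|lborel. (norm v)\<^sup>2 * h v) = E"
        using he h0 f0_E by (subst integral_eq_nn_integral) auto
      ultimately show ?thesis using hm h0 hi ae unfolding regular_density_def by blast
    qed auto
  qed
  then obtain g where g: "\<And>t. 0 \<le> t \<Longrightarrow> regular_density (g t)"
    "\<And>t. 0 \<le> t \<Longrightarrow> AE v in lborel. f t v = g t v" "\<And>t. 0 \<le> t \<Longrightarrow> (LINT v|lborel. (norm v)\<^sup>2 * g t v) = E"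
    by metis
  \<comment> \<open>At time 0 the collision integral is over a single instant, so the initial datum
    is attained.\<close>
  have "AE v in lebesgue. f 0 v = f0 v"
    using eq[OF order_refl]
  proof eventually_elim
    case (elim v)
    have "(LINT \<tau>|lebesgue_on {0..0}. q \<tau> v) = 0"
    proof (rule integral_eq_zero_AE)
      have ne: "AE \<tau> in lebesgue. \<tau> \<noteq> (0::real)"
        by (intro AE_completion AE_lborel_singleton)
      have "AE \<tau> in lebesgue. \<tau> \<in> {0..0::real} \<longrightarrow> q \<tau> v = 0"
        using ne by eventually_elim simp
      then show "AE \<tau> in lebesgue_on {0..0}. q \<tau> v = 0"
        by (subst AE_restrict_space_iff) simp_all
    qed
    then show ?case using elim by simp
  qed
  then have "AE v in lborel. f 0 v = f0 v" by (simp add: AE_completion_iff)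
  then have g0: "AE v in lborel. f0 v = g 0 v"
    using g(2)[of 0] by (auto elim: eventually_elim2)
  show thesis
  proof (rule that[of g])
    show "moment_flow b L \<beta> M E g"
    proof
      show "(LINT v|lborel. g 0 v) = M"
        using integral_completion_AE[OF _ g0] regular_densityD(1)[OF g(1)[of 0]] f0(3) by simp
      fix \<phi> :: "'a \<Rightarrow> real" and C t :: real
      assume \<phi>m[measurable]: "\<phi> \<in> borel_measurable borel" and \<phi>: "\<And>v. \<bar>\<phi> v\<bar> \<le> C" and t: "0 \<le> t"
      define F where "F = (\<lambda>x::real \<times> 'a. indicator ({0..t} \<times> UNIV) x *\<^sub>R (case x of (\<tau>, v) \<Rightarrow> q \<tau> v))"
      have S: "{0..t} \<times> (UNIV::'a set) \<in> sets lebesgue"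
      proof -
        have "closed ({0..t} \<times> (UNIV::'a set))" by (intro closed_Times) auto
        then show ?thesis by (intro sets_completionI_sets) (simp add: borel_closed)
      qed
      have F: "integrable lebesgue F"
        unfolding F_def using q_int[OF t] S by (subst integrable_restrict_space[symmetric]) auto
      have inner: "(LINT \<tau>|lebesgue. F (\<tau>, v)) = (LINT \<tau>|lebesgue_on {0..t}. q \<tau> v)" for v
        unfolding F_def by (subst integral_restrict_space) (auto simp: indicator_def intro!: Bochner_Integration.integral_cong)
      let ?h = "\<lambda>\<tau>. LINT v|lebesgue. \<phi> v * F (\<tau>, v)"
      have hint: "(?h has_integral (LINT v|lebesgue. \<phi> v * (LINT \<tau>|lebesgue_on {0..t}. q \<tau> v))) UNIV"
        and iint: "integrable lebesgue (\<lambda>v. \<phi> v * (LINT \<tau>|lebesgue_on {0..t}. q \<tau> v))"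
        using lebesgue_pair_integral[OF F \<phi>m \<phi>] unfolding inner by auto
      have "(LINT v|lebesgue. \<phi> v * f t v) = (LINT v|lebesgue. \<phi> v * f0 v + \<phi> v * (LINT \<tau>|lebesgue_on {0..t}. q \<tau> v))"
      proof (rule integral_cong_AE)
        show "AE v in lebesgue. \<phi> v * f t v = \<phi> v * f0 v + \<phi> v * (LINT \<tau>|lebesgue_on {0..t}. q \<tau> v)"
          using eq[OF t] by eventually_elim (simp add: distrib_left)
        show "(\<lambda>v. \<phi> v * f t v) \<in> borel_measurable lebesgue"
          using integrable_bounded_mult[OF f_int[OF t] \<phi>m \<phi>] by auto
        show "(\<lambda>v. \<phi> v * f0 v + \<phi> v * (LINT \<tau>|lebesgue_on {0..t}. q \<tau> v)) \<in> borel_measurable lebesgue"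
          using integrable_bounded_mult[OF f0i \<phi>m \<phi>] iint by auto
      qed
      also have "\<dots> = (LINT v|lebesgue. \<phi> v * f0 v) + (LINT v|lebesgue. \<phi> v * (LINT \<tau>|lebesgue_on {0..t}. q \<tau> v))"
        using integrable_bounded_mult[OF f0i \<phi>m \<phi>] iint by simp
      finally have balance: "(LINT v|lebesgue. \<phi> v * (LINT \<tau>|lebesgue_on {0..t}. q \<tau> v)) =
        (LINT v|lebesgue. \<phi> v * f t v) - (LINT v|lebesgue. \<phi> v * f0 v)" by simp
      have conv: "(LINT v|lebesgue. \<phi> v * k v) = (LINT v|lborel. h v * \<phi> v)"
        if "AE v in lborel. k v = h v" "h \<in> borel_measurable borel" for k h
        using that by (intro integral_completion_AE) (auto elim: eventually_mono simp: mult.commute)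
      have b1: "(LINT v|lebesgue. \<phi> v * f t v) = (LINT v|lborel. g t v * \<phi> v)"
        by (rule conv[OF g(2)[OF t] regular_densityD(1)[OF g(1)[OF t]]])
      have b2: "(LINT v|lebesgue. \<phi> v * f0 v) = (LINT v|lborel. g 0 v * \<phi> v)"
        by (rule conv[OF g0 regular_densityD(1)[OF g(1)[of 0]]]) simp
      let ?w = "\<lambda>\<tau>. LINT (v, w)|(density lborel (\<lambda>v. ennreal (g \<tau> v)) \<Otimes>\<^sub>M density lborel (\<lambda>v. ennreal (g \<tau> v))).
          weak_collision b L \<beta> \<phi> v w"
      have hw: "?h \<tau> = (if \<tau> \<in> {0..t} then ?w \<tau> else 0)" for \<tau>
      proof (cases "\<tau> \<in> {0..t}")
        case True
        then have \<tau>: "0 \<le> \<tau>" by simp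
        note [measurable] = regular_densityD(1)[OF g(1)[OF \<tau>]]
        let ?Q = "\<lambda>v. LINT (w, s)|(lborel \<Otimes>\<^sub>M usphere). norm (v - w) powr \<beta> * b (cos_dev v w s) *
          (g \<tau> (post_vel_star v w s) * g \<tau> (post_vel v w s) - g \<tau> w * g \<tau> v)"
        have "?h \<tau> = (LINT v|lebesgue. \<phi> v * q \<tau> v)"
          using True by (simp add: F_def)
        also have "\<dots> = (LINT v|lborel. \<phi> v * ?Q v)"
        proof (rule integral_completion_AE)
          have "AE v in lborel. q \<tau> v = ?Q v"
            unfolding q_def by (rule collision_op_eq_AE[OF \<beta>(1) _ _ g(2)[OF \<tau>] N b0]) measurable
          then show "AE v in lborel. \<phi> v * q \<tau> v = \<phi> v * ?Q v"
            by eventually_elim simp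
        qed measurable
        also have "\<dots> = ?w \<tau>"
          by (rule weak_form_static(1)[OF \<beta> g(1)[OF \<tau>] \<phi>m \<phi>])
        finally show ?thesis using True by simp
      next
        case False
        then have "F (\<tau>, v) = 0" for v by (auto simp: F_def)
        then show ?thesis using False by auto
      qed
      have "((\<lambda>\<tau>. if \<tau> \<in> {0..t} then ?w \<tau> else 0) has_integral ((LINT v|lborel. g t v * \<phi> v) - (LINT v|lborel. g 0 v * \<phi> v))) UNIV"
        using hint unfolding balance b1 b2 hw .
      then show "(?w has_integral ((LINT v|lborel. g t v * \<phi> v) - (LINT v|lborel. g 0 v * \<phi> v))) {0..t}"
        by (simp only: has_integral_restrict_UNIV)
    qed (use \<beta> g in auto)
  qed (use g g0 in auto)
qed

section \<open>Real inequalities\<close>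

text \<open>Mean value bound for natural exponents. For q = 0 the truncated q - 1 does no harm
  because of the factor q.\<close>

lemma power_add_le:
  fixes x y :: real
  assumes "0 \<le> x" "0 \<le> y"
  shows "(x + y) ^ q \<le> x ^ q + real q * y * (x + y) ^ (q - 1)"
proof (induction q)
  case (Suc q)
  have "(x + y) ^ Suc q = x * (x + y) ^ q + y * (x + y) ^ q" by (simp add: distrib_right)
  also have "x * (x + y) ^ q \<le> x * (x ^ q + real q * y * (x + y) ^ (q - 1))"
    using Suc assms by (intro mult_left_mono)
  also have "x * (x ^ q + real q * y * (x + y) ^ (q - 1)) \<le> x ^ Suc q + real q * y * (x + y) ^ q"
  proof (cases q)
    case (Suc m)
    have "x * (x + y) ^ m \<le> (x + y) * (x + y) ^ m" using assms by (intro mult_right_mono) auto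
    then have "real q * y * (x * (x + y) ^ m) \<le> real q * y * ((x + y) * (x + y) ^ m)"
      using assms by (intro mult_left_mono) auto
    then show ?thesis using Suc by (simp add: algebra_simps)
  qed simp
  finally show ?case by (simp add: algebra_simps)
qed simp

text \<open>All mixed terms are collected in one that is linear in the smaller variable y. With y =
  |w|^2 its integral involves only the energy and a lower moment.\<close>

lemma power_add_cross_le:
  fixes x y :: real
  assumes "0 \<le> y" "y \<le> x"
  shows "(x + y) ^ p \<le> x ^ p + y ^ p + real p * 2 ^ (p - 1) * (x ^ (p - 1) * y)"
proof -
  have "(x + y) ^ (p - 1) \<le> (2 * x) ^ (p - 1)" using assms by (intro power_mono) auto
  then have "real p * y * (x + y) ^ (p - 1) \<le> real p * y * (2 * x) ^ (p - 1)"
    using assms by (intro mult_left_mono) auto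
  moreover have "real p * y * (2 * x) ^ (p - 1) = real p * 2 ^ (p - 1) * (x ^ (p - 1) * y)"
    by (simp add: power_mult_distrib)
  moreover have "0 \<le> y ^ p" using assms by simp
  moreover have "(x + y) ^ p \<le> x ^ p + real p * y * (x + y) ^ (p - 1)" using assms by (intro power_add_le) auto
  ultimately show ?thesis by linarith
qed

text \<open>Equal to x^(q+1) up to n and linear with slope n^q beyond, so that n^q x minus it
  vanishes for x \<ge> n. It is in general not convex, as its slope drops at n; superadditivity
  comes instead from the quotient by x being nondecreasing.\<close>

definition trunc_power :: "nat \<Rightarrow> real \<Rightarrow> real \<Rightarrow> real" where
  "trunc_power q n x = x * min x n ^ q"

lemma trunc_power_nonneg: "0 \<le> n \<Longrightarrow> 0 \<le> x \<Longrightarrow> 0 \<le> trunc_power q n x"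
  by (simp add: trunc_power_def)

lemma trunc_power_superadd:
  assumes "0 \<le> n" "0 \<le> x" "0 \<le> y"
  shows "trunc_power q n x + trunc_power q n y \<le> trunc_power q n (x + y)"
proof -
  have "x * min x n ^ q \<le> x * min (x + y) n ^ q" "y * min y n ^ q \<le> y * min (x + y) n ^ q"
    using assms by (intro mult_left_mono power_mono; auto)+
  then show ?thesis by (simp add: trunc_power_def distrib_right)
qed

text \<open>The constant does not depend on n; otherwise the Gronwall bound would be lost as n
  \<rightarrow> \<infinity>. For x \<ge> n the truncation hides y from the factor of x, and for x <
  n the mean value bound applies.\<close>

lemma trunc_power_add_le:
  assumes n: "0 \<le> n" and y: "0 \<le> y" "y \<le> x"
  shows "trunc_power q n (x + y) \<le> trunc_power q n x + trunc_power q n y + 2 ^ q * (real q + 1) * (y * min x n ^ q)"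
proof -
  have x: "0 \<le> x" using y by simp
  have g: "0 \<le> min x n ^ q" using x n by simp
  have "min (x + y) n ^ q \<le> (2 * min x n) ^ q" using y n by (intro power_mono) auto
  then have 1: "y * min (x + y) n ^ q \<le> 2 ^ q * (y * min x n ^ q)"
    using y by (simp add: power_mult_distrib mult_left_mono mult.left_commute)
  have 2: "x * min (x + y) n ^ q \<le> x * min x n ^ q + 2 ^ q * real q * (y * min x n ^ q)"
  proof (cases "n \<le> x")
    case True
    then have "min (x + y) n = min x n" using y by simp
    then show ?thesis using y g by simp
  next
    case False
    have "min (x + y) n ^ q \<le> (x + y) ^ q" using x y n by (intro power_mono) auto
    also have "\<dots> \<le> x ^ q + real q * y * (x + y) ^ (q - 1)" by (rule power_add_le[OF x y(1)])
    also have "real q * y * (x + y) ^ (q - 1) \<le> real q * y * (2 * x) ^ (q - 1)"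
      using x y by (intro mult_left_mono power_mono) auto
    finally have "x * min (x + y) n ^ q \<le> x * (x ^ q + real q * y * (2 * x) ^ (q - 1))"
      using x by (simp add: mult_left_mono)
    also have "\<dots> \<le> x * x ^ q + 2 ^ q * real q * (y * x ^ q)"
    proof (cases q)
      case (Suc m)
      have "real q * y * (2 ^ m * (x * x ^ m)) \<le> real q * y * (2 ^ Suc m * (x * x ^ m))"
        using x y by (intro mult_left_mono mult_right_mono) auto
      then show ?thesis using Suc by (simp add: power_mult_distrib algebra_simps)
    qed simp
    finally show ?thesis using False by simp
  qed
  have "0 \<le> trunc_power q n y" using n y by (simp add: trunc_power_nonneg)
  then show ?thesis using 1 2 by (simp add: trunc_power_def algebra_simps)
qed

section \<open>Functions of time given as integrals\<close>

lemma has_integral_increment: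
  fixes G :: "real \<Rightarrow> real"
  assumes G: "\<And>t. 0 \<le> t \<Longrightarrow> (k has_integral (G t - G 0)) {0..t}" and st: "0 \<le> s" "s \<le> t"
  shows "(k has_integral (G t - G s)) {s..t}"
proof -
  have "k integrable_on {0..t}" using G[of t] st by auto
  then have i: "k integrable_on {s..t}" by (rule integrable_on_subinterval) (use st in auto)
  have "integral {0..s} k + integral {s..t} k = integral {0..t} k"
    using \<open>k integrable_on {0..t}\<close> st by (intro Henstock_Kurzweil_Integration.integral_combine) auto
  then have "integral {s..t} k = G t - G s"
    using integral_unique[OF G[of s]] integral_unique[OF G[of t]] st by simp
  with i show ?thesis by (metis integrable_integral)
qed

lemma has_integral_increment_continuous:
  fixes G :: "real \<Rightarrow> real"
  assumes G: "\<And>t. 0 \<le> t \<Longrightarrow> (k has_integral (G t - G 0)) {0..t}"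
  shows "continuous_on {0..T} G"
proof (cases "0 \<le> T")
  case True
  have "k integrable_on {0..T}" using G[OF True] by auto
  then have "continuous_on {0..T} (\<lambda>t. G 0 + integral {0..t} k)"
    by (intro continuous_intros indefinite_integral_continuous_1)
  then show ?thesis
    by (rule continuous_on_eq) (use integral_unique[OF G] in auto)
qed simp

text \<open>The rate k is only integrable and need not be the derivative of G at a given time, so
  its sign is used on a whole interval. Let \<open>T1\<close> be the first time at or above A2 and
  \<open>T0\<close> the last time before it at or below A1: between them G stays in the strip, so it
  cannot increase.\<close>

lemma barrier:
  fixes G :: "real \<Rightarrow> real"
  assumes G: "\<And>t. 0 \<le> t \<Longrightarrow> (k has_integral (G t - G 0)) {0..t}"
    and A: "A1 < A2" "G 0 \<le> A1"
    and k: "\<And>t. 0 \<le> t \<Longrightarrow> A1 \<le> G t \<Longrightarrow> G t \<le> A2 \<Longrightarrow> k t \<le> 0"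
    and t: "0 \<le> t"
  shows "G t \<le> A2"
proof (rule ccontr)
  assume "\<not> G t \<le> A2"
  have cont: "continuous_on {0..T} G" for T by (rule has_integral_increment_continuous[OF G])
  have "compact {s\<in>{0..t}. A2 \<le> G s}"
    by (rule compact_eq_bounded_closed[THEN iffD2], intro conjI,
      rule bounded_subset[OF bounded_closed_interval[of 0 t]], force,
      rule continuous_on_closed_Collect_le[OF continuous_on_const cont closed_atLeastAtMost])
  moreover have "t \<in> {s\<in>{0..t}. A2 \<le> G s}" using \<open>\<not> G t \<le> A2\<close> t by simp
  ultimately obtain T1 where T1: "0 \<le> T1" "T1 \<le> t" "A2 \<le> G T1" and T1min: "\<And>s. 0 \<le> s \<Longrightarrow> s \<le> t \<Longrightarrow> A2 \<le> G s \<Longrightarrow> T1 \<le> s"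
    using compact_attains_inf[of "{s\<in>{0..t}. A2 \<le> G s}"] by force
  have "compact {s\<in>{0..T1}. G s \<le> A1}"
    by (rule compact_eq_bounded_closed[THEN iffD2], intro conjI,
      rule bounded_subset[OF bounded_closed_interval[of 0 T1]], force,
      rule continuous_on_closed_Collect_le[OF cont continuous_on_const closed_atLeastAtMost])
  moreover have "0 \<in> {s\<in>{0..T1}. G s \<le> A1}" using A T1 by simp
  ultimately obtain T0 where T0: "0 \<le> T0" "T0 \<le> T1" "G T0 \<le> A1" and T0max: "\<And>s. 0 \<le> s \<Longrightarrow> s \<le> T1 \<Longrightarrow> G s \<le> A1 \<Longrightarrow> s \<le> T0"
    using compact_attains_sup[of "{s\<in>{0..T1}. G s \<le> A1}"] by force
  have "(k has_integral (G T1 - G T0)) {T0<..<T1}"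
    using has_integral_increment[OF G T0(1,2)] by (simp add: has_integral_Icc_iff_Ioo)
  moreover have "k s \<le> 0" if "s \<in> {T0<..<T1}" for s
  proof -
    have "A1 < G s" using T0max[of s] that T0 by force
    moreover have "G s < A2" using T1min[of s] that T0 T1 by force
    ultimately show ?thesis using k[of s] that T0 by auto
  qed
  ultimately have "G T1 - G T0 \<le> 0"
    by (rule has_integral_le[OF _ has_integral_0]) auto
  then show False using A T0 T1 by linarith
qed

text \<open>G need not be differentiable everywhere, so the argument runs on a primitive: u = A + G
  is at most u 0 + B U, where U is the integral of u, and exp (- B s) (u 0 + B U s) is
  nonincreasing.\<close>

lemma gronwall:
  fixes G :: "real \<Rightarrow> real"
  assumes G: "\<And>t. 0 \<le> t \<Longrightarrow> (k has_integral (G t - G 0)) {0..t}"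
    and k: "\<And>t. 0 \<le> t \<Longrightarrow> k t \<le> B * (A + G t)" and B: "0 < B" and t: "0 \<le> t"
  shows "A + G t \<le> (A + G 0) * exp (B * t)"
proof -
  define u where "u = (\<lambda>s. A + G s)"
  define U where "U = (\<lambda>s. integral {0..s} u)"
  have cu: "continuous_on {0..s} u" for s
    unfolding u_def by (intro continuous_intros has_integral_increment_continuous[OF G])
  have ui: "u integrable_on {0..s}" for s by (intro integrable_continuous_interval cu)
  have le: "u s \<le> u 0 + B * U s" if "0 \<le> s" for s
  proof -
    have "((\<lambda>r. B * u r) has_integral (B * U s)) {0..s}"
      unfolding U_def by (intro has_integral_mult_right integrable_integral ui)
    then have "G s - G 0 \<le> B * U s"
      by (rule has_integral_le[OF G[OF that]]) (use k in \<open>auto simp: u_def\<close>)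
    then show ?thesis by (simp add: u_def)
  qed
  have "u t \<le> u 0 * exp (B * t)"
  proof (cases "t = 0")
    case False
    with t have t0: "0 < t" by simp
    let ?W = "\<lambda>s. exp (- B * s) * (u 0 + B * U s)"
    have "?W t \<le> ?W 0"
    proof (rule DERIV_nonpos_imp_decreasing_open[OF less_imp_le[OF t0]])
      fix s assume s: "0 < s" "s < t"
      have "(U has_real_derivative u s) (at s within {0..t})"
        unfolding U_def using s by (intro integral_has_real_derivative cu) auto
      then have dU: "(U has_real_derivative u s) (at s)"
        using s by (simp add: at_within_Icc_at)
      have "(?W has_real_derivative (exp (- B * s) * (- B) * (u 0 + B * U s) + exp (- B * s) * (B * u s))) (at s)"
        by (rule derivative_eq_intros dU refl | simp)+
      moreover have "exp (- B * s) * (- B) * (u 0 + B * U s) + exp (- B * s) * (B * u s) = (exp (- B * s) * B) * (u s - (u 0 + B * U s))"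
        by (simp add: algebra_simps)
      moreover have "\<dots> \<le> 0"
        using le[of s] s B by (intro mult_nonneg_nonpos) auto
      ultimately show "\<exists>y. (?W has_real_derivative y) (at s) \<and> y \<le> 0" by metis
    next
      show "continuous_on {0..t} ?W"
        unfolding U_def by (intro continuous_intros indefinite_integral_continuous_1 ui)
    qed
    then have "exp (- B * t) * (u 0 + B * U t) \<le> u 0" by (simp add: U_def)
    then have "u 0 + B * U t \<le> u 0 * exp (B * t)"
      by (simp add: exp_minus field_simps)
    then show ?thesis using le[OF t] by linarith
  qed simp
  then show ?thesis by (simp add: u_def)
qed

section \<open>Bounds for powers of the relative speed\<close>

lemma norm_diff_powr_le_max:
  fixes v w :: "'a::real_normed_vector"
  assumes "0 < \<beta>" "\<beta> \<le> 2" "norm w \<le> norm v"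
  shows "norm (v - w) powr \<beta> \<le> 4 * norm v powr \<beta>"
proof -
  have "norm (v - w) \<le> 2 * norm v" using norm_triangle_ineq4[of v w] assms by linarith
  then have "norm (v - w) powr \<beta> \<le> (2 * norm v) powr \<beta>" using assms by (intro powr_mono2) auto
  also have "\<dots> = 2 powr \<beta> * norm v powr \<beta>" by (simp add: powr_mult)
  also have "\<dots> \<le> 4 * norm v powr \<beta>"
  proof (intro mult_right_mono)
    have "(2::real) powr \<beta> \<le> 2 powr 2" using assms by (intro powr_mono) auto
    then show "(2::real) powr \<beta> \<le> 4" by (simp add: powr_numeral)
  qed simp
  finally show ?thesis .
qed

lemma norm_diff_powr_le_sum:
  fixes v w :: "'a::real_normed_vector"
  assumes \<beta>: "0 < \<beta>" "\<beta> \<le> 2"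
  shows "norm (v - w) powr \<beta> \<le> 4 * (norm v powr \<beta> + norm w powr \<beta>)"
proof (cases "norm w \<le> norm v")
  case True
  have "0 \<le> norm w powr \<beta>" by simp
  then show ?thesis using norm_diff_powr_le_max[OF \<beta> True] unfolding distrib_left by linarith
next
  case False
  then have "norm (w - v) powr \<beta> \<le> 4 * norm w powr \<beta>"
    by (intro norm_diff_powr_le_max \<beta>) simp
  moreover have "0 \<le> norm v powr \<beta>" by simp
  ultimately show ?thesis unfolding distrib_left norm_minus_commute[of v w] by linarith
qed

text \<open>The previous bound for v = (v - w) + w, solved for the power of |v - w|. This is how the
  loss is bounded from below; the constant is crude but serves every \<beta> in (0, 2].\<close>

lemma norm_diff_powr_ge:
  fixes v w :: "'a::real_normed_vector"
  assumes \<beta>: "0 < \<beta>" "\<beta> \<le> 2"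
  shows "norm v powr \<beta> / 4 - norm w powr \<beta> \<le> norm (v - w) powr \<beta>"
  using norm_diff_powr_le_sum[OF \<beta>, of "v - w" "- w"] by simp

lemma powr_le_one_plus_square:
  assumes "0 \<le> (r::real)" "0 < \<beta>" "\<beta> \<le> 2"
  shows "r powr \<beta> \<le> 1 + r\<^sup>2"
proof (cases "r \<le> 1")
  case True
  then have "r powr \<beta> \<le> 1" using assms by (intro powr_le1) auto
  then show ?thesis using zero_le_power2[of r] by linarith
next
  case False
  then have "r powr \<beta> \<le> r powr 2" using assms by (intro powr_mono) auto
  then show ?thesis using False by (simp add: powr_numeral)
qed

text \<open>Fatou's lemma: bounds that are uniform in a truncation pass to the limit.\<close>

lemma nn_integral_le_of_limit:
  fixes u :: "nat \<Rightarrow> 'a \<Rightarrow> real"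
  assumes [measurable]: "\<And>n. u n \<in> borel_measurable M"
    and bound: "\<And>n. (\<integral>\<^sup>+ x. ennreal (u n x) \<partial>M) \<le> K"
    and lim: "\<And>x. (\<lambda>n. u n x) \<longlonglongrightarrow> f x"
  shows "(\<integral>\<^sup>+ x. ennreal (f x) \<partial>M) \<le> K"
proof -
  have "ennreal (f x) = liminf (\<lambda>n. ennreal (u n x))" for x
    using tendsto_ennrealI[OF lim[of x]] by (intro lim_imp_Liminf[symmetric]) auto
  then have "(\<integral>\<^sup>+ x. ennreal (f x) \<partial>M) = (\<integral>\<^sup>+ x. liminf (\<lambda>n. ennreal (u n x)) \<partial>M)" by simp
  also have "\<dots> \<le> liminf (\<lambda>n. \<integral>\<^sup>+ x. ennreal (u n x) \<partial>M)"
    by (intro nn_integral_liminf) measurable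
  also have "\<dots> \<le> K"
    by (intro Liminf_le always_eventually allI bound) auto
  finally show ?thesis .
qed

section \<open>Bounds on the collision rate of a fixed measure\<close>

text \<open>The collision rate is estimated at one frozen time, for a measure of which the mass M
  and the energy E are prescribed.\<close>

locale collision_state = angular_kernel dim_type b L + finite_measure \<mu>
  for dim_type :: "'a::euclidean_space itself" and b :: "real \<Rightarrow> real" and L :: real and \<mu> :: "'a measure" +
  fixes \<beta> M E :: real
  assumes \<beta>: "0 < \<beta>" "\<beta> \<le> 2"
    and sets_mu [simp, measurable_cong]: "sets \<mu> = sets borel"
    and square_integrable: "integrable \<mu> (\<lambda>v. (norm v)\<^sup>2)"
    and mass: "measure \<mu> UNIV = M"
    and energy: "(LINT v|\<mu>. (norm v)\<^sup>2) = E"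
begin

sublocale pair: pair_sigma_finite \<mu> \<mu> ..

lemma space_mu [simp]: "space \<mu> = UNIV"
  using sets_eq_imp_space_eq[OF sets_mu] by simp

lemma mass_nonneg: "0 \<le> M" and energy_nonneg: "0 \<le> E"
  unfolding mass[symmetric] energy[symmetric] by (auto intro: integral_nonneg_AE)

lemma integral_const_mu [simp]: "(LINT v|\<mu>. c) = M * (c::real)"
  using mass by simp

abbreviation rate :: "('a \<Rightarrow> real) \<Rightarrow> real" where
  "rate \<phi> \<equiv> LINT (v, w)|(\<mu> \<Otimes>\<^sub>M \<mu>). weak_collision b L \<beta> \<phi> v w"

lemma pair_mult:
  fixes f h :: "'a \<Rightarrow> real"
  assumes "integrable \<mu> f" "integrable \<mu> h"
  shows "integrable (\<mu> \<Otimes>\<^sub>M \<mu>) (\<lambda>(v, w). f v * h w)"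
    "(LINT (v, w)|(\<mu> \<Otimes>\<^sub>M \<mu>). f v * h w) = (LINT v|\<mu>. f v) * (LINT v|\<mu>. h v)"
  using integrable_pair_mult[OF sigma_finite_measure_axioms sigma_finite_measure_axioms assms]
    integral_pair_mult[OF sigma_finite_measure_axioms sigma_finite_measure_axioms assms] by auto

lemma pair_swap:
  fixes F :: "'a \<Rightarrow> 'a \<Rightarrow> real"
  assumes "integrable (\<mu> \<Otimes>\<^sub>M \<mu>) (\<lambda>(v, w). F v w)"
  shows "integrable (\<mu> \<Otimes>\<^sub>M \<mu>) (\<lambda>(v, w). F w v)"
    "(LINT (v, w)|(\<mu> \<Otimes>\<^sub>M \<mu>). F w v) = (LINT (v, w)|(\<mu> \<Otimes>\<^sub>M \<mu>). F v w)"
  using pair.integrable_product_swap[OF assms] pair.integral_product_swap[of "\<lambda>(v, w). F v w"]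
    borel_measurable_integrable[OF assms]
  by (auto simp: case_prod_beta')

lemma pair_integral_mono:
  fixes F H :: "'a \<Rightarrow> 'a \<Rightarrow> real"
  assumes "integrable (\<mu> \<Otimes>\<^sub>M \<mu>) (\<lambda>(v, w). F v w)" "integrable (\<mu> \<Otimes>\<^sub>M \<mu>) (\<lambda>(v, w). H v w)" "\<And>v w. F v w \<le> H v w"
  shows "(LINT (v, w)|(\<mu> \<Otimes>\<^sub>M \<mu>). F v w) \<le> (LINT (v, w)|(\<mu> \<Otimes>\<^sub>M \<mu>). H v w)"
  by (rule integral_mono[OF assms(1,2)]) (use assms(3) in auto)

lemma pair_integrable_bound:
  fixes F :: "'a \<Rightarrow> 'a \<Rightarrow> real"
  assumes "(\<lambda>(v, w). F v w) \<in> borel_measurable (borel \<Otimes>\<^sub>M borel)" "integrable \<mu> f" "integrable \<mu> h"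
    and bd: "\<And>v w. \<bar>F v w\<bar> \<le> f v * h w"
  shows "integrable (\<mu> \<Otimes>\<^sub>M \<mu>) (\<lambda>(v, w). F v w)"
proof (rule Bochner_Integration.integrable_bound[OF pair_mult(1)[OF assms(2,3)]])
  show "(\<lambda>(v, w). F v w) \<in> borel_measurable (\<mu> \<Otimes>\<^sub>M \<mu>)"
    using assms(1) by (simp cong: measurable_cong_sets)
  show "AE x in \<mu> \<Otimes>\<^sub>M \<mu>. norm (case x of (v, w) \<Rightarrow> F v w) \<le> norm (case x of (v, w) \<Rightarrow> f v * h w)"
    by (rule AE_I2) (use bd in \<open>auto intro: order_trans[OF _ abs_ge_self]\<close>)
qed

lemma weak_collision_growth:
  fixes \<phi> :: "'a \<Rightarrow> real"
  assumes [measurable]: "\<phi> \<in> borel_measurable borel" and \<phi>: "\<And>v. \<bar>\<phi> v\<bar> \<le> C * (1 + (norm v)\<^sup>2) ^ p" and C: "0 \<le> C"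
  shows "\<bar>weak_collision b L \<beta> \<phi> v w\<bar> \<le> (4 * L * C * (1 + (norm v)\<^sup>2) ^ Suc p) * (1 + (norm w)\<^sup>2) ^ Suc p"
proof -
  let ?x = "(norm v)\<^sup>2" and ?y = "(norm w)\<^sup>2"
  have xy: "1 + (?x + ?y) \<le> (1 + ?x) * (1 + ?y)" by (simp add: algebra_simps)
  have le: "\<bar>\<phi> u\<bar> \<le> C * ((1 + ?x) * (1 + ?y)) ^ p" if "(norm u)\<^sup>2 \<le> ?x + ?y" for u
  proof -
    have "(1 + (norm u)\<^sup>2) ^ p \<le> ((1 + ?x) * (1 + ?y)) ^ p"
      using that xy by (intro power_mono) auto
    then show ?thesis using \<phi>[of u] C by (meson mult_left_mono order_trans)
  qed
  have "\<bar>weak_collision b L \<beta> \<phi> v w\<bar> \<le> norm (v - w) powr \<beta> * (2 * L * (C * ((1 + ?x) * (1 + ?y)) ^ p))"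
    by (rule abs_weak_collision_le[OF \<beta>(1)]) (auto intro!: le norm_post_vel_le)
  also have "\<dots> \<le> 2 * ((1 + ?x) * (1 + ?y)) * (2 * L * (C * ((1 + ?x) * (1 + ?y)) ^ p))"
    using norm_diff_powr_le[OF \<beta>, of v w] L_pos C by (intro mult_right_mono) auto
  also have "\<dots> = (4 * L * C * (1 + ?x) ^ Suc p) * (1 + ?y) ^ Suc p"
    by (simp add: power_mult_distrib)
  finally show ?thesis .
qed

lemma weak_collision_integrable_state:
  assumes [measurable]: "\<phi> \<in> borel_measurable borel" and "\<And>v. \<bar>\<phi> v\<bar> \<le> C * (1 + (norm v)\<^sup>2) ^ p" "0 \<le> C"
    and "integrable \<mu> (\<lambda>v. (1 + (norm v)\<^sup>2) ^ Suc p)"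
  shows "integrable (\<mu> \<Otimes>\<^sub>M \<mu>) (\<lambda>(v, w). weak_collision b L \<beta> \<phi> v w)"
proof (rule pair_integrable_bound)
  show "\<bar>weak_collision b L \<beta> \<phi> v w\<bar> \<le> (4 * L * C * (1 + (norm v)\<^sup>2) ^ Suc p) * (1 + (norm w)\<^sup>2) ^ Suc p" for v w :: 'a
    by (rule weak_collision_growth[OF assms(1-3)])
  show "integrable \<mu> (\<lambda>v. 4 * L * C * (1 + (norm v)\<^sup>2) ^ Suc p)"
    by (rule integrable_mult_right[OF assms(4)])
qed (use assms(4) in measurable)

lemma rate_const: "rate (\<lambda>_. 1) = 0"
proof -
  have "weak_collision b L \<beta> (\<lambda>_. 1) v w = 0" for v w :: 'a
    using kernel_integral[of v w] \<beta> by (cases "v = w") (auto simp: weak_collision_def gain_def)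
  then show ?thesis by (simp add: case_prod_beta')
qed

lemma norm_powr_integrable: "integrable \<mu> (\<lambda>v. norm v powr \<beta>)"
  and norm_powr_integral_le: "(LINT v|\<mu>. norm v powr \<beta>) \<le> M + E"
proof -
  have i: "integrable \<mu> (\<lambda>v. 1 + (norm v)\<^sup>2)" using square_integrable by simp
  show 1: "integrable \<mu> (\<lambda>v. norm v powr \<beta>)"
  proof (rule Bochner_Integration.integrable_bound[OF i])
    show "AE v in \<mu>. norm (norm v powr \<beta>) \<le> norm (1 + (norm v)\<^sup>2)"
      using powr_le_one_plus_square[OF norm_ge_zero \<beta>] by (intro AE_I2) (simp add: order_trans[OF _ abs_ge_self])
  qed measurable
  have "(LINT v|\<mu>. norm v powr \<beta>) \<le> (LINT v|\<mu>. 1 + (norm v)\<^sup>2)"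
    by (rule integral_mono[OF 1 i]) (rule powr_le_one_plus_square[OF norm_ge_zero \<beta>])
  also have "\<dots> = M + E" using square_integrable energy mass by simp
  finally show "(LINT v|\<mu>. norm v powr \<beta>) \<le> M + E" .
qed

text \<open>
  The energy weight \<open>n\<^sup>q |v|\<^sup>2\<close> minus the truncated power is a bounded test function.  After
  symmetrization its energy part cancels, and superadditivity of the truncated power controls the gain.
\<close>
lemma truncated_rate:
  fixes q :: nat and n C :: real
  assumes n: "0 \<le> n"
  defines "\<eta> \<equiv> \<lambda>v::'a. n ^ q * (norm v)\<^sup>2 - trunc_power q n ((norm v)\<^sup>2)"
  assumes psi_int: "integrable \<mu> (\<lambda>v. trunc_power q n ((norm v)\<^sup>2))"
    and eta_int: "integrable (\<mu> \<Otimes>\<^sub>M \<mu>) (\<lambda>(v, w). weak_collision b L \<beta> \<eta> v w)"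
    and eta_bd: "\<And>v. \<bar>\<eta> v\<bar> \<le> C"
  shows "- rate \<eta> \<le> 4 * L * (2 ^ q * (real q + 1)) * E * (M + 2 * (LINT v|\<mu>. trunc_power q n ((norm v)\<^sup>2)))"
proof -
  let ?\<psi> = "\<lambda>v::'a. trunc_power q n ((norm v)\<^sup>2)"
  define c where "c = (2 ^ q * (real q + 1) :: real)"
  have c0: "0 \<le> c" by (simp add: c_def)
  have [measurable]: "\<eta> \<in> borel_measurable borel" unfolding \<eta>_def trunc_power_def by measurable
  have psi0: "0 \<le> ?\<psi> v" for v using n by (simp add: trunc_power_nonneg)
  let ?k = "weak_collision b L \<beta> \<eta>"
  \<comment> \<open>The faster particle v carries \<open>1 + 2 * ?\<psi> v\<close>, the slower one
    its energy. This dominates (1 + |v|^2) |w|^2 min(|v|^2, n)^q, the size of the cross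
    term.\<close>
  let ?R = "\<lambda>v w. (1 + 2 * ?\<psi> v) * (norm w)\<^sup>2"
  have lower: "- (4 * L * c) * (?R v w + ?R w v) \<le> ?k v w + ?k w v" for v w :: 'a
  proof (cases "v = w")
    case True
    have "0 \<le> (4 * L * c) * (?R w w + ?R w w)" using L_pos c0 psi0[of w] by simp
    then show ?thesis unfolding True weak_collision_same[OF \<beta>(1)]
      by (simp only: mult_minus_left neg_le_0_iff_le add_0_right)
  next
    case False
    let ?r = "norm (v - w) powr \<beta>"
    define x y where "x = (norm v)\<^sup>2" and "y = (norm w)\<^sup>2"
    have eta_vw: "\<eta> v + \<eta> w = n ^ q * (x + y) - (trunc_power q n x + trunc_power q n y)"
      by (simp add: \<eta>_def x_def y_def algebra_simps)
    have i1: "integrable usphere (\<lambda>s. b (cos_dev v w s) * \<eta> (post_vel v w s))"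
      by (rule kernel_mult_integrable[OF False _ eta_bd]) measurable
    have i2: "integrable usphere (\<lambda>s. b (cos_dev v w s) * \<eta> (post_vel_star v w s))"
      by (rule kernel_mult_integrable[OF False _ eta_bd]) measurable
    have "L * (n ^ q * (x + y) - trunc_power q n (x + y)) =
        (LINT s|usphere. b (cos_dev v w s) * (n ^ q * (x + y) - trunc_power q n (x + y)))"
      using kernel_integral[OF False] by simp
    also have "\<dots> \<le> (LINT s|usphere. b (cos_dev v w s) * (\<eta> (post_vel v w s) + \<eta> (post_vel_star v w s)))"
    proof (rule kernel_mult_mono)
      show "integrable usphere (\<lambda>s. b (cos_dev v w s) * (n ^ q * (x + y) - trunc_power q n (x + y)))"
        using kernel_integrable[OF False] by simp
      show "integrable usphere (\<lambda>s. b (cos_dev v w s) * (\<eta> (post_vel v w s) + \<eta> (post_vel_star v w s)))"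
        unfolding distrib_left by (rule Bochner_Integration.integrable_add[OF i1 i2])
      fix s :: 'a assume s: "norm s = 1"
      define x' y' where "x' = (norm (post_vel v w s))\<^sup>2" and "y' = (norm (post_vel_star v w s))\<^sup>2"
      have "x' + y' = x + y" using norm_post_vel_sum[OF s, of v w] by (simp add: x_def y_def x'_def y'_def)
      moreover have "trunc_power q n x' + trunc_power q n y' \<le> trunc_power q n (x' + y')"
        using n by (intro trunc_power_superadd) (auto simp: x'_def y'_def)
      moreover have "\<eta> (post_vel v w s) + \<eta> (post_vel_star v w s) = n ^ q * (x' + y') - (trunc_power q n x' + trunc_power q n y')"
        by (simp add: \<eta>_def x'_def y'_def algebra_simps)
      ultimately show "n ^ q * (x + y) - trunc_power q n (x + y) \<le> \<eta> (post_vel v w s) + \<eta> (post_vel_star v w s)"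
        by simp
    qed
    also have "\<dots> = gain b \<eta> v w + gain b \<eta> w v"
      unfolding distrib_left Bochner_Integration.integral_add[OF i1 i2]
      by (subst gain_swap) (simp_all add: gain_def)
    finally have g: "L * (n ^ q * (x + y) - trunc_power q n (x + y)) \<le> gain b \<eta> v w + gain b \<eta> w v" .
    have "L * (trunc_power q n x + trunc_power q n y - trunc_power q n (x + y)) =
        L * (n ^ q * (x + y) - trunc_power q n (x + y)) - L * (\<eta> v + \<eta> w)"
      unfolding eta_vw by (simp add: right_diff_distrib distrib_left)
    then have "L * (trunc_power q n x + trunc_power q n y - trunc_power q n (x + y)) \<le>
        (gain b \<eta> v w - L * \<eta> v) + (gain b \<eta> w v - L * \<eta> w)"
      using g unfolding distrib_left[of L "\<eta> v" "\<eta> w"] by linarith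
    then have "?r * (L * (trunc_power q n x + trunc_power q n y - trunc_power q n (x + y))) \<le>
        ?r * ((gain b \<eta> v w - L * \<eta> v) + (gain b \<eta> w v - L * \<eta> w))"
      by (intro mult_left_mono) auto
    also have "\<dots> = ?k v w + ?k w v"
      by (simp add: weak_collision_def norm_minus_commute distrib_left)
    finally have 1: "- L * (?r * (trunc_power q n (x + y) - trunc_power q n x - trunc_power q n y)) \<le> ?k v w + ?k w v"
      by (simp add: algebra_simps)
    have cross: "norm (v - w) powr \<beta> * (trunc_power q n ((norm v)\<^sup>2 + (norm w)\<^sup>2) - ?\<psi> v - ?\<psi> w) \<le> 4 * c * ?R v w"
      if le: "norm w \<le> norm v" for v w :: 'a
    proof -
      let ?x = "(norm v)\<^sup>2" and ?y = "(norm w)\<^sup>2"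
      let ?g = "min ?x n ^ q"
      have g0: "0 \<le> ?g" using n by simp
      have "trunc_power q n (?x + ?y) - ?\<psi> v - ?\<psi> w \<le> c * (?y * ?g)"
        using trunc_power_add_le[OF n, of ?y ?x q] le by (simp add: c_def power_mono)
      then have "norm (v - w) powr \<beta> * (trunc_power q n (?x + ?y) - ?\<psi> v - ?\<psi> w) \<le> norm (v - w) powr \<beta> * (c * (?y * ?g))"
        by (intro mult_left_mono) auto
      also have "\<dots> \<le> 4 * (1 + ?x) * (c * (?y * ?g))"
      proof (intro mult_right_mono)
        show "norm (v - w) powr \<beta> \<le> 4 * (1 + ?x)"
          using norm_diff_powr_le_max[OF \<beta> le] powr_le_one_plus_square[OF norm_ge_zero \<beta>, of v]
          unfolding distrib_left by linarith
      qed (use c0 g0 in auto)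
      also have "\<dots> = 4 * c * (?y * ((1 + ?x) * ?g))" by simp
      also have "\<dots> \<le> 4 * c * (?y * (1 + 2 * ?\<psi> v))"
      proof (intro mult_left_mono)
        have "?g \<le> 1 + ?x * ?g"
        proof (cases "1 \<le> ?x")
          case True
          then have "1 * ?g \<le> ?x * ?g" using g0 by (intro mult_right_mono)
          then show ?thesis by simp
        next
          case False
          then have "?g \<le> 1" using n by (intro power_le_one) auto
          moreover have "0 \<le> ?x * ?g" using g0 by simp
          ultimately show ?thesis by linarith
        qed
        then show "(1 + ?x) * ?g \<le> 1 + 2 * ?\<psi> v" by (simp add: trunc_power_def distrib_right)
      qed (use c0 in auto)
      finally show ?thesis by (simp add: mult_ac)
    qed
    have R0: "0 \<le> ?R v w" "0 \<le> ?R w v" using psi0 by auto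
    have "?r * (trunc_power q n (x + y) - trunc_power q n x - trunc_power q n y) \<le> 4 * c * (?R v w + ?R w v)"
    proof (cases "norm w \<le> norm v")
      case True
      have "4 * c * ?R v w \<le> 4 * c * (?R v w + ?R w v)"
        using R0 c0 by (intro mult_left_mono) auto
      then show ?thesis using cross[OF True] by (simp only: x_def y_def)
    next
      case False
      have "4 * c * ?R w v \<le> 4 * c * (?R v w + ?R w v)"
        using R0 c0 by (intro mult_left_mono) auto
      moreover have "?r * (trunc_power q n (x + y) - trunc_power q n x - trunc_power q n y) \<le> 4 * c * ?R w v"
        using cross[of v w] False by (simp add: x_def y_def norm_minus_commute add.commute algebra_simps)
      ultimately show ?thesis by linarith
    qed
    then have "L * (?r * (trunc_power q n (x + y) - trunc_power q n x - trunc_power q n y)) \<le> L * (4 * c * (?R v w + ?R w v))"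
      using L_pos by (intro mult_left_mono) auto
    then show ?thesis using 1 by (simp add: algebra_simps)
  qed
  have iR: "integrable (\<mu> \<Otimes>\<^sub>M \<mu>) (\<lambda>(v, w). ?R v w)"
    and eR: "(LINT (v, w)|(\<mu> \<Otimes>\<^sub>M \<mu>). ?R v w) = (M + 2 * (LINT v|\<mu>. ?\<psi> v)) * E"
  proof -
    have i: "integrable \<mu> (\<lambda>v. 1 + 2 * ?\<psi> v)" using psi_int by simp
    show "integrable (\<mu> \<Otimes>\<^sub>M \<mu>) (\<lambda>(v, w). ?R v w)" by (rule pair_mult(1)[OF i square_integrable])
    show "(LINT (v, w)|(\<mu> \<Otimes>\<^sub>M \<mu>). ?R v w) = (M + 2 * (LINT v|\<mu>. ?\<psi> v)) * E"
      using pair_mult(2)[OF i square_integrable] psi_int energy mass by simp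
  qed
  note sR = pair_swap[OF iR] and sk = pair_swap[OF eta_int]
  have "- (4 * L * c) * ((LINT (v, w)|(\<mu> \<Otimes>\<^sub>M \<mu>). ?R v w) + (LINT (v, w)|(\<mu> \<Otimes>\<^sub>M \<mu>). ?R w v)) =
      (LINT (v, w)|(\<mu> \<Otimes>\<^sub>M \<mu>). - (4 * L * c) * (?R v w + ?R w v))"
    using iR sR(1) unfolding case_prod_beta' by (subst Bochner_Integration.integral_add[symmetric]) auto
  also have "\<dots> \<le> (LINT (v, w)|(\<mu> \<Otimes>\<^sub>M \<mu>). ?k v w + ?k w v)"
  proof (rule pair_integral_mono)
    show "integrable (\<mu> \<Otimes>\<^sub>M \<mu>) (\<lambda>(v, w). - (4 * L * c) * (?R v w + ?R w v))"
      using iR sR(1) unfolding case_prod_beta' by (intro integrable_mult_right Bochner_Integration.integrable_add)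
    show "integrable (\<mu> \<Otimes>\<^sub>M \<mu>) (\<lambda>(v, w). ?k v w + ?k w v)"
      using eta_int sk(1) unfolding case_prod_beta' by (rule Bochner_Integration.integrable_add)
  qed (rule lower)
  also have "\<dots> = (LINT (v, w)|(\<mu> \<Otimes>\<^sub>M \<mu>). ?k v w) + (LINT (v, w)|(\<mu> \<Otimes>\<^sub>M \<mu>). ?k w v)"
    using eta_int sk(1) unfolding case_prod_beta' by (rule Bochner_Integration.integral_add)
  finally have fin: "- (4 * L * c) * ((LINT (v, w)|(\<mu> \<Otimes>\<^sub>M \<mu>). ?R v w) + (LINT (v, w)|(\<mu> \<Otimes>\<^sub>M \<mu>). ?R w v)) \<le>
      (LINT (v, w)|(\<mu> \<Otimes>\<^sub>M \<mu>). ?k v w) + (LINT (v, w)|(\<mu> \<Otimes>\<^sub>M \<mu>). ?k w v)" .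
  define Z where "Z = M + 2 * (LINT v|\<mu>. ?\<psi> v)"
  \<comment> \<open>Both sides have been symmetrized, so the factor 2 cancels in the end.\<close>
  have "- (4 * L * c) * (Z * E + Z * E) \<le> rate \<eta> + rate \<eta>"
    using fin unfolding sR(2) sk(2) eR Z_def .
  moreover have "- (4 * L * c) * (Z * E + Z * E) = - (4 * L * c * E * Z) - 4 * L * c * E * Z"
    by (simp add: distrib_left)
  ultimately show ?thesis unfolding c_def[symmetric] Z_def[symmetric] by linarith
qed

end

section \<open>Cut-offs and polynomial moments\<close>

context collision_state
begin

lemma integrable_growth:
  fixes f :: "'a \<Rightarrow> real"
  assumes "integrable \<mu> (\<lambda>v. (1 + (norm v)\<^sup>2) ^ k)" "f \<in> borel_measurable borel"
    and "\<And>v. \<bar>f v\<bar> \<le> C * (1 + (norm v)\<^sup>2) ^ k"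
  shows "integrable \<mu> f"
proof (rule Bochner_Integration.integrable_bound[OF integrable_mult_right[OF assms(1), of C]])
  show "f \<in> borel_measurable \<mu>" using assms(2) by (simp cong: measurable_cong_sets)
qed (use assms(3) in \<open>auto intro!: AE_I2 order_trans[OF _ abs_ge_self]\<close>)

text \<open>Indicators of balls make a polynomially growing \<phi> bounded, at the price of one more
  moment. The bound of the rates does not involve n, so it can also dominate in a time
  integral.\<close>

lemma rate_truncation:
  fixes \<phi> :: "'a \<Rightarrow> real"
  assumes [measurable]: "\<phi> \<in> borel_measurable borel" and \<phi>: "\<And>v. \<bar>\<phi> v\<bar> \<le> C * (1 + (norm v)\<^sup>2) ^ p" and C: "0 \<le> C"
    and mom: "integrable \<mu> (\<lambda>v. (1 + (norm v)\<^sup>2) ^ Suc p)"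
  defines "\<phi>' \<equiv> \<lambda>n::nat. \<lambda>v. indicator {v. norm v \<le> real n} v * \<phi> v"
  shows "(\<lambda>n. rate (\<phi>' n)) \<longlonglongrightarrow> rate \<phi>"
    "\<bar>rate (\<phi>' n)\<bar> \<le> 4 * L * C * (LINT v|\<mu>. (1 + (norm v)\<^sup>2) ^ Suc p)\<^sup>2"
    "(\<lambda>n. LINT v|\<mu>. \<phi>' n v) \<longlonglongrightarrow> (LINT v|\<mu>. \<phi> v)"
proof -
  have m[measurable]: "\<phi>' n \<in> borel_measurable borel" for n unfolding \<phi>'_def by measurable
  have \<phi>'_le: "\<bar>\<phi>' n v\<bar> \<le> \<bar>\<phi> v\<bar>" for n v by (simp add: \<phi>'_def indicator_def)
  have \<phi>'_bd: "\<bar>\<phi>' n v\<bar> \<le> C * (1 + (norm v)\<^sup>2) ^ p" for n v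
    using order_trans[OF \<phi>'_le \<phi>] .
  have lim: "(\<lambda>n. \<phi>' n v) \<longlonglongrightarrow> \<phi> v" for v
  proof (rule tendsto_eventually)
    obtain n0 :: nat where "norm v \<le> real n0" using real_arch_simple by blast
    then show "\<forall>\<^sub>F n in sequentially. \<phi>' n v = \<phi> v"
      by (intro eventually_sequentiallyI[of n0]) (auto simp: \<phi>'_def indicator_def)
  qed
  let ?D = "\<lambda>v w::'a. (4 * L * C * (1 + (norm v)\<^sup>2) ^ Suc p) * (1 + (norm w)\<^sup>2) ^ Suc p"
  have iD: "integrable (\<mu> \<Otimes>\<^sub>M \<mu>) (\<lambda>(v, w). ?D v w)"
    and eD: "(LINT (v, w)|(\<mu> \<Otimes>\<^sub>M \<mu>). ?D v w) = 4 * L * C * (LINT v|\<mu>. (1 + (norm v)\<^sup>2) ^ Suc p)\<^sup>2"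
    using pair_mult[OF integrable_mult_right[OF mom, of "4 * L * C"] mom] by (auto simp: power2_eq_square)
  have wbd: "\<bar>weak_collision b L \<beta> (\<phi>' n) v w\<bar> \<le> ?D v w" for n and v w :: 'a
    by (rule weak_collision_growth[OF m \<phi>'_bd C])
  have wi: "integrable (\<mu> \<Otimes>\<^sub>M \<mu>) (\<lambda>(v, w). weak_collision b L \<beta> (\<phi>' n) v w)" for n
    by (rule weak_collision_integrable_state[OF m \<phi>'_bd C mom])
  have glim: "(\<lambda>n. weak_collision b L \<beta> (\<phi>' n) v w) \<longlonglongrightarrow> weak_collision b L \<beta> \<phi> v w" for v w :: 'a
  proof (cases "v = w")
    case False
    have "(\<lambda>n. gain b (\<phi>' n) v w) \<longlonglongrightarrow> gain b \<phi> v w"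
      unfolding gain_def
    proof (rule integral_dominated_convergence)
      show "integrable usphere (\<lambda>s. b (cos_dev v w s) * (C * (1 + ((norm v)\<^sup>2 + (norm w)\<^sup>2)) ^ p))"
        using kernel_integrable[OF False] by simp
      show "AE s in usphere. norm (b (cos_dev v w s) * \<phi>' n (post_vel v w s)) \<le> b (cos_dev v w s) * (C * (1 + ((norm v)\<^sup>2 + (norm w)\<^sup>2)) ^ p)" for n
        using AE_usphere_norm
      proof eventually_elim
        case (elim s)
        have "\<bar>\<phi>' n (post_vel v w s)\<bar> \<le> C * (1 + (norm (post_vel v w s))\<^sup>2) ^ p" by (rule \<phi>'_bd)
        also have "\<dots> \<le> C * (1 + ((norm v)\<^sup>2 + (norm w)\<^sup>2)) ^ p"
          using norm_post_vel_le[OF elim, of v w] C by (intro mult_left_mono power_mono) auto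
        finally show ?case using b_nonneg by (simp add: abs_mult mult_left_mono)
      qed
    qed (measurable, use lim in \<open>auto intro!: AE_I2 tendsto_intros\<close>)
    then show ?thesis unfolding weak_collision_def by (intro tendsto_intros lim)
  qed (use \<beta> in simp)
  show "(\<lambda>n. rate (\<phi>' n)) \<longlonglongrightarrow> rate \<phi>"
  proof (rule integral_dominated_convergence[OF _ _ iD])
    show "(\<lambda>(v, w). weak_collision b L \<beta> \<phi> v w) \<in> borel_measurable (\<mu> \<Otimes>\<^sub>M \<mu>)"
      using weak_collision_integrable_state[OF _ \<phi> C mom] by auto
    show "(\<lambda>(v, w). weak_collision b L \<beta> (\<phi>' n) v w) \<in> borel_measurable (\<mu> \<Otimes>\<^sub>M \<mu>)" for n
      using wi by auto
  qed (use glim wbd in \<open>auto intro!: AE_I2\<close>)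
  have "\<bar>rate (\<phi>' n)\<bar> \<le> (LINT x|(\<mu> \<Otimes>\<^sub>M \<mu>). \<bar>case x of (v, w) \<Rightarrow> weak_collision b L \<beta> (\<phi>' n) v w\<bar>)"
    by (rule integral_abs_bound)
  also have "\<dots> \<le> (LINT (v, w)|(\<mu> \<Otimes>\<^sub>M \<mu>). ?D v w)"
    by (rule integral_mono[OF integrable_abs[OF wi] iD]) (use wbd in auto)
  finally show "\<bar>rate (\<phi>' n)\<bar> \<le> 4 * L * C * (LINT v|\<mu>. (1 + (norm v)\<^sup>2) ^ Suc p)\<^sup>2"
    unfolding eD .
  show "(\<lambda>n. LINT v|\<mu>. \<phi>' n v) \<longlonglongrightarrow> (LINT v|\<mu>. \<phi> v)"
  proof (rule integral_dominated_convergence)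
    have "\<bar>\<phi>' n v\<bar> \<le> C * (1 + (norm v)\<^sup>2) ^ Suc p" for n v
    proof (rule order_trans[OF \<phi>'_bd mult_left_mono[OF _ C]])
      show "(1 + (norm v)\<^sup>2) ^ p \<le> (1 + (norm v)\<^sup>2) ^ Suc p" by (intro power_increasing) auto
    qed
    then show "AE v in \<mu>. norm (\<phi>' n v) \<le> C * (1 + (norm v)\<^sup>2) ^ Suc p" for n
      by (intro AE_I2) simp
    show "integrable \<mu> (\<lambda>v. C * (1 + (norm v)\<^sup>2) ^ Suc p)" by (rule integrable_mult_right[OF mom])
  qed (use lim in \<open>auto intro!: AE_I2\<close>)
qed

text \<open>With an angular factor of at most 1/4 the main terms are |v - w|^\<beta> times 1/4
  |w|^(2p) - 3/4 |v|^(2p), and the exchange of v and w leaves -1/2. Bounding |v - w|^\<beta> below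
  by |v|^\<beta> / 4 - |w|^\<beta> turns this into the dissipation with factor -M/8 and a term with
  the unweighted moment. The cross terms have lower order.\<close>

lemma poly_rate:
  assumes mom: "\<And>k. integrable \<mu> (\<lambda>v. (1 + (norm v)\<^sup>2) ^ k)" and p: "1 \<le> p"
    and gain: "\<And>v w::'a. v \<noteq> w \<Longrightarrow> gain b (\<lambda>u. ((norm u)\<^sup>2) ^ p) v w \<le> 1 / 4 * L * ((norm v)\<^sup>2 + (norm w)\<^sup>2) ^ p"
  shows "rate (\<lambda>v. ((norm v)\<^sup>2) ^ p) \<le> L * (- (M / 8) * (LINT v|\<mu>. norm v powr \<beta> * ((norm v)\<^sup>2) ^ p)
     + (M + E) / 2 * (LINT v|\<mu>. ((norm v)\<^sup>2) ^ p)
     + real p * 2 ^ p * E * (LINT v|\<mu>. norm v powr \<beta> * ((norm v)\<^sup>2) ^ (p - 1)))"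
proof -
  let ?r = "\<lambda>v w::'a. norm (v - w) powr \<beta>"
  let ?f = "\<lambda>v::'a. ((norm v)\<^sup>2) ^ p" and ?h = "\<lambda>v::'a. norm v powr \<beta> * ((norm v)\<^sup>2) ^ (p - 1)"
  \<comment> \<open>A factor 4 comes from the bound of |v - w|^\<beta>, the factor p 2^(p-1) from
    the mixed terms.\<close>
  define c where "c = real p * 2 ^ (p + 1)"
  have c0: "0 \<le> c" by (simp add: c_def)
  have pw: "((norm v)\<^sup>2) ^ k \<le> (1 + (norm v)\<^sup>2) ^ k" for v :: 'a and k
    by (intro power_mono) auto
  have bpw: "norm v powr \<beta> * ((norm v)\<^sup>2) ^ k \<le> (1 + (norm v)\<^sup>2) ^ Suc k" for v :: 'a and k
    using mult_mono[OF powr_le_one_plus_square[OF norm_ge_zero \<beta>] pw[of v k]] by simp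
  have if': "integrable \<mu> ?f"
    by (rule integrable_growth[OF mom[of p], where C=1]) (use pw in auto)
  have ibf: "integrable \<mu> (\<lambda>v. norm v powr \<beta> * ?f v)"
    by (rule integrable_growth[OF mom[of "Suc p"], where C=1]) (use bpw[of _ p] in auto)
  have ih: "integrable \<mu> ?h"
    by (rule integrable_growth[OF mom[of "Suc (p - 1)"], where C=1]) (use bpw[of _ "p - 1"] in auto)
  have irf: "integrable (\<mu> \<Otimes>\<^sub>M \<mu>) (\<lambda>(v, w). ?r v w * ?f v)"
  proof (rule pair_integrable_bound)
    show "integrable \<mu> (\<lambda>v. 2 * (1 + (norm v)\<^sup>2) ^ Suc p)" by (rule integrable_mult_right[OF mom])
    show "integrable \<mu> (\<lambda>v. (1 + (norm v)\<^sup>2) ^ 1)" by (rule mom)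
    fix v w :: 'a
    have "?r v w * ?f v \<le> (2 * ((1 + (norm v)\<^sup>2) * (1 + (norm w)\<^sup>2))) * (1 + (norm v)\<^sup>2) ^ p"
      by (intro mult_mono norm_diff_powr_le[OF \<beta>] pw) auto
    then show "\<bar>?r v w * ?f v\<bar> \<le> 2 * (1 + (norm v)\<^sup>2) ^ Suc p * (1 + (norm w)\<^sup>2) ^ 1"
      by (simp add: mult_ac)
  qed measurable
  have irf': "integrable (\<mu> \<Otimes>\<^sub>M \<mu>) (\<lambda>(v, w). ?r v w * ?f w)"
    "(LINT (v, w)|(\<mu> \<Otimes>\<^sub>M \<mu>). ?r v w * ?f w) = (LINT (v, w)|(\<mu> \<Otimes>\<^sub>M \<mu>). ?r v w * ?f v)"
  proof -
    have "(\<lambda>(v, w). ?r w v * ?f w) = (\<lambda>(v, w). ?r v w * ?f w)"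
      by (auto simp: fun_eq_iff norm_minus_commute)
    then show "integrable (\<mu> \<Otimes>\<^sub>M \<mu>) (\<lambda>(v, w). ?r v w * ?f w)"
      "(LINT (v, w)|(\<mu> \<Otimes>\<^sub>M \<mu>). ?r v w * ?f w) = (LINT (v, w)|(\<mu> \<Otimes>\<^sub>M \<mu>). ?r v w * ?f v)"
      using pair_swap[OF irf] by (simp_all only:)
  qed
  have iD: "integrable (\<mu> \<Otimes>\<^sub>M \<mu>) (\<lambda>(v, w). ?h v * (norm w)\<^sup>2)"
    and eD: "(LINT (v, w)|(\<mu> \<Otimes>\<^sub>M \<mu>). ?h v * (norm w)\<^sup>2) = (LINT v|\<mu>. ?h v) * E"
    using pair_mult[OF ih square_integrable] energy by auto
  note iD' = pair_swap[OF iD]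
  have ik: "integrable (\<mu> \<Otimes>\<^sub>M \<mu>) (\<lambda>(v, w). weak_collision b L \<beta> ?f v w)"
    by (rule weak_collision_integrable_state[OF _ _ _ mom[of "Suc p"], where C=1]) (use pw in auto)
  have cross: "?r v w * ((norm v)\<^sup>2 + (norm w)\<^sup>2) ^ p \<le> ?r v w * (?f v + ?f w) + c * (?h v * (norm w)\<^sup>2)"
    if le: "norm w \<le> norm v" for v w :: 'a
  proof -
    have "?r v w * ((norm v)\<^sup>2 + (norm w)\<^sup>2) ^ p \<le> ?r v w * (?f v + ?f w + real p * 2 ^ (p - 1) * (((norm v)\<^sup>2) ^ (p - 1) * (norm w)\<^sup>2))"
      using power_add_cross_le[of "(norm w)\<^sup>2" "(norm v)\<^sup>2" p] le by (intro mult_left_mono) (auto simp: power_mono)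
    also have "\<dots> = ?r v w * (?f v + ?f w) + ?r v w * (real p * 2 ^ (p - 1) * (((norm v)\<^sup>2) ^ (p - 1) * (norm w)\<^sup>2))"
      by (simp add: distrib_left)
    also have "?r v w * (real p * 2 ^ (p - 1) * (((norm v)\<^sup>2) ^ (p - 1) * (norm w)\<^sup>2)) \<le>
        (4 * norm v powr \<beta>) * (real p * 2 ^ (p - 1) * (((norm v)\<^sup>2) ^ (p - 1) * (norm w)\<^sup>2))"
      by (intro mult_right_mono norm_diff_powr_le_max[OF \<beta> le]) auto
    also have "\<dots> = c * (?h v * (norm w)\<^sup>2)"
    proof -
      have "(4::real) * 2 ^ (p - 1) = 2 ^ (p + 1)" using p by (cases p) auto
      then have "c = real p * (4 * 2 ^ (p - 1))" unfolding c_def by simp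
      then show ?thesis by simp
    qed
    finally show ?thesis by simp
  qed
  have cross2: "?r v w * ((norm v)\<^sup>2 + (norm w)\<^sup>2) ^ p \<le> ?r v w * (?f v + ?f w) + c * (?h v * (norm w)\<^sup>2 + ?h w * (norm v)\<^sup>2)"
    for v w :: 'a
  proof -
    have n: "0 \<le> c * (?h v * (norm w)\<^sup>2)" "0 \<le> c * (?h w * (norm v)\<^sup>2)" using c0 by auto
    show ?thesis
    proof (cases "norm w \<le> norm v")
      case True
      show ?thesis using cross[OF True] n unfolding distrib_left[of c] by linarith
    next
      case False
      then have "?r w v * ((norm w)\<^sup>2 + (norm v)\<^sup>2) ^ p \<le> ?r w v * (?f w + ?f v) + c * (?h w * (norm v)\<^sup>2)"
        by (intro cross) auto
      then have "?r v w * ((norm v)\<^sup>2 + (norm w)\<^sup>2) ^ p \<le> ?r v w * (?f v + ?f w) + c * (?h w * (norm v)\<^sup>2)"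
        by (simp only: norm_minus_commute[of w v] add.commute[of "(norm w)\<^sup>2"] add.commute[of "?f w"])
      then show ?thesis using n unfolding distrib_left[of c] by linarith
    qed
  qed
  let ?U = "\<lambda>v w. L * (1 / 4 * (?r v w * ?f w) - 3 / 4 * (?r v w * ?f v) + c / 4 * (?h v * (norm w)\<^sup>2 + ?h w * (norm v)\<^sup>2))"
  have upper: "weak_collision b L \<beta> ?f v w \<le> ?U v w" for v w :: 'a
  proof (cases "v = w")
    case True
    have "0 \<le> L * (c / 4 * (?h w * (norm w)\<^sup>2 + ?h w * (norm w)\<^sup>2))" using L_pos c0 by simp
    then show ?thesis unfolding True weak_collision_same[OF \<beta>(1)] using \<beta> by simp
  next
    case False
    have "weak_collision b L \<beta> ?f v w \<le> ?r v w * (1 / 4 * L * ((norm v)\<^sup>2 + (norm w)\<^sup>2) ^ p - L * ?f v)"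
      unfolding weak_collision_def using gain[OF False] by (intro mult_left_mono) auto
    also have "\<dots> = L * (1 / 4 * (?r v w * ((norm v)\<^sup>2 + (norm w)\<^sup>2) ^ p) - ?r v w * ?f v)"
      by (simp add: algebra_simps)
    also have "\<dots> \<le> ?U v w"
    proof (rule mult_left_mono)
      show "1 / 4 * (?r v w * ((norm v)\<^sup>2 + (norm w)\<^sup>2) ^ p) - ?r v w * ?f v \<le>
        1 / 4 * (?r v w * ?f w) - 3 / 4 * (?r v w * ?f v) + c / 4 * (?h v * (norm w)\<^sup>2 + ?h w * (norm v)\<^sup>2)"
        using cross2[of v w] unfolding distrib_left[of "?r v w"] by (simp add: field_simps)
    qed (use L_pos in simp)
    finally show ?thesis .
  qed
  have iU: "integrable (\<mu> \<Otimes>\<^sub>M \<mu>) (\<lambda>(v, w). ?U v w)"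
    using irf irf'(1) iD iD'(1) unfolding case_prod_beta' by simp
  have "rate ?f \<le> (LINT (v, w)|(\<mu> \<Otimes>\<^sub>M \<mu>). ?U v w)"
    by (rule pair_integral_mono[OF ik iU upper])
  also have "\<dots> = L * (1 / 4 * (LINT (v, w)|(\<mu> \<Otimes>\<^sub>M \<mu>). ?r v w * ?f w) - 3 / 4 * (LINT (v, w)|(\<mu> \<Otimes>\<^sub>M \<mu>). ?r v w * ?f v)
      + c / 4 * ((LINT (v, w)|(\<mu> \<Otimes>\<^sub>M \<mu>). ?h v * (norm w)\<^sup>2) + (LINT (v, w)|(\<mu> \<Otimes>\<^sub>M \<mu>). ?h w * (norm v)\<^sup>2)))"
    using irf irf'(1) iD iD'(1) unfolding case_prod_beta' by simp
  also have "(LINT (v, w)|(\<mu> \<Otimes>\<^sub>M \<mu>). ?r v w * ?f w) = (LINT (v, w)|(\<mu> \<Otimes>\<^sub>M \<mu>). ?r v w * ?f v)"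
    by (rule irf'(2))
  finally have 1: "rate ?f \<le> L * (- (1 / 2) * (LINT (v, w)|(\<mu> \<Otimes>\<^sub>M \<mu>). ?r v w * ?f v) + c / 2 * ((LINT v|\<mu>. ?h v) * E))"
    unfolding iD'(2) eD by (simp add: field_simps)
  have 2: "M / 4 * (LINT v|\<mu>. norm v powr \<beta> * ?f v) - (M + E) * (LINT v|\<mu>. ?f v) \<le> (LINT (v, w)|(\<mu> \<Otimes>\<^sub>M \<mu>). ?r v w * ?f v)"
  proof -
    have i1: "integrable (\<mu> \<Otimes>\<^sub>M \<mu>) (\<lambda>(v, w). norm v powr \<beta> * ?f v * 1)"
      and e1: "(LINT (v, w)|(\<mu> \<Otimes>\<^sub>M \<mu>). norm v powr \<beta> * ?f v * 1) = (LINT v|\<mu>. norm v powr \<beta> * ?f v) * M"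
      using pair_mult[OF ibf, of "\<lambda>_. 1"] mass by auto
    have i2: "integrable (\<mu> \<Otimes>\<^sub>M \<mu>) (\<lambda>(v, w). ?f v * norm w powr \<beta>)"
      and e2: "(LINT (v, w)|(\<mu> \<Otimes>\<^sub>M \<mu>). ?f v * norm w powr \<beta>) = (LINT v|\<mu>. ?f v) * (LINT v|\<mu>. norm v powr \<beta>)"
      using pair_mult[OF if' norm_powr_integrable] by auto
    have "(LINT v|\<mu>. ?f v) * (LINT v|\<mu>. norm v powr \<beta>) \<le> (LINT v|\<mu>. ?f v) * (M + E)"
      by (intro mult_left_mono norm_powr_integral_le integral_nonneg_AE) auto
    then have "M / 4 * (LINT v|\<mu>. norm v powr \<beta> * ?f v) - (M + E) * (LINT v|\<mu>. ?f v) \<le>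
       1 / 4 * (LINT (v, w)|(\<mu> \<Otimes>\<^sub>M \<mu>). norm v powr \<beta> * ?f v * 1) - (LINT (v, w)|(\<mu> \<Otimes>\<^sub>M \<mu>). ?f v * norm w powr \<beta>)"
      unfolding e1 e2 by (simp add: mult.commute)
    also have "\<dots> = (LINT (v, w)|(\<mu> \<Otimes>\<^sub>M \<mu>). 1 / 4 * (norm v powr \<beta> * ?f v * 1) - ?f v * norm w powr \<beta>)"
      using i1 i2 unfolding case_prod_beta' by simp
    also have "\<dots> \<le> (LINT (v, w)|(\<mu> \<Otimes>\<^sub>M \<mu>). ?r v w * ?f v)"
    proof (rule pair_integral_mono[OF _ irf])
      show "integrable (\<mu> \<Otimes>\<^sub>M \<mu>) (\<lambda>(v, w). 1 / 4 * (norm v powr \<beta> * ?f v * 1) - ?f v * norm w powr \<beta>)"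
        using i1 i2 unfolding case_prod_beta' by simp
      fix v w :: 'a
      have "(norm v powr \<beta> / 4 - norm w powr \<beta>) * ?f v \<le> ?r v w * ?f v"
        by (intro mult_right_mono norm_diff_powr_ge[OF \<beta>]) auto
      then show "1 / 4 * (norm v powr \<beta> * ?f v * 1) - ?f v * norm w powr \<beta> \<le> ?r v w * ?f v"
        by (simp add: algebra_simps)
    qed
    finally show ?thesis .
  qed
  have "c / 2 = real p * 2 ^ p" by (simp add: c_def)
  have "rate ?f \<le> L * (- (1 / 2) * (M / 4 * (LINT v|\<mu>. norm v powr \<beta> * ?f v) - (M + E) * (LINT v|\<mu>. ?f v)) + c / 2 * ((LINT v|\<mu>. ?h v) * E))"
    by (rule order_trans[OF 1 mult_left_mono]) (use 2 L_pos in auto)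
  also have "\<dots> = L * (- (M / 8) * (LINT v|\<mu>. norm v powr \<beta> * ?f v) + (M + E) / 2 * (LINT v|\<mu>. ?f v) + real p * 2 ^ p * E * (LINT v|\<mu>. ?h v))"
    unfolding \<open>c / 2 = real p * 2 ^ p\<close> by (simp add: field_simps)
  finally show ?thesis .
qed

end

section \<open>Truncated exponential series\<close>

definition exp_partial :: "nat \<Rightarrow> real \<Rightarrow> real" where
  "exp_partial n z = (\<Sum>k\<le>n. z ^ k / fact k)"

lemma exp_partial_nonneg: "0 \<le> z \<Longrightarrow> 0 \<le> exp_partial n z"
  unfolding exp_partial_def by (intro sum_nonneg) auto

lemma exp_partial_sums: "(\<lambda>k. z ^ k / fact k) sums exp (z::real)"
  using exp_converges[of z] by (simp add: divide_inverse mult.commute)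

lemma exp_partial_le_exp:
  assumes "0 \<le> z"
  shows "exp_partial n z \<le> exp z"
  unfolding exp_partial_def sums_unique[OF exp_partial_sums[of z]]
  using assms by (intro sum_le_suminf sums_summable[OF exp_partial_sums]) auto

lemma exp_partial_tendsto: "(\<lambda>n. exp_partial n z) \<longlonglongrightarrow> exp z"
  unfolding exp_partial_def using exp_partial_sums[of z] by (simp add: sums_def_le)

text \<open>In the double sum the left side runs over the index triangle i + j \<le> n, the right
  side over the square containing it.\<close>

lemma exp_partial_add_le:
  assumes "0 \<le> x" "0 \<le> y"
  shows "exp_partial n (x + y) \<le> exp_partial n x * exp_partial n y"
proof -
  let ?g = "\<lambda>i j. (x ^ i / fact i) * (y ^ j / fact j) :: real"
  have fin: "finite {(i, j). i + j \<le> n}"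
    by (rule finite_subset[of _ "{..n} \<times> {..n}"]) auto
  have "exp_partial n (x + y) = (\<Sum>k\<le>n. \<Sum>i\<le>k. ?g i (k - i))"
    unfolding exp_partial_def
  proof (intro sum.cong refl)
    fix k
    have "(x + y) ^ k / fact k = (\<Sum>i\<le>k. real (k choose i) * x ^ i * y ^ (k - i) / fact k)"
      by (simp add: binomial_ring sum_divide_distrib)
    also have "\<dots> = (\<Sum>i\<le>k. ?g i (k - i))"
      by (intro sum.cong refl) (simp add: binomial_fact field_simps)
    finally show "(x + y) ^ k / fact k = (\<Sum>i\<le>k. ?g i (k - i))" .
  qed
  also have "\<dots> = (\<Sum>(i, j)\<in>{(i, j). i + j \<le> n}. ?g i j)"
    by (rule sum.triangle_reindex_eq[symmetric])
  also have "\<dots> \<le> (\<Sum>(i, j)\<in>{..n} \<times> {..n}. ?g i j)"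
    using assms by (intro sum_mono2) auto
  also have "\<dots> = exp_partial n x * exp_partial n y"
    unfolding exp_partial_def by (simp add: sum_product sum.cartesian_product)
  finally show ?thesis .
qed

text \<open>Normalised to x + y = 1 this is u \<le> u^\<theta> on [0, 1].\<close>

lemma powr_add_le_add_powr:
  fixes x y :: real
  assumes "0 \<le> x" "0 \<le> y" "0 < \<theta>" "\<theta> \<le> 1"
  shows "(x + y) powr \<theta> \<le> x powr \<theta> + y powr \<theta>"
proof (cases "x + y = 0")
  case False
  then have pos: "0 < x + y" using assms by linarith
  have *: "u \<le> u powr \<theta>" if "0 \<le> u" "u \<le> 1" for u :: real
  proof (cases "u = 0")
    case False
    then have "u powr 1 \<le> u powr \<theta>" using that assms by (intro powr_mono') auto
    then show ?thesis using that False by simp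
  qed simp
  have "1 = x / (x + y) + y / (x + y)" using pos by (simp add: add_divide_distrib[symmetric])
  also have "\<dots> \<le> (x / (x + y)) powr \<theta> + (y / (x + y)) powr \<theta>"
    using assms pos by (intro add_mono *) auto
  also have "\<dots> = (x powr \<theta> + y powr \<theta>) / (x + y) powr \<theta>"
    by (simp add: powr_divide add_divide_distrib)
  finally show ?thesis using pos by (simp add: field_simps)
qed (use assms in auto)

text \<open>k = 0 is excluded because at u = 0 the left side would be 1 and the right side 0, as
  \<open>0 powr 0 = 0\<close>.\<close>

lemma norm_powr_power_eq:
  assumes "1 \<le> k"
  shows "(norm u powr s) ^ k = ((norm u)\<^sup>2) powr (real k * s / 2)"
proof (cases "norm u = 0")
  case True
  then show ?thesis using assms by (simp add: power_0_left)
next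
  case False
  then have u: "0 < norm u" using norm_ge_zero[of u] by linarith
  have sq: "(norm u)\<^sup>2 = norm u powr 2" using u by (simp add: powr_numeral)
  have "((norm u)\<^sup>2) powr (real k * s / 2) = norm u powr (s * real k)"
    unfolding sq powr_powr by (simp add: mult.commute)
  then show ?thesis using u by (simp add: powr_power mult.commute)
qed

lemma norm_powr_le: "0 < s \<Longrightarrow> s \<le> 2 \<Longrightarrow> norm v powr s \<le> 1 + (norm v)\<^sup>2"
  by (rule powr_le_one_plus_square[OF norm_ge_zero])

lemma exp_partial_growth:
  assumes a: "0 \<le> a" and s: "0 < s" "s \<le> 2"
  shows "exp_partial n (a * norm v powr s) \<le> (\<Sum>k\<le>n. a ^ k / fact k) * (1 + (norm v)\<^sup>2) ^ n"
proof -
  have "exp_partial n (a * norm v powr s) = (\<Sum>k\<le>n. a ^ k / fact k * (norm v powr s) ^ k)"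
    unfolding exp_partial_def by (simp add: power_mult_distrib)
  also have "\<dots> \<le> (\<Sum>k\<le>n. a ^ k / fact k * (1 + (norm v)\<^sup>2) ^ n)"
  proof (intro sum_mono mult_left_mono)
    fix k assume "k \<in> {..n}"
    have "(norm v powr s) ^ k \<le> (1 + (norm v)\<^sup>2) ^ k"
      using norm_powr_le[OF s] by (intro power_mono) auto
    also have "\<dots> \<le> (1 + (norm v)\<^sup>2) ^ n" using \<open>k \<in> {..n}\<close> by (intro power_increasing) auto
    finally show "(norm v powr s) ^ k \<le> (1 + (norm v)\<^sup>2) ^ n" .
  qed (use a in auto)
  finally show ?thesis by (simp add: sum_distrib_right)
qed

context collision_state
begin

text \<open>
  The exponential of a sum splits into a product because \<open>s / 2 \<le> 1\<close> makes \<open>r \<mapsto> r powr (s / 2)\<close>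
  subadditive; the small factor \<open>\<epsilon>\<close> comes from the angular averaging of high powers.
\<close>
lemma exp_rate:
  assumes mom: "\<And>k. integrable \<mu> (\<lambda>v. (1 + (norm v)\<^sup>2) ^ k)"
    and a: "0 \<le> a" and s: "\<beta> \<le> s" "s \<le> 2" and \<epsilon>: "0 \<le> \<epsilon>"
    and k0: "1 \<le> k0" "k0 \<le> n" "p0 \<le> real k0 * \<beta> / 2"
    and gain: "\<And>p v w. p0 \<le> p \<Longrightarrow> v \<noteq> (w::'a) \<Longrightarrow>
      gain b (\<lambda>u. ((norm u)\<^sup>2) powr p) v w \<le> \<epsilon> * L * ((norm v)\<^sup>2 + (norm w)\<^sup>2) powr p"
  defines "e \<equiv> \<lambda>v::'a. exp_partial n (a * norm v powr s)"
    and "low \<equiv> \<lambda>v::'a. \<Sum>k<k0. (a * norm v powr s) ^ k / fact k"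
    and "slice \<equiv> \<lambda>v::'a. \<Sum>k=k0..n. (a * norm v powr s) ^ k / fact k"
  shows "rate slice \<le> L * (8 * \<epsilon> * (LINT v|\<mu>. e v) * (LINT v|\<mu>. norm v powr \<beta> * e v)
      - M / 4 * ((LINT v|\<mu>. norm v powr \<beta> * e v) - (LINT v|\<mu>. norm v powr \<beta> * low v))
      + (M + E) * (LINT v|\<mu>. e v))" (is ?rate)
    and "integrable \<mu> e" "integrable \<mu> (\<lambda>v. norm v powr \<beta> * e v)" "integrable \<mu> slice"
proof -
  have s0: "0 < s" using s \<beta> by simp
  define Z where "Z = (\<lambda>v::'a. a * norm v powr s)"
  have Z0: "0 \<le> Z v" for v using a by (simp add: Z_def)
  have [measurable]: "Z \<in> borel_measurable borel" unfolding Z_def by measurable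
  have [measurable]: "e \<in> borel_measurable borel" unfolding e_def exp_partial_def by measurable
  have [measurable]: "low \<in> borel_measurable borel" unfolding low_def by measurable
  have [measurable]: "slice \<in> borel_measurable borel" unfolding slice_def by measurable
  have e_split: "e v = low v + slice v" for v
  proof -
    have "{..n} = {..<k0} \<union> {k0..n}" using k0 by auto
    then show ?thesis
      unfolding e_def low_def slice_def exp_partial_def by (simp add: sum.union_disjoint ivl_disj_int)
  qed
  have low0: "0 \<le> low v" for v unfolding low_def using a by (intro sum_nonneg) auto
  have slice0: "0 \<le> slice v" for v unfolding slice_def using a by (intro sum_nonneg) auto
  have e0: "0 \<le> e v" for v using low0 slice0 e_split by simp
  define C where "C = (\<Sum>k\<le>n. a ^ k / fact k)"
  have C0: "0 \<le> C" unfolding C_def using a by (intro sum_nonneg) auto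
  have e_bd: "e v \<le> C * (1 + (norm v)\<^sup>2) ^ n" for v
    unfolding e_def C_def by (rule exp_partial_growth[OF a s0 s(2)])
  have be_bd: "norm v powr \<beta> * e v \<le> C * (1 + (norm v)\<^sup>2) ^ Suc n" for v
    using mult_mono[OF norm_powr_le[OF \<beta>] e_bd[of v]] e0 C0 by (simp add: mult_ac)
  have ie: "integrable \<mu> f" if "f \<in> borel_measurable borel" "\<And>v. 0 \<le> f v" "\<And>v. f v \<le> e v" for f
    by (rule integrable_growth[OF mom[of n] that(1)]) (use order_trans[OF that(3) e_bd] that(2) in auto)
  have ibe: "integrable \<mu> (\<lambda>v. norm v powr \<beta> * f v)" if [measurable]: "f \<in> borel_measurable borel" and "\<And>v. 0 \<le> f v" "\<And>v. f v \<le> e v" for f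
  proof (rule integrable_growth[OF mom[of "Suc n"]])
    fix v :: 'a
    have "norm v powr \<beta> * f v \<le> norm v powr \<beta> * e v" by (intro mult_left_mono that) auto
    then show "\<bar>norm v powr \<beta> * f v\<bar> \<le> C * (1 + (norm v)\<^sup>2) ^ Suc n"
      using be_bd[of v] that(2)[of v] by (simp add: abs_mult)
  qed measurable
  show i_e: "integrable \<mu> e" by (rule ie) (use e0 in auto)
  show i_be: "integrable \<mu> (\<lambda>v. norm v powr \<beta> * e v)" by (rule ibe) (use e0 in auto)
  show i_s: "integrable \<mu> slice" by (rule ie) (use slice0 low0 e_split in auto)
  have i_bs: "integrable \<mu> (\<lambda>v. norm v powr \<beta> * slice v)" by (rule ibe) (use slice0 low0 e_split in auto)
  have i_bl: "integrable \<mu> (\<lambda>v. norm v powr \<beta> * low v)" by (rule ibe) (use slice0 low0 e_split in auto)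
  have gain_slice: "gain b slice v w \<le> \<epsilon> * L * (e v * e w)" if vw: "v \<noteq> w" for v w :: 'a
  proof -
    let ?x = "(norm v)\<^sup>2" and ?y = "(norm w)\<^sup>2"
    have term_eq: "(a * norm u powr s) ^ k / fact k = a ^ k / fact k * ((norm u)\<^sup>2) powr (real k * s / 2)"
      if "k \<in> {k0..n}" for u :: 'a and k
      using that k0 norm_powr_power_eq[of k u s] by (simp add: power_mult_distrib)
    have int: "integrable usphere (\<lambda>s'. b (cos_dev v w s') * ((norm (post_vel v w s'))\<^sup>2) powr q)" if "0 \<le> q" for q
      by (rule kernel_mult_integrable[OF vw, where C="(?x + ?y) powr q"])
         (measurable, use norm_post_vel_le[of _ v w] that in \<open>auto intro!: powr_mono2\<close>)
    have "gain b slice v w = (LINT s'|usphere. (\<Sum>k=k0..n. a ^ k / fact k * (b (cos_dev v w s') * ((norm (post_vel v w s'))\<^sup>2) powr (real k * s / 2))))"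
      unfolding gain_def slice_def
      unfolding sum_distrib_left
    proof (intro Bochner_Integration.integral_cong refl sum.cong)
      fix s' :: 'a and k assume k: "k \<in> {k0..n}"
      show "b (cos_dev v w s') * ((a * norm (post_vel v w s') powr s) ^ k / fact k) =
        a ^ k / fact k * (b (cos_dev v w s') * ((norm (post_vel v w s'))\<^sup>2) powr (real k * s / 2))"
        by (simp only: term_eq[OF k] mult.left_commute)
    qed
    also have "\<dots> = (\<Sum>k=k0..n. a ^ k / fact k * gain b (\<lambda>u. ((norm u)\<^sup>2) powr (real k * s / 2)) v w)"
      unfolding gain_def using s0 int by (subst Bochner_Integration.integral_sum) auto
    also have "\<dots> \<le> (\<Sum>k=k0..n. a ^ k / fact k * (\<epsilon> * L * (norm v powr s + norm w powr s) ^ k))"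
    proof (intro sum_mono mult_left_mono)
      fix k assume k: "k \<in> {k0..n}"
      \<comment> \<open>The threshold is stated with \<beta>, so the same \<open>k0\<close> serves
        every s \<ge> \<beta>.\<close>
      have "p0 \<le> real k0 * \<beta> / 2" by (rule k0)
      also have "\<dots> \<le> real k * s / 2" using k s \<beta> by (intro divide_right_mono mult_mono) auto
      finally have "gain b (\<lambda>u. ((norm u)\<^sup>2) powr (real k * s / 2)) v w \<le> \<epsilon> * L * (?x + ?y) powr (real k * s / 2)"
        by (rule gain[OF _ vw])
      also have "(?x + ?y) powr (real k * s / 2) \<le> (norm v powr s + norm w powr s) ^ k"
      proof -
        have h: "((norm u)\<^sup>2) powr (s / 2) = norm u powr s" for u :: 'a
          using norm_powr_power_eq[of 1 u s] by simp
        have "(?x + ?y) powr (real k * s / 2) = ((?x + ?y) powr (s / 2)) ^ k"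
        proof (cases "?x + ?y = 0")
          case True
          then show ?thesis unfolding True using k k0 by (simp add: power_0_left)
        next
          case False
          then show ?thesis by (subst powr_power) (auto simp: mult.commute)
        qed
        also have "\<dots> \<le> (norm v powr s + norm w powr s) ^ k"
          using powr_add_le_add_powr[of ?x ?y "s / 2"] s0 s by (intro power_mono) (auto simp: h)
        finally show ?thesis .
      qed
      finally show "gain b (\<lambda>u. ((norm u)\<^sup>2) powr (real k * s / 2)) v w \<le> \<epsilon> * L * (norm v powr s + norm w powr s) ^ k"
        using \<epsilon> L_pos by (simp add: mult_left_mono)
    qed (use a in auto)
    also have "\<dots> = \<epsilon> * L * (\<Sum>k=k0..n. (Z v + Z w) ^ k / fact k)"
      by (simp add: sum_distrib_left Z_def power_mult_distrib mult_ac flip: distrib_left)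
    \<comment> \<open>The low degrees are added back because splitting the sum
      \<open>Z v + Z w\<close> into a product uses the full partial series.\<close>
    also have "\<dots> \<le> \<epsilon> * L * (\<Sum>k\<le>n. (Z v + Z w) ^ k / fact k)"
      using \<epsilon> L_pos Z0 by (intro mult_left_mono sum_mono2) auto
    also have "\<dots> \<le> \<epsilon> * L * (e v * e w)"
      using \<epsilon> L_pos exp_partial_add_le[OF Z0 Z0, of n v w]
      by (intro mult_left_mono) (auto simp: e_def Z_def exp_partial_def)
    finally show ?thesis .
  qed
  \<comment> \<open>The gain is bounded with |v - w|^\<beta> \<le> 4 (|v|^\<beta> + |w|^\<beta>),
    the loss with the lower bound of |v - w|^\<beta>.\<close>
  let ?U = "\<lambda>v w. L * (4 * \<epsilon> * ((norm v powr \<beta> * e v) * e w + e v * (norm w powr \<beta> * e w))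
      - 1 / 4 * ((norm v powr \<beta> * slice v) * 1) + slice v * norm w powr \<beta>)"
  have upper: "weak_collision b L \<beta> slice v w \<le> ?U v w" for v w :: 'a
  proof -
    let ?r = "norm (v - w) powr \<beta>"
    have 1: "(norm v powr \<beta> / 4 - norm w powr \<beta>) * slice v \<le> ?r * slice v"
      by (intro mult_right_mono norm_diff_powr_ge[OF \<beta>] slice0)
    have 2: "?r * (\<epsilon> * (e v * e w)) \<le> (4 * (norm v powr \<beta> + norm w powr \<beta>)) * (\<epsilon> * (e v * e w))"
      using \<epsilon> e0 by (intro mult_right_mono norm_diff_powr_le_sum[OF \<beta>]) auto
    have "weak_collision b L \<beta> slice v w \<le> L * (?r * (\<epsilon> * (e v * e w)) - ?r * slice v)"
    proof (cases "v = w")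
      case False
      have "weak_collision b L \<beta> slice v w \<le> ?r * (\<epsilon> * L * (e v * e w) - L * slice v)"
        unfolding weak_collision_def using gain_slice[OF False] by (intro mult_left_mono) auto
      then show ?thesis by (simp add: algebra_simps)
    qed (use \<beta> in simp)
    also have "\<dots> \<le> L * ((4 * (norm v powr \<beta> + norm w powr \<beta>)) * (\<epsilon> * (e v * e w)) - (norm v powr \<beta> / 4 - norm w powr \<beta>) * slice v)"
      using 1 2 L_pos by (intro mult_left_mono) auto
    also have "\<dots> = ?U v w" by (simp add: algebra_simps)
    finally show ?thesis .
  qed
  have slice_growth: "\<bar>slice v\<bar> \<le> C * (1 + (norm v)\<^sup>2) ^ n" for v
    using e_bd[of v] slice0[of v] low0[of v] e_split[of v] by simp
  have ik: "integrable (\<mu> \<Otimes>\<^sub>M \<mu>) (\<lambda>(v, w). weak_collision b L \<beta> slice v w)"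
    by (rule weak_collision_integrable_state[OF _ slice_growth C0 mom]) measurable
  note t1 = pair_mult[OF i_be i_e] and t2 = pair_mult[OF i_e i_be]
    and t3 = pair_mult[OF i_bs, of "\<lambda>_. 1"] and t4 = pair_mult[OF i_s norm_powr_integrable]
  have c1: "integrable \<mu> (\<lambda>_. 1 :: real)" by simp
  have iU: "integrable (\<mu> \<Otimes>\<^sub>M \<mu>) (\<lambda>(v, w). ?U v w)"
    using t1(1) t2(1) t3(1)[OF c1] t4(1) unfolding case_prod_beta'
    by (intro integrable_mult_right Bochner_Integration.integrable_add Bochner_Integration.integrable_diff)
  have "rate slice \<le> (LINT (v, w)|(\<mu> \<Otimes>\<^sub>M \<mu>). ?U v w)"
    by (rule pair_integral_mono[OF ik iU upper])
  also have "\<dots> = L * (4 * \<epsilon> * ((LINT (v, w)|(\<mu> \<Otimes>\<^sub>M \<mu>). (norm v powr \<beta> * e v) * e w) + (LINT (v, w)|(\<mu> \<Otimes>\<^sub>M \<mu>). e v * (norm w powr \<beta> * e w)))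
      - 1 / 4 * (LINT (v, w)|(\<mu> \<Otimes>\<^sub>M \<mu>). (norm v powr \<beta> * slice v) * 1) + (LINT (v, w)|(\<mu> \<Otimes>\<^sub>M \<mu>). slice v * norm w powr \<beta>))"
    using t1(1) t2(1) t3(1)[OF c1] t4(1) unfolding case_prod_beta'
    by (simp add: Bochner_Integration.integral_add Bochner_Integration.integral_diff integrable_mult_right)
  \<comment> \<open>The two product terms of the gain have the same integral, so 4 becomes
    8.\<close>
  also have "\<dots> = L * (8 * \<epsilon> * (LINT v|\<mu>. e v) * (LINT v|\<mu>. norm v powr \<beta> * e v)
      - M / 4 * (LINT v|\<mu>. norm v powr \<beta> * slice v) + (LINT v|\<mu>. slice v) * (LINT v|\<mu>. norm v powr \<beta>))"
    unfolding t1(2) t2(2) t3(2)[OF c1] t4(2) using mass by (simp add: algebra_simps)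
  also have "\<dots> \<le> L * (8 * \<epsilon> * (LINT v|\<mu>. e v) * (LINT v|\<mu>. norm v powr \<beta> * e v)
      - M / 4 * (LINT v|\<mu>. norm v powr \<beta> * slice v) + (LINT v|\<mu>. e v) * (M + E))"
  proof (intro mult_left_mono add_mono order_refl mult_mono)
    show "(LINT v|\<mu>. slice v) \<le> (LINT v|\<mu>. e v)"
      using low0 e_split by (intro integral_mono i_s i_e) auto
    show "0 \<le> (LINT v|\<mu>. e v)" using e0 by (intro integral_nonneg_AE) auto
    show "0 \<le> (LINT v|\<mu>. norm v powr \<beta>)" by (intro integral_nonneg_AE) auto
  qed (use L_pos norm_powr_integral_le in auto)
  \<comment> \<open>The dissipation is rewritten for the full series e; the low part, given back
    here, will be bounded by a polynomial moment.\<close>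
  also have "(LINT v|\<mu>. norm v powr \<beta> * slice v) = (LINT v|\<mu>. norm v powr \<beta> * e v) - (LINT v|\<mu>. norm v powr \<beta> * low v)"
    using i_bs i_bl by (simp add: e_split distrib_left)
  finally show ?rate by (simp add: mult.commute)
qed

end

section \<open>Moments along the flow\<close>

lemma one_plus_power_le:
  assumes "0 \<le> (x::real)" "k \<le> p"
  shows "(1 + x) ^ k \<le> 2 ^ p * (1 + x ^ p)"
proof -
  have "(1 + x) ^ k \<le> (1 + x) ^ p" using assms by (intro power_increasing) auto
  also have "\<dots> \<le> (2 * max 1 x) ^ p" using assms by (intro power_mono) auto
  also have "\<dots> = 2 ^ p * (max 1 x) ^ p" by (simp add: power_mult_distrib)
  also have "\<dots> \<le> 2 ^ p * (1 + x ^ p)"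
  proof (intro mult_left_mono)
    show "(max 1 x) ^ p \<le> 1 + x ^ p"
      using assms zero_le_power[of x p] by (cases "1 \<le> x") (auto simp: max_def)
  qed simp
  finally show ?thesis .
qed

context moment_flow
begin

definition mu :: "real \<Rightarrow> 'a measure" where
  "mu t = density lborel (\<lambda>v. ennreal (g t v))"

abbreviation flow_rate :: "real \<Rightarrow> ('a \<Rightarrow> real) \<Rightarrow> real" where
  "flow_rate t \<phi> \<equiv> LINT (v, w)|(mu t \<Otimes>\<^sub>M mu t). weak_collision b L \<beta> \<phi> v w"

lemma sets_mu [simp, measurable_cong]: "sets (mu t) = sets borel"
  by (simp add: mu_def)

lemma integral_mu:
  assumes "0 \<le> t" and [measurable]: "\<phi> \<in> borel_measurable borel"
  shows "(LINT v|mu t. \<phi> v) = (LINT v|lborel. g t v * \<phi> v)"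
  using regular_densityD(1,2)[OF regular[OF assms(1)]]
  unfolding mu_def by (subst integral_density) auto

lemma weak_form_mu:
  assumes [measurable]: "\<phi> \<in> borel_measurable borel" and "\<And>v. \<bar>\<phi> v\<bar> \<le> C" "0 \<le> t"
  shows "((\<lambda>\<tau>. flow_rate \<tau> \<phi>) has_integral ((LINT v|mu t. \<phi> v) - (LINT v|mu 0. \<phi> v))) {0..t}"
  unfolding integral_mu[OF assms(3,1)] integral_mu[OF order_refl assms(1)]
  unfolding mu_def by (rule weak_form[OF assms])

text \<open>The mass is left unevaluated here, since its conservation is obtained from this very
  locale; \<open>state\<close> then inserts M.\<close>

lemma collision_state_aux:
  assumes t: "0 \<le> t"
  shows "collision_state b L (mu t) \<beta> (measure (mu t) UNIV) E"
proof -
  note r = regular_densityD[OF regular[OF t]]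
  interpret finite_measure "mu t" unfolding mu_def by (rule finite_measure_regular_density[OF regular[OF t]])
  show ?thesis
  proof
    have "integrable lborel (\<lambda>v. g t v * (norm v)\<^sup>2)"
      using regular[OF t] unfolding regular_density_def by (simp add: mult.commute)
    then show "integrable (mu t) (\<lambda>v. (norm v)\<^sup>2)"
      unfolding mu_def using r by (subst integrable_density) auto
    show "(LINT v|mu t. (norm v)\<^sup>2) = E"
      using energy[OF t] by (subst integral_mu[OF t]) (auto simp: mult.commute)
  qed (use \<beta> in auto)
qed

lemma measure_mu:
  assumes t: "0 \<le> t"
  shows "measure (mu t) UNIV = M"
proof -
  have m: "measure (mu \<tau>) UNIV = (LINT v|mu \<tau>. 1)" if "0 \<le> \<tau>" for \<tau>
    using collision_state.integral_const_mu[OF collision_state_aux[OF that], of 1] by simp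
  have "((\<lambda>\<tau>. 0) has_integral ((LINT v|mu t. 1) - (LINT v|mu 0. 1 :: real))) {0..t}"
  proof (rule has_integral_eq)
    show "((\<lambda>\<tau>. flow_rate \<tau> (\<lambda>_. 1)) has_integral ((LINT v|mu t. 1) - (LINT v|mu 0. 1 :: real))) {0..t}"
      by (rule weak_form_mu[where C=1]) (use t in auto)
    show "flow_rate \<tau> (\<lambda>_. 1) = 0" if "\<tau> \<in> {0..t}" for \<tau>
      using collision_state.rate_const[OF collision_state_aux[of \<tau>]] that by simp
  qed
  then have "(LINT v|mu t. 1) = (LINT v|mu 0. 1 :: real)"
    using has_integral_unique[OF has_integral_0] by fastforce
  also have "\<dots> = M" using initial_mass by (subst integral_mu) auto
  finally show ?thesis using m[OF t] by simp
qed

lemma state: "0 \<le> t \<Longrightarrow> collision_state b L (mu t) \<beta> M E"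
  using collision_state_aux[of t] measure_mu[of t] by simp

lemma mass_energy_nonneg: "0 \<le> M" "0 \<le> E"
  using collision_state.mass_nonneg[OF state[of 0]] collision_state.energy_nonneg[OF state[of 0]] by auto

lemma trunc_power_integrable:
  assumes t: "0 \<le> t"
  shows "integrable (mu t) (\<lambda>v. trunc_power q (real n) ((norm v)\<^sup>2))"
proof -
  interpret S: collision_state "TYPE('a)" b L "mu t" \<beta> M E by (rule state[OF t])
  show ?thesis
  proof (rule Bochner_Integration.integrable_bound[OF integrable_mult_left[OF S.square_integrable, of "real n ^ q"]])
    show "(\<lambda>v. trunc_power q (real n) ((norm v)\<^sup>2)) \<in> borel_measurable (mu t)"
      unfolding trunc_power_def by measurable
    have "\<bar>trunc_power q (real n) x\<bar> \<le> x * real n ^ q" if "0 \<le> x" for x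
      using that unfolding trunc_power_def by (auto simp: abs_mult intro!: mult_left_mono power_mono)
    then show "AE v in mu t. norm (trunc_power q (real n) ((norm v)\<^sup>2)) \<le> norm ((norm v)\<^sup>2 * real n ^ q)"
      by (intro AE_I2) (auto intro: order_trans[OF _ abs_ge_self])
  qed
qed

text \<open>The bound K is uniform in the truncation but depends on T. Finiteness on bounded time
  intervals is the aim here: it makes powers admissible as test functions.\<close>

lemma local_moment:
  fixes q :: nat
  assumes m0: "integrable (mu 0) (\<lambda>v. ((norm v)\<^sup>2) ^ Suc q)"
  obtains K where "\<And>t. 0 \<le> t \<Longrightarrow> t \<le> T \<Longrightarrow> integrable (mu t) (\<lambda>v. ((norm v)\<^sup>2) ^ Suc q) \<and>
    (LINT v|mu t. ((norm v)\<^sup>2) ^ Suc q) \<le> K"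
proof
  \<comment> \<open>The summand 1 keeps B positive when E = 0.\<close>
  define B where "B = 8 * L * (2 ^ q * (real q + 1)) * E + 1"
  define K where "K = (M / 2 + (LINT v|mu 0. ((norm v)\<^sup>2) ^ Suc q)) * exp (B * \<bar>T\<bar>)"
  note ME = mass_energy_nonneg
  have B: "0 < B" using ME L_pos by (simp add: B_def add_nonneg_pos)
  have m00: "0 \<le> (LINT v|mu 0. ((norm v)\<^sup>2) ^ Suc q)" by (intro integral_nonneg_AE) auto
  have K0: "0 \<le> K" unfolding K_def using ME m00 by simp
  have trunc_le: "(LINT v|mu t. trunc_power q (real n) ((norm v)\<^sup>2)) \<le> K" if t: "0 \<le> t" "t \<le> T" for n t
  proof -
    define G where "G = (\<lambda>t. LINT v|mu t. trunc_power q (real n) ((norm v)\<^sup>2))"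
    define \<eta> where "\<eta> = (\<lambda>v::'a. real n ^ q * (norm v)\<^sup>2 - trunc_power q (real n) ((norm v)\<^sup>2))"
    have \<eta>_meas[measurable]: "\<eta> \<in> borel_measurable borel" unfolding \<eta>_def trunc_power_def by measurable
    have \<eta>_bd: "\<bar>\<eta> v\<bar> \<le> real n ^ q * real n" for v
    proof -
      define x where "x = (norm v)\<^sup>2"
      have x: "0 \<le> x" by (simp add: x_def)
      have "\<bar>real n ^ q * x - trunc_power q (real n) x\<bar> \<le> real n ^ q * real n"
      proof (cases "real n \<le> x")
        case True
        then show ?thesis by (simp add: trunc_power_def min_absorb2)
      next
        case False
        then have 1: "trunc_power q (real n) x = x ^ q * x" by (simp add: trunc_power_def)
        have "x ^ q * x \<le> real n ^ q * x" using x False by (intro mult_right_mono power_mono) auto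
        moreover have "real n ^ q * x \<le> real n ^ q * real n" using False by (intro mult_left_mono) auto
        moreover have "0 \<le> x ^ q * x" using x by simp
        ultimately show ?thesis unfolding 1 by linarith
      qed
      then show ?thesis by (simp add: \<eta>_def x_def)
    qed
    have \<eta>_int: "(LINT v|mu t. \<eta> v) = real n ^ q * E - G t" if "0 \<le> t" for t
    proof -
      interpret S: collision_state "TYPE('a)" b L "mu t" \<beta> M E by (rule state[OF that])
      show ?thesis unfolding \<eta>_def G_def
        using S.square_integrable S.energy trunc_power_integrable[OF that] by simp
    qed
    \<comment> \<open>The energy part of \<eta> is constant in time, so G changes by minus the
      change of the integral of \<eta>.\<close>
    have hi: "((\<lambda>\<tau>. - flow_rate \<tau> \<eta>) has_integral (G t - G 0)) {0..t}" if "0 \<le> t" for t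
      using has_integral_neg[OF weak_form_mu[OF \<eta>_meas \<eta>_bd that]] by (simp add: \<eta>_int that)
    have ub: "- flow_rate \<tau> \<eta> \<le> B * (M / 2 + G \<tau>)" if "0 \<le> \<tau>" for \<tau>
    proof -
      interpret S: collision_state "TYPE('a)" b L "mu \<tau>" \<beta> M E by (rule state[OF that])
      have i1: "integrable (mu \<tau>) (\<lambda>v. (1 + (norm v)\<^sup>2) ^ Suc 0)" using S.square_integrable by simp
      have i2: "integrable (mu \<tau> \<Otimes>\<^sub>M mu \<tau>) (\<lambda>(v, w). weak_collision b L \<beta> \<eta> v w)"
        by (rule S.weak_collision_integrable_state[OF _ _ _ i1, where C="real n ^ q * real n"]) (use \<eta>_bd in auto)
      have "- flow_rate \<tau> \<eta> \<le> 4 * L * (2 ^ q * (real q + 1)) * E * (M + 2 * G \<tau>)"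
        unfolding G_def \<eta>_def
        by (rule S.truncated_rate[OF _ trunc_power_integrable[OF that]]) (use i2 \<eta>_bd in \<open>auto simp: \<eta>_def\<close>)
      also have "\<dots> = (B - 1) * (M / 2 + G \<tau>)" by (simp add: B_def field_simps)
      also have "\<dots> \<le> B * (M / 2 + G \<tau>)"
      proof (intro mult_right_mono)
        have "0 \<le> G \<tau>" unfolding G_def by (intro integral_nonneg_AE AE_I2) (simp add: trunc_power_nonneg)
        then show "0 \<le> M / 2 + G \<tau>" using ME by simp
      qed simp
      finally show ?thesis .
    qed
    have "M / 2 + G t \<le> (M / 2 + G 0) * exp (B * t)"
      by (rule gronwall[OF hi ub B t(1)])
    also have "\<dots> \<le> K"
      unfolding K_def
    proof (intro mult_mono)
      have "trunc_power q (real n) x \<le> x ^ Suc q" if "0 \<le> x" for x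
        using that unfolding trunc_power_def by (auto intro!: mult_left_mono power_mono)
      then have "G 0 \<le> (LINT v|mu 0. ((norm v)\<^sup>2) ^ Suc q)"
        unfolding G_def by (intro integral_mono trunc_power_integrable m0) auto
      then show "M / 2 + G 0 \<le> M / 2 + (LINT v|mu 0. ((norm v)\<^sup>2) ^ Suc q)" by simp
      show "exp (B * t) \<le> exp (B * \<bar>T\<bar>)" using t B by (simp add: mult_left_mono)
    qed (use ME m00 in auto)
    finally show ?thesis using ME by (simp add: G_def)
  qed
  fix t :: real assume t: "0 \<le> t" "t \<le> T"
  have nn: "(\<integral>\<^sup>+ v. ennreal (((norm v)\<^sup>2) ^ Suc q) \<partial>mu t) \<le> ennreal K"
  proof (rule nn_integral_le_of_limit[where u="\<lambda>n v. trunc_power q (real n) ((norm v)\<^sup>2)"])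
    fix n :: nat
    show "(\<lambda>v. trunc_power q (real n) ((norm v)\<^sup>2)) \<in> borel_measurable (mu t)"
      using trunc_power_integrable[OF t(1)] by auto
    have "(\<integral>\<^sup>+ v. ennreal (trunc_power q (real n) ((norm v)\<^sup>2)) \<partial>mu t) = ennreal (LINT v|mu t. trunc_power q (real n) ((norm v)\<^sup>2))"
      by (intro nn_integral_eq_integral trunc_power_integrable[OF t(1)] AE_I2) (simp add: trunc_power_nonneg)
    then show "(\<integral>\<^sup>+ v. ennreal (trunc_power q (real n) ((norm v)\<^sup>2)) \<partial>mu t) \<le> ennreal K"
      using trunc_le[OF t, of n] by (simp add: ennreal_leI)
  next
    fix v :: 'a
    obtain n0 :: nat where n0: "(norm v)\<^sup>2 \<le> real n0" using real_arch_simple by blast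
    show "(\<lambda>n. trunc_power q (real n) ((norm v)\<^sup>2)) \<longlonglongrightarrow> ((norm v)\<^sup>2) ^ Suc q"
      by (intro tendsto_eventually eventually_sequentiallyI[of n0]) (use n0 in \<open>auto simp: trunc_power_def\<close>)
  qed
  have i: "integrable (mu t) (\<lambda>v. ((norm v)\<^sup>2) ^ Suc q)"
    using nn by (intro integrableI_nonneg) (auto simp: less_top[symmetric] top_unique)
  have "ennreal (LINT v|mu t. ((norm v)\<^sup>2) ^ Suc q) \<le> ennreal K"
    using nn nn_integral_eq_integral[OF i] by simp
  then show "integrable (mu t) (\<lambda>v. ((norm v)\<^sup>2) ^ Suc q) \<and> (LINT v|mu t. ((norm v)\<^sup>2) ^ Suc q) \<le> K"
    using i K0 by (simp add: ennreal_le_iff)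
qed

lemma local_moments:
  assumes m0: "\<And>q. integrable (mu 0) (\<lambda>v. ((norm v)\<^sup>2) ^ Suc q)"
  obtains K where "\<And>t. 0 \<le> t \<Longrightarrow> t \<le> T \<Longrightarrow> integrable (mu t) (\<lambda>v. (1 + (norm v)\<^sup>2) ^ k) \<and>
    (LINT v|mu t. (1 + (norm v)\<^sup>2) ^ k) \<le> K"
proof -
  obtain K where K: "\<And>t. 0 \<le> t \<Longrightarrow> t \<le> T \<Longrightarrow> integrable (mu t) (\<lambda>v. ((norm v)\<^sup>2) ^ Suc k) \<and>
    (LINT v|mu t. ((norm v)\<^sup>2) ^ Suc k) \<le> K"
    using local_moment[OF m0[of k], of T] by metis
  show thesis
  proof (rule that[of "2 ^ Suc k * (M + K)"])
    fix t :: real assume t: "0 \<le> t" "t \<le> T"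
    interpret S: collision_state "TYPE('a)" b L "mu t" \<beta> M E by (rule state[OF t(1)])
    have le: "(1 + (norm v)\<^sup>2) ^ k \<le> 2 ^ Suc k * (1 + ((norm v)\<^sup>2) ^ Suc k)" for v :: 'a
      by (rule one_plus_power_le) auto
    have i1: "integrable (mu t) (\<lambda>v. 2 ^ Suc k * (1 + ((norm v)\<^sup>2) ^ Suc k))"
      using K[OF t] by (intro integrable_mult_right Bochner_Integration.integrable_add) auto
    have i2: "integrable (mu t) (\<lambda>v. (1 + (norm v)\<^sup>2) ^ k)"
    proof (rule Bochner_Integration.integrable_bound[OF i1])
      show "AE v in mu t. norm ((1 + (norm v)\<^sup>2) ^ k) \<le> norm (2 ^ Suc k * (1 + ((norm v)\<^sup>2) ^ Suc k))"
        using le by (intro AE_I2) (simp add: order_trans[OF _ abs_ge_self] del: power_Suc)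
    qed measurable
    have "(LINT v|mu t. (1 + (norm v)\<^sup>2) ^ k) \<le> (LINT v|mu t. 2 ^ Suc k * (1 + ((norm v)\<^sup>2) ^ Suc k))"
      by (rule integral_mono[OF i2 i1 le])
    also have "\<dots> = 2 ^ Suc k * (M + (LINT v|mu t. ((norm v)\<^sup>2) ^ Suc k))"
      using K[OF t] S.mass by (simp del: power_Suc)
    also have "\<dots> \<le> 2 ^ Suc k * (M + K)"
      using K[OF t] by (intro mult_left_mono add_left_mono) auto
    finally show "integrable (mu t) (\<lambda>v. (1 + (norm v)\<^sup>2) ^ k) \<and> (LINT v|mu t. (1 + (norm v)\<^sup>2) ^ k) \<le> 2 ^ Suc k * (M + K)"
      using i2 by blast
  qed
qed

lemma moments_integrable:
  assumes m0: "\<And>q. integrable (mu 0) (\<lambda>v. ((norm v)\<^sup>2) ^ Suc q)" and "0 \<le> t"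
  shows "integrable (mu t) (\<lambda>v. (1 + (norm v)\<^sup>2) ^ k)"
  using local_moments[OF m0, of t k] assms(2) by (metis order_refl)

text \<open>Local moment bounds of order p + 1 give a dominating constant on [0, t], so the cut-offs
  can be removed inside the time integral.\<close>

lemma weak_form_growth:
  assumes m0: "\<And>q. integrable (mu 0) (\<lambda>v. ((norm v)\<^sup>2) ^ Suc q)"
    and [measurable]: "\<phi> \<in> borel_measurable borel" and \<phi>: "\<And>v. \<bar>\<phi> v\<bar> \<le> C * (1 + (norm v)\<^sup>2) ^ p" and C: "0 \<le> C"
    and t: "0 \<le> t"
  shows "((\<lambda>\<tau>. flow_rate \<tau> \<phi>) has_integral ((LINT v|mu t. \<phi> v) - (LINT v|mu 0. \<phi> v))) {0..t}"
proof -
  let ?\<phi> = "\<lambda>n::nat. \<lambda>v. indicator {v. norm v \<le> real n} v * \<phi> v"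
  obtain K where K: "\<And>\<tau>. 0 \<le> \<tau> \<Longrightarrow> \<tau> \<le> t \<Longrightarrow> integrable (mu \<tau>) (\<lambda>v. (1 + (norm v)\<^sup>2) ^ Suc p) \<and>
    (LINT v|mu \<tau>. (1 + (norm v)\<^sup>2) ^ Suc p) \<le> K"
    using local_moments[OF m0] by metis
  have bd: "\<bar>?\<phi> n v\<bar> \<le> C * (1 + (real n)\<^sup>2) ^ p" for n v
  proof (cases "norm v \<le> real n")
    case True
    then have "(1 + (norm v)\<^sup>2) ^ p \<le> (1 + (real n)\<^sup>2) ^ p" by (intro power_mono add_left_mono) auto
    then have "C * (1 + (norm v)\<^sup>2) ^ p \<le> C * (1 + (real n)\<^sup>2) ^ p" using C by (rule mult_left_mono)
    then show ?thesis using True \<phi>[of v] by simp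
  qed (use C in simp)
  note trunc = collision_state.rate_truncation[OF state _ \<phi> C]
  show ?thesis
  proof (rule has_integral_dominated_convergence)
    show "((\<lambda>\<tau>. flow_rate \<tau> (?\<phi> n)) has_integral ((LINT v|mu t. ?\<phi> n v) - (LINT v|mu 0. ?\<phi> n v))) {0..t}" for n
      by (rule weak_form_mu[OF _ bd t]) measurable
    show "(\<lambda>\<tau>. 4 * L * C * K\<^sup>2) integrable_on {0..t}" by (rule integrable_const_ivl)
    show "\<forall>\<tau>\<in>{0..t}. norm (flow_rate \<tau> (?\<phi> n)) \<le> 4 * L * C * K\<^sup>2" for n
    proof
      fix \<tau> assume \<tau>: "\<tau> \<in> {0..t}"
      then have "\<bar>flow_rate \<tau> (?\<phi> n)\<bar> \<le> 4 * L * C * (LINT v|mu \<tau>. (1 + (norm v)\<^sup>2) ^ Suc p)\<^sup>2"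
        using K[of \<tau>] by (intro trunc(2)) auto
      also have "\<dots> \<le> 4 * L * C * K\<^sup>2"
      proof (intro mult_left_mono power_mono)
        show "0 \<le> (LINT v|mu \<tau>. (1 + (norm v)\<^sup>2) ^ Suc p)" by (intro integral_nonneg_AE) auto
      qed (use K[of \<tau>] \<tau> L_pos C in auto)
      finally show "norm (flow_rate \<tau> (?\<phi> n)) \<le> 4 * L * C * K\<^sup>2" by simp
    qed
    show "\<forall>\<tau>\<in>{0..t}. (\<lambda>n. flow_rate \<tau> (?\<phi> n)) \<longlonglongrightarrow> flow_rate \<tau> \<phi>"
      using K by (auto intro!: trunc(1))
    show "(\<lambda>n. (LINT v|mu t. ?\<phi> n v) - (LINT v|mu 0. ?\<phi> n v)) \<longlonglongrightarrow> (LINT v|mu t. \<phi> v) - (LINT v|mu 0. \<phi> v)"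
      using K t by (intro tendsto_diff trunc(3)) auto
  qed
qed

end

text \<open>Both lower-order terms of \<open>poly_rate\<close> are absorbed, each by half of the
  dissipation M/8. B is found before the measure, so it is the same at all times and for all flows
  with the same M and E.\<close>

lemma (in angular_kernel) poly_rate_uniform:
  assumes \<beta>: "0 < \<beta>" "\<beta> \<le> 2" and M: "0 < M" and E: "0 \<le> E" and p: "1 \<le> p"
    and gain: "\<And>v w::'a. v \<noteq> w \<Longrightarrow> gain b (\<lambda>u. ((norm u)\<^sup>2) ^ p) v w \<le> 1 / 4 * L * ((norm v)\<^sup>2 + (norm w)\<^sup>2) ^ p"
  obtains B where "\<And>\<mu> :: 'a measure. collision_state b L \<mu> \<beta> M E \<Longrightarrow> (\<And>k. integrable \<mu> (\<lambda>v. (1 + (norm v)\<^sup>2) ^ k)) \<Longrightarrow>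
    (LINT (v, w)|(\<mu> \<Otimes>\<^sub>M \<mu>). weak_collision b L \<beta> (\<lambda>v. ((norm v)\<^sup>2) ^ p) v w)
      \<le> L * (B - (M + E) / 2 * (LINT v|\<mu>. ((norm v)\<^sup>2) ^ p))"
proof -
  define c where "c = real p * 2 ^ p"
  \<comment> \<open>Above |v|^2 = l the lower power costs a factor 1 / l, and c E / l \<le> M /
    16.\<close>
  define l where "l = max 1 (16 * (c * E) / M)"
  \<comment> \<open>Chosen so that M / 16 * S = M + E; T is then the value of |v|^2 at which
    |v|^\<beta> reaches S.\<close>
  define S where "S = 16 * (M + E) / M"
  define T where "T = S powr (2 / \<beta>)"
  define B where "B = (M + E) * T ^ p * M + c * E * (2 * l ^ p * M)"
  have c0: "0 \<le> c" by (simp add: c_def)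
  have l: "1 \<le> l" "16 * (c * E) / M \<le> l" by (simp_all add: l_def)
  have S0: "0 \<le> S" using M E by (simp add: S_def)
  have cl: "c * E / l \<le> M / 16"
    using l M by (simp add: field_simps)
  have MS: "M / 16 * S = M + E" using M by (simp add: S_def)
  have pt1: "S * r \<^sup>2 ^ p \<le> r powr \<beta> * r\<^sup>2 ^ p + S * T ^ p" if r: "0 \<le> r" for r :: real
  proof (cases "S \<le> r powr \<beta>")
    case True
    have "S * r\<^sup>2 ^ p \<le> r powr \<beta> * r\<^sup>2 ^ p" using True by (intro mult_right_mono) auto
    moreover have "0 \<le> S * T ^ p" using S0 by (simp add: T_def)
    ultimately show ?thesis by linarith
  next
    case False
    have "r\<^sup>2 = (r powr \<beta>) powr (2 / \<beta>)"
      using r \<beta> by (cases "r = 0") (simp_all add: powr_powr powr_numeral)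
    also have "\<dots> \<le> T" unfolding T_def using False \<beta> by (intro powr_mono2) auto
    finally have "S * r\<^sup>2 ^ p \<le> S * T ^ p" using S0 by (intro mult_left_mono power_mono) auto
    moreover have "0 \<le> r powr \<beta> * r\<^sup>2 ^ p" by simp
    ultimately show ?thesis by linarith
  qed
  have pt2: "r powr \<beta> * r\<^sup>2 ^ (p - 1) \<le> 1 / l * (r powr \<beta> * r\<^sup>2 ^ p) + 2 * l ^ p" if r: "0 \<le> r" for r :: real
  proof (cases "l \<le> r\<^sup>2")
    case True
    have pp: "r\<^sup>2 ^ p = r\<^sup>2 * r\<^sup>2 ^ (p - 1)" using p by (cases p) auto
    have "l * (r powr \<beta> * r\<^sup>2 ^ (p - 1)) \<le> r\<^sup>2 * (r powr \<beta> * r\<^sup>2 ^ (p - 1))"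
      using True by (intro mult_right_mono) auto
    then have "r powr \<beta> * r\<^sup>2 ^ (p - 1) \<le> 1 / l * (r powr \<beta> * r\<^sup>2 ^ p)"
      using l unfolding pp by (simp add: field_simps)
    moreover have "0 \<le> 2 * l ^ p" using l by simp
    ultimately show ?thesis by linarith
  next
    case False
    have pp: "l ^ p = l * l ^ (p - 1)" using p by (cases p) auto
    have "r powr \<beta> \<le> 2 * l" using powr_le_one_plus_square[OF r \<beta>] False l by linarith
    moreover have "r\<^sup>2 ^ (p - 1) \<le> l ^ (p - 1)" using False by (intro power_mono) auto
    ultimately have "r powr \<beta> * r\<^sup>2 ^ (p - 1) \<le> 2 * l * l ^ (p - 1)"
      using l by (intro mult_mono) auto
    moreover have "0 \<le> 1 / l * (r powr \<beta> * r\<^sup>2 ^ p)" using l by simp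
    ultimately show ?thesis unfolding pp by linarith
  qed
  show thesis
  proof (rule that[of B])
    fix \<mu> :: "'a measure"
    assume st: "collision_state b L \<mu> \<beta> M E" and mom: "\<And>k. integrable \<mu> (\<lambda>v. (1 + (norm v)\<^sup>2) ^ k)"
    interpret S: collision_state "TYPE('a)" b L \<mu> \<beta> M E by (rule st)
    let ?f = "\<lambda>v::'a. ((norm v)\<^sup>2) ^ p" and ?h = "\<lambda>v::'a. norm v powr \<beta> * ((norm v)\<^sup>2) ^ (p - 1)"
    let ?m = "LINT v|\<mu>. ?f v" and ?P = "LINT v|\<mu>. norm v powr \<beta> * ?f v" and ?d = "LINT v|\<mu>. ?h v"
    have pw: "((norm v)\<^sup>2) ^ k \<le> (1 + (norm v)\<^sup>2) ^ k" for v :: 'a and k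
      by (intro power_mono) auto
    have bpw: "norm v powr \<beta> * ((norm v)\<^sup>2) ^ k \<le> (1 + (norm v)\<^sup>2) ^ Suc k" for v :: 'a and k
      using mult_mono[OF powr_le_one_plus_square[OF norm_ge_zero \<beta>] pw[of v k]] by simp
    have i1: "integrable \<mu> ?f"
      by (rule S.integrable_growth[OF mom[of p], where C=1]) (use pw in auto)
    have i2: "integrable \<mu> (\<lambda>v. norm v powr \<beta> * ?f v)"
      by (rule S.integrable_growth[OF mom[of "Suc p"], where C=1]) (use bpw[of _ p] in auto)
    have i3: "integrable \<mu> ?h"
      by (rule S.integrable_growth[OF mom[of "Suc (p - 1)"], where C=1]) (use bpw[of _ "p - 1"] in auto)
    have "S * ?m = (LINT v|\<mu>. S * ?f v)" by simp
    also have "\<dots> \<le> (LINT v|\<mu>. norm v powr \<beta> * ?f v + S * T ^ p)"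
      using i1 i2 pt1 by (intro integral_mono) auto
    also have "\<dots> = ?P + S * T ^ p * M" using i2 S.mass by simp
    finally have "M / 16 * (S * ?m) \<le> M / 16 * (?P + S * T ^ p * M)" using M by (intro mult_left_mono) auto
    then have 1: "(M + E) * ?m \<le> M / 16 * ?P + (M + E) * T ^ p * M"
      unfolding MS[symmetric] by (simp add: algebra_simps)
    have "?d \<le> (LINT v|\<mu>. 1 / l * (norm v powr \<beta> * ?f v) + 2 * l ^ p)"
      by (rule integral_mono[OF i3]) (use i2 pt2 in auto)
    also have "\<dots> = 1 / l * ?P + 2 * l ^ p * M" using i2 S.mass by simp
    finally have "c * E * ?d \<le> c * E * (1 / l * ?P + 2 * l ^ p * M)" using c0 E by (intro mult_left_mono) auto
    also have "\<dots> = c * E / l * ?P + c * E * (2 * l ^ p * M)" by (simp add: distrib_left)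
    also have "\<dots> \<le> M / 16 * ?P + c * E * (2 * l ^ p * M)"
    proof (intro add_right_mono mult_right_mono cl)
      show "0 \<le> ?P" by (intro integral_nonneg_AE) auto
    qed
    finally have 2: "c * E * ?d \<le> M / 16 * ?P + c * E * (2 * l ^ p * M)" .
    have "S.rate ?f \<le> L * (- (M / 8) * ?P + (M + E) / 2 * ?m + real p * 2 ^ p * E * ?d)"
      by (rule S.poly_rate[OF mom p gain])
    also have "\<dots> \<le> L * (B - (M + E) / 2 * ?m)"
    proof (rule mult_left_mono)
      \<comment> \<open>Twice the required amount has been absorbed, which leaves the restoring term
        -(M + E) / 2 times the moment.\<close>
      have "(M + E) / 2 * ?m = (M + E) * ?m - (M + E) / 2 * ?m" by (simp add: field_simps)
      then show "- (M / 8) * ?P + (M + E) / 2 * ?m + real p * 2 ^ p * E * ?d \<le> B - (M + E) / 2 * ?m"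
        using 1 2 unfolding B_def c_def[symmetric] by linarith
    qed (use L_pos in simp)
    finally show "S.rate ?f \<le> L * (B - (M + E) / 2 * ?m)" .
  qed
qed


section \<open>Bounds uniform in time\<close>

context moment_flow
begin

text \<open>Above 2 B / (M + E) the bound of the rate is nonpositive, so the moment cannot climb.
  The 1 is the width of the strip that \<open>barrier\<close> needs.\<close>

lemma poly_moment_bound:
  assumes m0: "\<And>q. integrable (mu 0) (\<lambda>v. ((norm v)\<^sup>2) ^ Suc q)"
    and M: "0 < M"
    and B: "\<And>\<tau>. 0 \<le> \<tau> \<Longrightarrow> flow_rate \<tau> (\<lambda>v. ((norm v)\<^sup>2) ^ p) \<le> L * (B - (M + E) / 2 * (LINT v|mu \<tau>. ((norm v)\<^sup>2) ^ p))"
    and t: "0 \<le> t" and init: "(LINT v|mu 0. ((norm v)\<^sup>2) ^ p) \<le> K0"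
  shows "(LINT v|mu t. ((norm v)\<^sup>2) ^ p) \<le> max K0 (2 * B / (M + E)) + 1"
proof (rule barrier[where ?A1.0="max K0 (2 * B / (M + E))" and G="\<lambda>t. LINT v|mu t. ((norm v)\<^sup>2) ^ p"])
  show "((\<lambda>\<tau>. flow_rate \<tau> (\<lambda>v. ((norm v)\<^sup>2) ^ p)) has_integral
      (LINT v|mu t. ((norm v)\<^sup>2) ^ p) - (LINT v|mu 0. ((norm v)\<^sup>2) ^ p)) {0..t}" if "0 \<le> t" for t
    by (rule weak_form_growth[OF m0, where C=1 and p=p]) (use that in \<open>auto intro!: power_mono\<close>)
  fix \<tau> :: real
  assume \<tau>: "0 \<le> \<tau>" and le: "max K0 (2 * B / (M + E)) \<le> (LINT v|mu \<tau>. ((norm v)\<^sup>2) ^ p)"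
  have ME: "0 < M + E" using M mass_energy_nonneg by simp
  have "2 * B / (M + E) \<le> (LINT v|mu \<tau>. ((norm v)\<^sup>2) ^ p)" using le by simp
  then have "B - (M + E) / 2 * (LINT v|mu \<tau>. ((norm v)\<^sup>2) ^ p) \<le> 0"
    using ME by (simp add: field_simps)
  then have "L * (B - (M + E) / 2 * (LINT v|mu \<tau>. ((norm v)\<^sup>2) ^ p)) \<le> 0"
    using L_pos by (simp add: mult_le_0_iff)
  then show "flow_rate \<tau> (\<lambda>v. ((norm v)\<^sup>2) ^ p) \<le> 0" using B[OF \<tau>] by linarith
qed (use t init in auto)

lemma exp_moment_bound:
  assumes m0: "\<And>q. integrable (mu 0) (\<lambda>v. ((norm v)\<^sup>2) ^ Suc q)"
    and M: "0 < M" and C0: "0 < C0" and s: "\<beta> \<le> s" "s \<le> 2"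
    and a: "0 < a" "a \<le> 1" "a * R\<^sup>2 \<le> 1" and R: "1 \<le> R" "8 * (M + E + 1) / M \<le> R powr \<beta>"
    and k0: "1 \<le> k0" "p0 \<le> real k0 * \<beta> / 2"
    and gain: "\<And>p v w. p0 \<le> p \<Longrightarrow> v \<noteq> (w::'a) \<Longrightarrow>
      gain b (\<lambda>u. ((norm u)\<^sup>2) powr p) v w \<le> \<epsilon> * L * ((norm v)\<^sup>2 + (norm w)\<^sup>2) powr p"
    and A1: "A1 = 3 * (M * (M + E + 1)) + M / 4 * (M + E + 1) + C0"
    and \<epsilon>: "\<epsilon> = M / (64 * (A1 + M + 2))"
    and low: "\<And>\<tau>. 0 \<le> \<tau> \<Longrightarrow> a * real k0 * (LINT v|mu \<tau>. (1 + (norm v)\<^sup>2) ^ Suc k0) \<le> 1"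
    and init: "(LINT v|mu 0. exp_partial n (a * norm v powr s)) \<le> C0"
    and n: "k0 \<le> n" and t: "0 \<le> t"
  shows "(LINT v|mu t. exp_partial n (a * norm v powr s)) \<le> A1 + M + 2"
proof -
  have s0: "0 < s" using s \<beta> by simp
  define e where "e = (\<lambda>v::'a. exp_partial n (a * norm v powr s))"
  define lo where "lo = (\<lambda>v::'a. \<Sum>k<k0. (a * norm v powr s) ^ k / fact k)"
  define slice where "slice = (\<lambda>v::'a. \<Sum>k=k0..n. (a * norm v powr s) ^ k / fact k)"
  define S where "S = 8 * (M + E + 1) / M"
  note ME = mass_energy_nonneg
  have mom: "integrable (mu \<tau>) (\<lambda>v. (1 + (norm v)\<^sup>2) ^ k)" if "0 \<le> \<tau>" for \<tau> k
    by (rule moments_integrable[OF m0 that])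
  have A1pos: "0 < A1" unfolding A1 using M ME C0 by (intro add_nonneg_pos add_nonneg_nonneg) auto
  have \<epsilon>0: "0 \<le> \<epsilon>" unfolding \<epsilon> using M A1pos by simp
  have S0: "0 \<le> S" using M ME by (simp add: S_def)
  have MS: "M / 8 * S = M + E + 1" using M by (simp add: S_def)
  have [measurable]: "slice \<in> borel_measurable borel" unfolding slice_def by measurable
  have [measurable]: "lo \<in> borel_measurable borel" unfolding lo_def by measurable
  have e_split: "e v = lo v + slice v" for v
  proof -
    have "{..n} = {..<k0} \<union> {k0..n}" using n by auto
    then show ?thesis
      unfolding e_def lo_def slice_def exp_partial_def by (simp add: sum.union_disjoint ivl_disj_int)
  qed
  have lo0: "0 \<le> lo v" for v unfolding lo_def using a by (intro sum_nonneg) auto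
  have slice0: "0 \<le> slice v" for v unfolding slice_def using a by (intro sum_nonneg) auto
  have e0: "0 \<le> e v" for v using lo0 slice0 e_split by simp
  \<comment> \<open>The constant term gives 1. Every other term has a^k \<le> a because a \<le> 1,
    and there are fewer than \<open>k0\<close> of them.\<close>
  have lo_le: "lo v \<le> 1 + a * real k0 * (1 + (norm v)\<^sup>2) ^ k0" for v
  proof -
    have "lo v \<le> (\<Sum>k<k0. (if k = 0 then 1 else 0) + a * (1 + (norm v)\<^sup>2) ^ k0)"
      unfolding lo_def
    proof (rule sum_mono)
      fix k assume k: "k \<in> {..<k0}"
      show "(a * norm v powr s) ^ k / fact k \<le> (if k = 0 then 1 else 0) + a * (1 + (norm v)\<^sup>2) ^ k0"
      proof (cases "k = 0")
        case True
        have "0 \<le> a * (1 + (norm v)\<^sup>2) ^ k0" using a by simp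
        then show ?thesis using True by simp
      next
        case False
        have "(a * norm v powr s) ^ k / fact k \<le> (a * norm v powr s) ^ k / 1"
          using a by (intro divide_left_mono) (auto simp: fact_ge_1)
        also have "\<dots> = a ^ k * (norm v powr s) ^ k" by (simp add: power_mult_distrib)
        also have "\<dots> \<le> a * (1 + (norm v)\<^sup>2) ^ k0"
        proof (intro mult_mono)
          show "a ^ k \<le> a" using a False power_decreasing[of 1 k a] by simp
          have "(norm v powr s) ^ k \<le> (1 + (norm v)\<^sup>2) ^ k"
            using norm_powr_le[OF s0 s(2)] by (intro power_mono) auto
          also have "\<dots> \<le> (1 + (norm v)\<^sup>2) ^ k0" using k by (intro power_increasing) auto
          finally show "(norm v powr s) ^ k \<le> (1 + (norm v)\<^sup>2) ^ k0" .
        qed (use a in auto)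
        finally show ?thesis using False by simp
      qed
    qed
    also have "\<dots> = 1 + a * real k0 * (1 + (norm v)\<^sup>2) ^ k0"
      using k0 by (simp add: sum.distrib sum.delta)
    finally show ?thesis .
  qed
  \<comment> \<open>Where |v|^\<beta> \<ge> S the weight wins. Otherwise |v| < R, and a R^2 \<le> 1
    gives e \<le> exp 1 \<le> 3.\<close>
  have e_low: "S * e v \<le> norm v powr \<beta> * e v + 3 * S" for v
  proof (cases "S \<le> norm v powr \<beta>")
    case True
    then have "S * e v \<le> norm v powr \<beta> * e v" using e0 by (intro mult_right_mono)
    then show ?thesis using S0 by linarith
  next
    case False
    then have "norm v powr \<beta> < R powr \<beta>" using R by (simp add: S_def)
    have "norm v < R"
    proof (rule ccontr)
      assume "\<not> norm v < R"
      then have "R powr \<beta> \<le> norm v powr \<beta>" using \<beta> R by (intro powr_mono2) auto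
      then show False using \<open>norm v powr \<beta> < R powr \<beta>\<close> by simp
    qed
    then have "norm v powr s \<le> R powr s" using s0 by (intro powr_mono2) auto
    also have "\<dots> \<le> R powr 2" using R s by (intro powr_mono) auto
    also have "\<dots> = R\<^sup>2" using R by (simp add: powr_numeral)
    finally have "a * norm v powr s \<le> a * R\<^sup>2" using a by (intro mult_left_mono) auto
    then have "a * norm v powr s \<le> 1" using a by linarith
    then have "exp (a * norm v powr s) \<le> exp 1" by simp
    moreover have "e v \<le> exp (a * norm v powr s)" unfolding e_def using a by (intro exp_partial_le_exp) auto
    ultimately have "e v \<le> 3" using exp_le by linarith
    then have "S * e v \<le> S * 3" using S0 by (intro mult_left_mono)
    moreover have "0 \<le> norm v powr \<beta> * e v" using e0 by simp
    ultimately show ?thesis by linarith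
  qed
  have X: "integrable (mu \<tau>) e" "integrable (mu \<tau>) slice" "integrable (mu \<tau>) lo"
    "(LINT v|mu \<tau>. e v) = (LINT v|mu \<tau>. lo v) + (LINT v|mu \<tau>. slice v)"
    "0 \<le> (LINT v|mu \<tau>. lo v)" "(LINT v|mu \<tau>. lo v) \<le> M + 1"
    "(LINT v|mu \<tau>. slice v) \<le> A1 + 1 \<Longrightarrow> flow_rate \<tau> slice \<le> L * (A1 - C0 - (LINT v|mu \<tau>. e v))"
    if \<tau>: "0 \<le> \<tau>" for \<tau>
  proof -
    interpret Q: collision_state "TYPE('a)" b L "mu \<tau>" \<beta> M E by (rule state[OF \<tau>])
    note er = Q.exp_rate[OF mom[OF \<tau>] less_imp_le[OF a(1)] s \<epsilon>0 k0(1) n k0(2) gain]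
    have pt: "exp_partial n (a * norm v powr s) = e v" "(\<Sum>k<k0. (a * norm v powr s) ^ k / fact k) = lo v"
      "(\<Sum>k=k0..n. (a * norm v powr s) ^ k / fact k) = slice v" for v :: 'a
      by (simp_all add: e_def lo_def slice_def)
    note er' = er[unfolded pt]
    show ie: "integrable (mu \<tau>) e" and isl: "integrable (mu \<tau>) slice"
      using er'(2,4) by simp_all
    have ibe: "integrable (mu \<tau>) (\<lambda>v. norm v powr \<beta> * e v)" using er'(3) by simp
    have "integrable (mu \<tau>) (\<lambda>v. e v - slice v)" using ie isl by simp
    then show ilo: "integrable (mu \<tau>) lo" by (simp add: e_split)
    show Xsplit: "(LINT v|mu \<tau>. e v) = (LINT v|mu \<tau>. lo v) + (LINT v|mu \<tau>. slice v)"
      using ilo isl by (simp add: e_split)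
    show "0 \<le> (LINT v|mu \<tau>. lo v)" using lo0 by (intro integral_nonneg_AE) auto
    have mle: "(LINT v|mu \<tau>. (1 + (norm v)\<^sup>2) ^ k0) \<le> (LINT v|mu \<tau>. (1 + (norm v)\<^sup>2) ^ Suc k0)"
      by (intro integral_mono mom[OF \<tau>] power_increasing) auto
    have "(LINT v|mu \<tau>. lo v) \<le> (LINT v|mu \<tau>. 1 + a * real k0 * (1 + (norm v)\<^sup>2) ^ k0)"
      using mom[OF \<tau>, of k0] lo_le by (intro integral_mono ilo) auto
    also have "\<dots> = M + a * real k0 * (LINT v|mu \<tau>. (1 + (norm v)\<^sup>2) ^ k0)"
      using mom[OF \<tau>, of k0] Q.mass by simp
    also have "\<dots> \<le> M + a * real k0 * (LINT v|mu \<tau>. (1 + (norm v)\<^sup>2) ^ Suc k0)"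
      using a mle by (intro add_left_mono mult_left_mono) auto
    finally show lo_int: "(LINT v|mu \<tau>. lo v) \<le> M + 1" using low[OF \<tau>] by linarith
    have iblo: "integrable (mu \<tau>) (\<lambda>v. norm v powr \<beta> * lo v)"
    proof (rule Bochner_Integration.integrable_bound[OF ibe])
      show "AE v in mu \<tau>. norm (norm v powr \<beta> * lo v) \<le> norm (norm v powr \<beta> * e v)"
        using lo0 e0 e_split slice0 by (intro AE_I2) (simp add: abs_mult mult_left_mono)
    qed measurable
    have lo_pt: "norm v powr \<beta> * lo v \<le> norm v powr \<beta> + a * real k0 * (1 + (norm v)\<^sup>2) ^ Suc k0" for v :: 'a
    proof -
      have "norm v powr \<beta> * lo v \<le> norm v powr \<beta> * (1 + a * real k0 * (1 + (norm v)\<^sup>2) ^ k0)"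
        by (intro mult_left_mono lo_le) auto
      also have "\<dots> = norm v powr \<beta> + norm v powr \<beta> * (a * real k0 * (1 + (norm v)\<^sup>2) ^ k0)"
        by (simp add: distrib_left)
      also have "\<dots> \<le> norm v powr \<beta> + (1 + (norm v)\<^sup>2) * (a * real k0 * (1 + (norm v)\<^sup>2) ^ k0)"
        using a norm_powr_le[OF \<beta>] by (intro add_left_mono mult_right_mono) auto
      finally show ?thesis by (simp add: mult_ac)
    qed
    have "(LINT v|mu \<tau>. norm v powr \<beta> * lo v) \<le> (LINT v|mu \<tau>. norm v powr \<beta> + a * real k0 * (1 + (norm v)\<^sup>2) ^ Suc k0)"
      by (rule integral_mono[OF iblo _ lo_pt])
        (intro Bochner_Integration.integrable_add Q.norm_powr_integrable integrable_mult_right mom[OF \<tau>])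
    also have "\<dots> = (LINT v|mu \<tau>. norm v powr \<beta>) + a * real k0 * (LINT v|mu \<tau>. (1 + (norm v)\<^sup>2) ^ Suc k0)"
      by (subst Bochner_Integration.integral_add[OF Q.norm_powr_integrable integrable_mult_right[OF mom[OF \<tau>]]]) simp
    finally have Yl: "(LINT v|mu \<tau>. norm v powr \<beta> * lo v) \<le> M + E + 1"
      using low[OF \<tau>] Q.norm_powr_integral_le by linarith
    let ?X = "LINT v|mu \<tau>. e v" and ?Y = "LINT v|mu \<tau>. norm v powr \<beta> * e v"
    have Y0: "0 \<le> ?Y" using e0 by (intro integral_nonneg_AE) auto
    have "S * ?X = (LINT v|mu \<tau>. S * e v)" by simp
    also have "\<dots> \<le> (LINT v|mu \<tau>. norm v powr \<beta> * e v + 3 * S)"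
      using ie ibe e_low by (intro integral_mono) auto
    also have "\<dots> = ?Y + 3 * S * M" using ibe Q.mass by simp
    finally have "M / 8 * (S * ?X) \<le> M / 8 * (?Y + 3 * S * M)" using M by (intro mult_left_mono) auto
    then have XY: "(M + E + 1) * ?X \<le> M / 8 * ?Y + 3 * (M * (M + E + 1))"
      unfolding MS[symmetric] by (simp add: algebra_simps)
    assume sl: "(LINT v|mu \<tau>. slice v) \<le> A1 + 1"
    then have "?X \<le> A1 + M + 2" using Xsplit lo_int by linarith
    \<comment> \<open>Origin of \<epsilon>: 8 \<epsilon> (A1 + M + 2) = M / 8, half of the
      dissipation.\<close>
    then have "8 * \<epsilon> * ?X \<le> 8 * \<epsilon> * (A1 + M + 2)" using \<epsilon>0 by (intro mult_left_mono) auto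
    also have "\<dots> = M / 8" unfolding \<epsilon> using A1pos M by (simp add: field_simps)
    finally have "8 * \<epsilon> * ?X * ?Y \<le> M / 8 * ?Y" using Y0 by (intro mult_right_mono)
    moreover have "M / 4 * (LINT v|mu \<tau>. norm v powr \<beta> * lo v) \<le> M / 4 * (M + E + 1)"
      using Yl M by (intro mult_left_mono) auto
    \<comment> \<open>Origin of A1: the constants 3 M (M + E + 1), from small velocities, and M / 4
      (M + E + 1), from the terms of low degree, add up to A1 - C0.\<close>
    ultimately have "8 * \<epsilon> * ?X * ?Y - M / 4 * (?Y - (LINT v|mu \<tau>. norm v powr \<beta> * lo v)) + (M + E) * ?X
        \<le> A1 - C0 - ?X"
      using XY unfolding A1 right_diff_distrib distrib_right[of "M + E" 1] by linarith
    then have "L * (8 * \<epsilon> * ?X * ?Y - M / 4 * (?Y - (LINT v|mu \<tau>. norm v powr \<beta> * lo v)) + (M + E) * ?X)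
        \<le> L * (A1 - C0 - ?X)"
      using L_pos by (intro mult_left_mono) auto
    then show "flow_rate \<tau> slice \<le> L * (A1 - C0 - ?X)"
      using er'(1) by linarith
  qed
  define Ca where "Ca = (\<Sum>k\<le>n. a ^ k / fact k)"
  have growth: "\<bar>slice v\<bar> \<le> Ca * (1 + (norm v)\<^sup>2) ^ n" for v
    using exp_partial_growth[OF less_imp_le[OF a(1)] s0 s(2), of n v] slice0[of v] lo0[of v] e_split[of v]
    by (simp add: e_def Ca_def)
  have Ca0: "0 \<le> Ca" unfolding Ca_def using a by (intro sum_nonneg) auto
  have "(LINT v|mu t. slice v) \<le> A1 + 1"
  proof (rule barrier[where ?A1.0=A1 and G="\<lambda>t. LINT v|mu t. slice v"])
    show "((\<lambda>\<tau>. flow_rate \<tau> slice) has_integral (LINT v|mu t. slice v) - (LINT v|mu 0. slice v)) {0..t}" if "0 \<le> t" for t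
      by (rule weak_form_growth[OF m0 _ growth Ca0 that]) measurable
    have "(LINT v|mu 0. slice v) \<le> C0" using X(4,5)[of 0] init by (simp add: e_def)
    also have "C0 \<le> A1" unfolding A1 using M ME by simp
    finally show "(LINT v|mu 0. slice v) \<le> A1" .
    fix \<tau> :: real assume \<tau>: "0 \<le> \<tau>" "A1 \<le> (LINT v|mu \<tau>. slice v)" "(LINT v|mu \<tau>. slice v) \<le> A1 + 1"
    have "A1 - C0 - (LINT v|mu \<tau>. e v) \<le> 0" using X(4,5)[OF \<tau>(1)] \<tau>(2) C0 by linarith
    then have "L * (A1 - C0 - (LINT v|mu \<tau>. e v)) \<le> 0" using L_pos by (simp add: mult_le_0_iff)
    then show "flow_rate \<tau> slice \<le> 0" using X(7)[OF \<tau>(1,3)] by linarith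
  qed (use t in auto)
  \<comment> \<open>M + 1 for the low degrees and A1 + 1 for \<open>slice\<close>.\<close>
  then show ?thesis using X(4,6)[OF t] by (simp add: e_def)
qed

end

section \<open>Uniform constants\<close>

text \<open>For r > 1 a single term of the exponential series suffices. The condition on k involves
  \<beta> and not s, so the constant is the same for all s \<ge> \<beta>.\<close>

lemma even_power_le_exp:
  fixes r a :: real
  assumes r: "0 \<le> r" and a: "0 < a" and \<beta>: "0 < \<beta>" "\<beta> \<le> s" and k: "2 * real j \<le> real k * \<beta>"
  shows "(r\<^sup>2) ^ j \<le> 1 + fact k / a ^ k * exp (a * r powr s)"
proof (cases "r \<le> 1")
  case True
  then have "(r\<^sup>2) ^ j \<le> 1" using r by (intro power_le_one) (auto simp: power_le_one)
  moreover have "0 \<le> fact k / a ^ k * exp (a * r powr s)" using a by simp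
  ultimately show ?thesis by linarith
next
  case False
  then have r1: "1 < r" by simp
  have "(r\<^sup>2) ^ j = r ^ (2 * j)" by (simp only: power_mult)
  also have "\<dots> = r powr real (2 * j)" using r1 by (intro powr_realpow[symmetric]) simp
  also have "real (2 * j) = 2 * real j" by simp
  also have "r powr (2 * real j) \<le> r powr (s * real k)"
  proof (rule powr_mono)
    have "real k * \<beta> \<le> real k * s" using \<beta> by (intro mult_left_mono) auto
    then show "2 * real j \<le> s * real k" using k by (simp add: mult.commute)
  qed (use r1 in simp)
  also have "\<dots> = (r powr s) ^ k" using r1 by (simp add: powr_power mult.commute)
  also have "\<dots> = fact k / a ^ k * ((a * r powr s) ^ k / fact k)"
    using a by (simp add: power_mult_distrib)
  also have "\<dots> \<le> fact k / a ^ k * exp (a * r powr s)"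
  proof (rule mult_left_mono)
    have "(a * r powr s) ^ k / fact k \<le> exp_partial k (a * r powr s)"
      unfolding exp_partial_def using a by (intro member_le_sum) auto
    also have "\<dots> \<le> exp (a * r powr s)" using a by (intro exp_partial_le_exp) simp
    finally show "(a * r powr s) ^ k / fact k \<le> exp (a * r powr s)" .
  qed (use a in simp)
  finally show ?thesis by simp
qed

lemma (in moment_flow) initial_moments:
  assumes a0: "0 < a0" and C0: "0 < C0" and s: "\<beta> \<le> s" and k: "2 * real j \<le> real k * \<beta>"
    and init: "(\<integral>\<^sup>+ v. ennreal (exp (a0 * norm v powr s)) \<partial>mu 0) \<le> ennreal C0"
  shows "integrable (mu 0) (\<lambda>v. ((norm v)\<^sup>2) ^ j)" "(LINT v|mu 0. ((norm v)\<^sup>2) ^ j) \<le> M + fact k / a0 ^ k * C0"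
    "integrable (mu 0) (\<lambda>v. exp (a0 * norm v powr s))" "(LINT v|mu 0. exp (a0 * norm v powr s)) \<le> C0"
proof -
  interpret S: collision_state "TYPE('a)" b L "mu 0" \<beta> M E by (rule state) simp
  show i: "integrable (mu 0) (\<lambda>v. exp (a0 * norm v powr s))"
  proof (rule integrableI_nonneg)
    show "(\<integral>\<^sup>+ v. ennreal (exp (a0 * norm v powr s)) \<partial>mu 0) < \<infinity>"
      using init by (rule le_less_trans) simp
  qed auto
  have "ennreal (LINT v|mu 0. exp (a0 * norm v powr s)) \<le> ennreal C0"
    using init nn_integral_eq_integral[OF i] by simp
  then show le: "(LINT v|mu 0. exp (a0 * norm v powr s)) \<le> C0"
    using C0 by (simp add: ennreal_le_iff)
  have pt: "((norm v)\<^sup>2) ^ j \<le> 1 + fact k / a0 ^ k * exp (a0 * norm v powr s)" for v :: 'a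
    by (rule even_power_le_exp[OF norm_ge_zero a0 \<beta>(1) s k])
  have i1: "integrable (mu 0) (\<lambda>v. 1 + fact k / a0 ^ k * exp (a0 * norm v powr s))"
    using i by simp
  show ij: "integrable (mu 0) (\<lambda>v. ((norm v)\<^sup>2) ^ j)"
  proof (rule Bochner_Integration.integrable_bound[OF i1])
    show "AE v in mu 0. norm (((norm v)\<^sup>2) ^ j) \<le> norm (1 + fact k / a0 ^ k * exp (a0 * norm v powr s))"
      using pt by (intro AE_I2) (simp add: order_trans[OF _ abs_ge_self])
  qed measurable
  have "(LINT v|mu 0. ((norm v)\<^sup>2) ^ j) \<le> (LINT v|mu 0. 1 + fact k / a0 ^ k * exp (a0 * norm v powr s))"
    by (rule integral_mono[OF ij i1 pt])
  also have "\<dots> = M + fact k / a0 ^ k * (LINT v|mu 0. exp (a0 * norm v powr s))"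
    using i S.mass by simp
  also have "\<dots> \<le> M + fact k / a0 ^ k * C0" using le a0 by (intro add_left_mono mult_left_mono) auto
  finally show "(LINT v|mu 0. ((norm v)\<^sup>2) ^ j) \<le> M + fact k / a0 ^ k * C0" .
qed

theorem (in angular_kernel) exp_moment_propagation:
  assumes \<beta>: "0 < \<beta>" "\<beta> \<le> 2" and a0: "0 < a0" and C0: "0 < C0"
  obtains C a where "0 < C" "0 < a"
    "\<And>s (g :: real \<Rightarrow> 'a \<Rightarrow> real) t. \<beta> \<le> s \<Longrightarrow> s \<le> 2 \<Longrightarrow> moment_flow b L \<beta> M E g \<Longrightarrow>
      (\<integral>\<^sup>+ v. ennreal (exp (a0 * norm v powr s)) \<partial>density lborel (\<lambda>v. ennreal (g 0 v))) \<le> ennreal C0 \<Longrightarrow> 0 \<le> t \<Longrightarrow>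
      (\<integral>\<^sup>+ v. ennreal (exp (a * norm v powr s)) \<partial>density lborel (\<lambda>v. ennreal (g t v))) \<le> ennreal C"
proof (cases "0 < M \<and> 0 \<le> E")
  \<comment> \<open>Every flow has M, E \<ge> 0, so here M = 0, the measures vanish and any
    constants do.\<close>
  case False
  show thesis
  proof (rule that[of 1 1])
    fix s t :: real and g :: "real \<Rightarrow> 'a \<Rightarrow> real"
    assume fl: "moment_flow b L \<beta> M E g" and t: "0 \<le> t"
    interpret moment_flow "TYPE('a)" b L \<beta> M E g by (rule fl)
    interpret S: collision_state "TYPE('a)" b L "mu t" \<beta> M E by (rule state[OF t])
    have "M = 0" using False mass_energy_nonneg by auto
    then have "UNIV \<in> null_sets (mu t)" using S.mass by (simp add: null_sets_def S.emeasure_eq_measure)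
    from AE_not_in[OF this] have "AE v in mu t. False" by simp
    then have "(\<integral>\<^sup>+ v. ennreal (exp (1 * norm v powr s)) \<partial>mu t) = (\<integral>\<^sup>+ v. 0 \<partial>mu t)"
      by (intro nn_integral_cong_AE) (auto elim: eventually_mono)
    then show "(\<integral>\<^sup>+ v. ennreal (exp (1 * norm v powr s)) \<partial>density lborel (\<lambda>v. ennreal (g t v))) \<le> ennreal 1"
      by (simp add: mu_def)
  qed auto
next
  case True
  then have M: "0 < M" and E: "0 \<le> E" by auto
  \<comment> \<open>From this radius on |v|^\<beta> is at least the factor S of
    \<open>exp_moment_bound\<close>; R \<ge> 1 ensures R^s \<le> R^2.\<close>
  define R where "R = max 1 ((8 * (M + E + 1) / M) powr (1 / \<beta>))"
  define A1 where "A1 = 3 * (M * (M + E + 1)) + M / 4 * (M + E + 1) + C0"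
  define \<epsilon> where "\<epsilon> = M / (64 * (A1 + M + 2))"
  have A1: "0 < A1" unfolding A1_def using M E C0 by (intro add_nonneg_pos add_nonneg_nonneg) auto
  have \<epsilon>: "0 < \<epsilon>" unfolding \<epsilon>_def using M A1 by simp
  have R: "1 \<le> R" "8 * (M + E + 1) / M \<le> R powr \<beta>"
  proof -
    have pos: "0 < 8 * (M + E + 1) / M" using M E by simp
    have "x = (x powr (1 / \<beta>)) powr \<beta>" if "0 < x" for x
      using \<beta> that by (simp add: powr_powr)
    from this[OF pos] have "8 * (M + E + 1) / M = ((8 * (M + E + 1) / M) powr (1 / \<beta>)) powr \<beta>" .
    also have "\<dots> \<le> R powr \<beta>" unfolding R_def using \<beta> by (intro powr_mono2) auto
    finally show "8 * (M + E + 1) / M \<le> R powr \<beta>" .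
  qed (simp add: R_def)
  obtain p0 where p0: "1 \<le> p0" and gain0: "\<And>p v w. p0 \<le> p \<Longrightarrow> v \<noteq> (w::'a) \<Longrightarrow>
    gain b (\<lambda>u. ((norm u)\<^sup>2) powr p) v w \<le> \<epsilon> * L * ((norm v)\<^sup>2 + (norm w)\<^sup>2) powr p"
    using gain_power_small[OF \<epsilon>] by metis
  obtain p1 where p1: "1 \<le> p1" and gain1: "\<And>p v w. p1 \<le> p \<Longrightarrow> v \<noteq> (w::'a) \<Longrightarrow>
    gain b (\<lambda>u. ((norm u)\<^sup>2) powr p) v w \<le> 1 / 4 * L * ((norm v)\<^sup>2 + (norm w)\<^sup>2) powr p"
    using gain_power_small[of "1 / 4"] by (metis zero_less_divide_1_iff zero_less_numeral)
  \<comment> \<open>All degrees k \<ge> \<open>k0\<close> have exponents k s / 2 \<ge> p0, for every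
    s \<ge> \<beta>.\<close>
  define k0 where "k0 = Suc (nat \<lceil>2 * p0 / \<beta>\<rceil>)"
  have k0: "1 \<le> k0" "p0 \<le> real k0 * \<beta> / 2"
  proof -
    have "2 * p0 / \<beta> \<le> real k0" unfolding k0_def by linarith
    then show "p0 \<le> real k0 * \<beta> / 2" using \<beta> by (simp add: field_simps)
  qed (simp add: k0_def)
  \<comment> \<open>Two demands: the moment of order \<open>k0 + 1\<close> has to be dominated, and
    the angular factor for this power has to be at most 1/4.\<close>
  define p where "p = max (Suc k0) (nat \<lceil>p1\<rceil>)"
  have p: "Suc k0 \<le> p" "1 \<le> p" "p1 \<le> real p"
  proof -
    have "p1 \<le> real (nat \<lceil>p1\<rceil>)" by linarith
    also have "\<dots> \<le> real p" unfolding p_def by simp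
    finally show "p1 \<le> real p" .
  qed (auto simp: p_def)
  have pow: "x powr real p = x ^ p" if "0 \<le> x" for x :: real
    using that p by (cases "x = 0") (auto simp: powr_realpow power_0_left)
  have gain2: "gain b (\<lambda>u. ((norm u)\<^sup>2) ^ p) v w \<le> 1 / 4 * L * ((norm v)\<^sup>2 + (norm w)\<^sup>2) ^ p" if "v \<noteq> w" for v w :: 'a
    using gain1[OF p(3) that] by (simp add: pow)
  obtain B where B: "\<And>\<mu> :: 'a measure. collision_state b L \<mu> \<beta> M E \<Longrightarrow> (\<And>k. integrable \<mu> (\<lambda>v. (1 + (norm v)\<^sup>2) ^ k)) \<Longrightarrow>
    (LINT (v, w)|(\<mu> \<Otimes>\<^sub>M \<mu>). weak_collision b L \<beta> (\<lambda>v. ((norm v)\<^sup>2) ^ p) v w)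
      \<le> L * (B - (M + E) / 2 * (LINT v|\<mu>. ((norm v)\<^sup>2) ^ p))"
  proof (rule poly_rate_uniform[OF \<beta> M E p(2)])
    show "gain b (\<lambda>u. ((norm u)\<^sup>2) ^ p) v w \<le> 1 / 4 * L * ((norm v)\<^sup>2 + (norm w)\<^sup>2) ^ p" if "v \<noteq> w" for v w :: 'a
      by (rule gain2[OF that])
  next
    fix B
    assume B: "\<And>\<mu> :: 'a measure. collision_state b L \<mu> \<beta> M E \<Longrightarrow> (\<And>k. integrable \<mu> (\<lambda>v. (1 + (norm v)\<^sup>2) ^ k)) \<Longrightarrow>
      (LINT (v, w)|(\<mu> \<Otimes>\<^sub>M \<mu>). weak_collision b L \<beta> (\<lambda>v. ((norm v)\<^sup>2) ^ p) v w)
        \<le> L * (B - (M + E) / 2 * (LINT v|\<mu>. ((norm v)\<^sup>2) ^ p))"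
    show thesis by (rule that[of B]) (rule B)
  qed
  define idx where "idx = (\<lambda>j::nat. nat \<lceil>2 * real j / \<beta>\<rceil>)"
  have idx: "2 * real j \<le> real (idx j) * \<beta>" for j
  proof -
    have "2 * real j / \<beta> \<le> real (idx j)" unfolding idx_def by linarith
    then show ?thesis using \<beta> by (simp add: field_simps)
  qed
  \<comment> \<open>\<open>K0\<close> bounds the moment of order p initially and \<open>K1\<close>
    at all times; \<open>Mom\<close> bounds the integral of (1 + |v|^2)^(k0+1).\<close>
  define K0 where "K0 = M + fact (idx p) / a0 ^ idx p * C0"
  define K1 where "K1 = max K0 (2 * B / (M + E)) + 1"
  define Mom where "Mom = 2 ^ p * (M + K1)"
  have "0 \<le> K0" unfolding K0_def using M C0 a0 by simp
  then have K1: "0 \<le> K1" by (simp add: K1_def)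
  have Mom: "0 \<le> Mom" using M K1 by (simp add: Mom_def)
  \<comment> \<open>In this order the bounds serve the comparison with the initial datum, a^k \<le>
    a, boundedness of the exponential on |v| \<le> R, and smallness of the low degrees.\<close>
  define a where "a = min (min a0 1) (min (1 / R\<^sup>2) (1 / (real k0 * Mom + 1)))"
  have a: "0 < a" "a \<le> a0" "a \<le> 1" "a * R\<^sup>2 \<le> 1" "a * real k0 * Mom \<le> 1"
  proof -
    have d: "0 < real k0 * Mom + 1" using Mom by (simp add: add_nonneg_pos)
    have R2: "0 < R\<^sup>2" using R by simp
    show "0 < a" using a0 d R2 by (simp add: a_def)
    have "a \<le> 1 / R\<^sup>2" by (simp add: a_def)
    then show "a * R\<^sup>2 \<le> 1" using R2 by (simp add: field_simps)
    have "a \<le> 1 / (real k0 * Mom + 1)" by (simp add: a_def)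
    then have "a * (real k0 * Mom + 1) \<le> 1" using d by (simp add: field_simps)
    then show "a * real k0 * Mom \<le> 1" using \<open>0 < a\<close> by (simp add: algebra_simps)
  qed (auto simp: a_def)
  show thesis
  proof (rule that[of "A1 + M + 2" a])
    show "0 < A1 + M + 2" using A1 M by simp
    show "0 < a" by (rule a(1))
    fix s t :: real and g :: "real \<Rightarrow> 'a \<Rightarrow> real"
    assume s: "\<beta> \<le> s" "s \<le> 2" and fl: "moment_flow b L \<beta> M E g" and t: "0 \<le> t"
      and init': "(\<integral>\<^sup>+ v. ennreal (exp (a0 * norm v powr s)) \<partial>density lborel (\<lambda>v. ennreal (g 0 v))) \<le> ennreal C0"
    interpret moment_flow "TYPE('a)" b L \<beta> M E g by (rule fl)
    have init: "(\<integral>\<^sup>+ v. ennreal (exp (a0 * norm v powr s)) \<partial>mu 0) \<le> ennreal C0"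
      using init' by (simp add: mu_def)
    have m0: "integrable (mu 0) (\<lambda>v. ((norm v)\<^sup>2) ^ Suc q)" for q
      by (rule initial_moments(1)[OF a0 C0 s(1) idx init])
    have mp: "(LINT v|mu \<tau>. ((norm v)\<^sup>2) ^ p) \<le> K1" if "0 \<le> \<tau>" for \<tau>
      unfolding K1_def
    proof (rule poly_moment_bound[OF m0 M _ that])
      show "(LINT v|mu 0. ((norm v)\<^sup>2) ^ p) \<le> K0"
        unfolding K0_def by (rule initial_moments(2)[OF a0 C0 s(1) idx init])
      show "flow_rate \<tau> (\<lambda>v. ((norm v)\<^sup>2) ^ p) \<le> L * (B - (M + E) / 2 * (LINT v|mu \<tau>. ((norm v)\<^sup>2) ^ p))"
        if "0 \<le> \<tau>" for \<tau>
        by (rule B[OF state[OF that] moments_integrable[OF m0 that]])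
    qed
    have low: "a * real k0 * (LINT v|mu \<tau>. (1 + (norm v)\<^sup>2) ^ Suc k0) \<le> 1" if \<tau>: "0 \<le> \<tau>" for \<tau>
    proof -
      interpret S: collision_state "TYPE('a)" b L "mu \<tau>" \<beta> M E by (rule state[OF \<tau>])
      have ip: "integrable (mu \<tau>) (\<lambda>v. ((norm v)\<^sup>2) ^ p)"
        by (rule S.integrable_growth[OF moments_integrable[OF m0 \<tau>, of p], where C=1]) (auto intro!: power_mono)
      have "(LINT v|mu \<tau>. (1 + (norm v)\<^sup>2) ^ Suc k0) \<le> (LINT v|mu \<tau>. 2 ^ p * (1 + ((norm v)\<^sup>2) ^ p))"
        by (intro integral_mono moments_integrable[OF m0 \<tau>] one_plus_power_le p(1)) (use ip in auto)
      also have "\<dots> = 2 ^ p * (M + (LINT v|mu \<tau>. ((norm v)\<^sup>2) ^ p))" using ip S.mass by simp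
      also have "\<dots> \<le> Mom" unfolding Mom_def using mp[OF \<tau>] by (intro mult_left_mono add_left_mono) auto
      finally have "a * real k0 * (LINT v|mu \<tau>. (1 + (norm v)\<^sup>2) ^ Suc k0) \<le> a * real k0 * Mom"
        using a by (intro mult_left_mono) auto
      then show ?thesis using a(5) by linarith
    qed
    interpret S0: collision_state "TYPE('a)" b L "mu 0" \<beta> M E by (rule state) simp
    interpret St: collision_state "TYPE('a)" b L "mu t" \<beta> M E by (rule state[OF t])
    have e_int: "integrable (mu \<tau>) (\<lambda>v. exp_partial n (a * norm v powr s))" if "0 \<le> \<tau>" for \<tau> n
    proof -
      interpret S: collision_state "TYPE('a)" b L "mu \<tau>" \<beta> M E by (rule state[OF that])
      show ?thesis
      proof (rule S.integrable_growth[OF moments_integrable[OF m0 that, of n]])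
        show "(\<lambda>v. exp_partial n (a * norm v powr s)) \<in> borel_measurable borel"
          unfolding exp_partial_def by measurable
        show "\<bar>exp_partial n (a * norm v powr s)\<bar> \<le> (\<Sum>k\<le>n. a ^ k / fact k) * (1 + (norm v)\<^sup>2) ^ n" for v :: 'a
          using exp_partial_growth[of a s n v] exp_partial_nonneg[of "a * norm v powr s" n] a s \<beta> by simp
      qed
    qed
    have bound: "(LINT v|mu t. exp_partial n (a * norm v powr s)) \<le> A1 + M + 2" if n: "k0 \<le> n" for n
    proof (rule exp_moment_bound[OF m0 M C0 s a(1,3,4) R k0 gain0 A1_def \<epsilon>_def low _ n t])
      have "(LINT v|mu 0. exp_partial n (a * norm v powr s)) \<le> (LINT v|mu 0. exp (a0 * norm v powr s))"
      proof (rule integral_mono[OF e_int initial_moments(3)[OF a0 C0 s(1) idx[of 0] init]])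
        fix v :: 'a
        have "exp_partial n (a * norm v powr s) \<le> exp (a * norm v powr s)" using a by (intro exp_partial_le_exp) auto
        also have "\<dots> \<le> exp (a0 * norm v powr s)" using a by (simp add: mult_right_mono)
        finally show "exp_partial n (a * norm v powr s) \<le> exp (a0 * norm v powr s)" .
      qed simp
      also have "\<dots> \<le> C0" by (rule initial_moments(4)[OF a0 C0 s(1) idx[of 0] init])
      finally show "(LINT v|mu 0. exp_partial n (a * norm v powr s)) \<le> C0" .
    qed
    \<comment> \<open>The partial sums are shifted by \<open>k0\<close>, since the bound is known
      only from that degree on.\<close>
    have "(\<integral>\<^sup>+ v. ennreal (exp (a * norm v powr s)) \<partial>mu t) \<le> ennreal (A1 + M + 2)"
    proof (rule nn_integral_le_of_limit[where u="\<lambda>n v. exp_partial (n + k0) (a * norm v powr s)"])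
      show "(\<lambda>v. exp_partial (n + k0) (a * norm v powr s)) \<in> borel_measurable (mu t)" for n
        using e_int[OF t] by auto
      show "(\<integral>\<^sup>+ v. ennreal (exp_partial (n + k0) (a * norm v powr s)) \<partial>mu t) \<le> ennreal (A1 + M + 2)" for n
        using a bound[of "n + k0"]
        by (subst nn_integral_eq_integral[OF e_int[OF t]]) (auto intro!: AE_I2 exp_partial_nonneg ennreal_leI)
      show "(\<lambda>n. exp_partial (n + k0) (a * norm v powr s)) \<longlonglongrightarrow> exp (a * norm v powr s)" for v :: 'a
        by (rule LIMSEQ_ignore_initial_segment[OF exp_partial_tendsto])
    qed
    then show "(\<integral>\<^sup>+ v. ennreal (exp (a * norm v powr s)) \<partial>density lborel (\<lambda>v. ennreal (g t v))) \<le> ennreal (A1 + M + 2)"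
      by (simp add: mu_def)
  qed
qed

text \<open>
  The Lebesgue measurable \<open>b\<close> is replaced by a Borel function; the two agree for almost every cosine,
  because the distribution of the cosine is absolutely continuous.
\<close>
lemma angular_kernel_exists:
  fixes b :: "real \<Rightarrow> real"
  assumes dim: "DIM('a::euclidean_space) \<ge> 2"
    and b_nonneg: "\<And>z. z \<in> {-1..1} \<Longrightarrow> 0 \<le> b z"
    and b_nonzero: "\<not> (AE z in lebesgue_on {-1..1}. b z = 0)"
    and b_integrable:
      "integrable (density (lebesgue_on {-1..1})
         (\<lambda>z. ennreal ((1 - z\<^sup>2) powr ((real DIM('a) - 3) / 2)))) b"
  shows "\<exists>b' L (N :: real measure). angular_kernel TYPE('a) b' L \<and>
    (\<forall>e::'a. norm e = 1 \<longrightarrow> distr usphere borel (\<lambda>s. e \<bullet> s) = N) \<and> (AE t in N. b t = b' t)"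
proof -
  let ?w = "\<lambda>t::real. (1 - t\<^sup>2) powr ((real DIM('a) - 3) / 2)"
  obtain \<kappa> where \<kappa>: "0 < \<kappa>" and dist: "\<And>e::'a. norm e = 1 \<Longrightarrow> distr usphere borel (\<lambda>s. e \<bullet> s) =
    density lborel (\<lambda>t. ennreal (\<kappa> * (?w t * indicator {-1<..<1} t)))"
    by (rule distr_usphere_cos[OF dim], rule that)
  define W where "W = (\<lambda>t. \<kappa> * (?w t * indicator {-1<..<1} t))"
  have W[measurable]: "W \<in> borel_measurable borel" unfolding W_def by measurable
  have W0: "0 \<le> W t" for t using \<kappa> by (simp add: W_def)
  define N where "N = density lborel (\<lambda>t. ennreal (W t))"
  have S: "{-1..1::real} \<in> sets lebesgue" by simp
  have bm: "b \<in> borel_measurable (lebesgue_on {-1..1})"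
    using borel_measurable_integrable[OF b_integrable] by simp
  have wm: "?w \<in> borel_measurable (lebesgue_on {-1..1})"
    by (intro measurable_restrict_space1 measurable_completion) measurable
  have "integrable (lebesgue_on {-1..1}) (\<lambda>t. ?w t *\<^sub>R b t)"
    using b_integrable bm wm by (subst (asm) integrable_density) auto
  then have ib: "integrable lebesgue (\<lambda>t. indicator {-1..1} t *\<^sub>R (?w t *\<^sub>R b t))"
    using S by (subst (asm) integrable_restrict_space) auto
  have "(\<lambda>t. indicator {-1..1} t *\<^sub>R b t) \<in> borel_measurable lebesgue"
    using bm S by (subst (asm) borel_measurable_restrict_space_iff) auto
  then obtain h where h[measurable]: "h \<in> borel_measurable lborel" and ae: "AE t in lborel. indicator {-1..1} t *\<^sub>R b t = h t"
    using completion_ex_borel_measurable_real by blast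
  \<comment> \<open>b is nonnegative only on [-1, 1]; the cut at 0 makes the representative
    nonnegative on the whole line.\<close>
  define b' where "b' = (\<lambda>t. max 0 (h t))"
  have b'm[measurable]: "b' \<in> borel_measurable borel" unfolding b'_def using h by simp
  have b'0: "0 \<le> b' t" for t by (simp add: b'_def)
  have ae': "AE t in lborel. t \<in> {-1..1} \<longrightarrow> b t = b' t"
    using ae
  proof eventually_elim
    case (elim t)
    show ?case
    proof
      assume t: "t \<in> {-1..1}"
      have "h t = b t" using elim t by simp
      moreover have "0 \<le> b t" by (rule b_nonneg[OF t])
      ultimately show "b t = b' t" by (simp add: b'_def)
    qed
  qed
  \<comment> \<open>At the endpoints the weight is 0 because \<open>0 powr x = 0\<close>, even where
    the exponent (d - 3) / 2 is negative or zero; so the open and the closed interval give the same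
    weight.\<close>
  have Wi: "W t = \<kappa> * (indicator {-1..1} t * ?w t)" for t
  proof -
    have "t = 1 \<or> t = -1 \<or> (indicator {-1<..<1} t :: real) = indicator {-1..1} t"
      by (auto simp: indicator_def)
    then show ?thesis by (auto simp: W_def)
  qed
  have "AE t in lborel. indicator {-1..1} t *\<^sub>R (?w t *\<^sub>R b t) = indicator {-1..1} t * (?w t * b' t)"
    using ae' by eventually_elim (auto simp: indicator_def)
  then have "integrable lborel (\<lambda>t. indicator {-1..1} t * (?w t * b' t))"
    using ib by (subst (asm) integrable_completion_AE) auto
  then have "integrable lborel (\<lambda>t. \<kappa> * (indicator {-1..1} t * (?w t * b' t)))"
    by (rule integrable_mult_right)
  then have "integrable lborel (\<lambda>t. W t *\<^sub>R b' t)" by (simp add: Wi mult.assoc)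
  then have iN: "integrable N b'" unfolding N_def using W0 by (subst integrable_density) auto
  have AE_N: "(AE t in N. P t) \<longleftrightarrow> (AE t in lborel. t \<in> {-1<..<1} \<longrightarrow> P t)" for P
  proof -
    have "0 < ennreal (W t) \<longleftrightarrow> t \<in> {-1<..<1}" for t
    proof -
      have "t \<in> {-1<..<1} \<Longrightarrow> 1 - t\<^sup>2 \<noteq> 0"
        using abs_square_less_1[of t] by auto
      then show ?thesis using \<kappa> by (auto simp: W_def indicator_def)
    qed
    then show ?thesis unfolding N_def by (subst AE_density) auto
  qed
  have pos: "\<not> (AE t in N. b' t = 0)"
  proof
    assume "AE t in N. b' t = 0"
    then have 1: "AE t in lborel. t \<in> {-1<..<1} \<longrightarrow> b' t = 0" by (simp add: AE_N)
    have "AE t in lborel. t \<in> {-1..1} \<longrightarrow> b t = 0"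
      using 1 ae' AE_lborel_singleton[of "1::real"] AE_lborel_singleton[of "-1::real"]
      by eventually_elim auto
    then have "AE t in lebesgue. t \<in> {-1..1} \<longrightarrow> b t = 0" by (rule AE_completion)
    then have "AE t in lebesgue_on {-1..1}. b t = 0" by (subst AE_restrict_space_iff) auto
    then show False using b_nonzero by simp
  qed
  have dN: "distr usphere borel (\<lambda>s. e \<bullet> s) = N" if "norm e = 1" for e :: 'a
    using dist[OF that] by (simp add: N_def W_def)
  have "angular_kernel TYPE('a) b' (LINT t|N. b' t)"
  proof (rule angular_kernelI[OF b'm b'0 dN _ iN pos])
    show "AE t in N. \<bar>t\<bar> < 1" by (simp add: AE_N abs_less_iff)
  qed
  moreover have "AE t in N. b t = b' t"
    unfolding AE_N using ae' by eventually_elim auto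
  ultimately show ?thesis using dN by blast
qed

lemma nn_integral_density_mult:
  fixes f g h :: "'a::euclidean_space \<Rightarrow> real"
  assumes ae: "AE v in lborel. f v = g v" and [measurable]: "g \<in> borel_measurable borel" "h \<in> borel_measurable borel"
    and g: "\<And>v. 0 \<le> g v"
  shows "(\<integral>\<^sup>+ v. ennreal (f v * h v) \<partial>lebesgue) = (\<integral>\<^sup>+ v. ennreal (h v) \<partial>density lborel (\<lambda>v. ennreal (g v)))"
proof -
  have "(\<integral>\<^sup>+ v. ennreal (f v * h v) \<partial>lebesgue) = (\<integral>\<^sup>+ v. ennreal (g v * h v) \<partial>lborel)"
    unfolding nn_integral_completion using ae by (intro nn_integral_cong_AE) (auto elim: eventually_mono)
  also have "\<dots> = (\<integral>\<^sup>+ v. ennreal (h v) \<partial>density lborel (\<lambda>v. ennreal (g v)))"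
    using g by (subst nn_integral_density) (auto simp: ennreal_mult')
  finally show ?thesis .
qed

text \<open>Dependence on the listed data only is expressed by the order of the quantifiers: C and a
  come before s, the initial datum and the solution, while M and E are fixed outside.\<close>

theorem theorem2:
  fixes b :: "real \<Rightarrow> real" and \<beta> M E a\<^sub>0 C\<^sub>0 :: real
  assumes dim: "DIM('a::euclidean_space) \<ge> 2"
    and beta: "0 < \<beta>" "\<beta> \<le> 2"
    and b_nonneg: "\<And>z. z \<in> {-1..1} \<Longrightarrow> 0 \<le> b z"
    and b_nonzero: "\<not> (AE z in lebesgue_on {-1..1}. b z = 0)"
    and b_integrable:
      "integrable (density (lebesgue_on {-1..1})
         (\<lambda>z. ennreal ((1 - z\<^sup>2) powr ((real DIM('a) - 3) / 2)))) b"
    and a\<^sub>0: "0 < a\<^sub>0" and C\<^sub>0: "0 < C\<^sub>0"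
  shows "\<exists>C a. 0 < C \<and> 0 < a \<and>
    (\<forall>s (f\<^sub>0 :: 'a \<Rightarrow> real) f.
       \<beta> \<le> s \<longrightarrow> s \<le> 2 \<longrightarrow>
       (\<forall>v. 0 \<le> f\<^sub>0 v) \<longrightarrow>
       integrable lebesgue (\<lambda>v. f\<^sub>0 v * (1 + (norm v)\<^sup>2)) \<longrightarrow>
       (LINT v|lebesgue. f\<^sub>0 v) = M \<longrightarrow>
       (LINT v|lebesgue. (norm v)\<^sup>2 * f\<^sub>0 v) = E \<longrightarrow>
       (\<integral>\<^sup>+ v. ennreal (f\<^sub>0 v * exp (a\<^sub>0 * norm v powr s)) \<partial>lebesgue) \<le> ennreal C\<^sub>0 \<longrightarrow>
       boltzmann_solution (\<lambda>r z. r powr \<beta> * b z) f\<^sub>0 f \<longrightarrow>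
       energy_conserving f\<^sub>0 f \<longrightarrow>
       (\<forall>t\<ge>0. (\<integral>\<^sup>+ v. ennreal (f t v * exp (a * norm v powr s)) \<partial>lebesgue) \<le> ennreal C))"
proof -
  obtain b' L and N :: "real measure" where ak: "angular_kernel TYPE('a) b' L"
    and N: "\<And>e::'a. norm e = 1 \<Longrightarrow> distr usphere borel (\<lambda>s. e \<bullet> s) = N" and bb': "AE t in N. b t = b' t"
    using angular_kernel_exists[OF dim b_nonneg b_nonzero b_integrable] by blast
  obtain C a where C: "0 < C" and a: "0 < a" and bound: "\<And>s (g :: real \<Rightarrow> 'a \<Rightarrow> real) t. \<beta> \<le> s \<Longrightarrow> s \<le> 2 \<Longrightarrow>
      moment_flow b' L \<beta> M E g \<Longrightarrow>
      (\<integral>\<^sup>+ v. ennreal (exp (a\<^sub>0 * norm v powr s)) \<partial>density lborel (\<lambda>v. ennreal (g 0 v))) \<le> ennreal C\<^sub>0 \<Longrightarrow> 0 \<le> t \<Longrightarrow>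
      (\<integral>\<^sup>+ v. ennreal (exp (a * norm v powr s)) \<partial>density lborel (\<lambda>v. ennreal (g t v))) \<le> ennreal C"
    by (rule angular_kernel.exp_moment_propagation[OF ak beta a\<^sub>0 C\<^sub>0], rule that)
  show ?thesis
  proof (rule exI[of _ C], rule exI[of _ a], intro conjI C a allI impI)
    fix s t :: real and f0 :: "'a \<Rightarrow> real" and f
    assume s: "\<beta> \<le> s" "s \<le> 2" and f0: "\<forall>v. 0 \<le> f0 v" "integrable lebesgue (\<lambda>v. f0 v * (1 + (norm v)\<^sup>2))"
      "(LINT v|lebesgue. f0 v) = M" "(LINT v|lebesgue. (norm v)\<^sup>2 * f0 v) = E"
      and init: "(\<integral>\<^sup>+ v. ennreal (f0 v * exp (a\<^sub>0 * norm v powr s)) \<partial>lebesgue) \<le> ennreal C\<^sub>0"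
      and sol: "boltzmann_solution (\<lambda>r z. r powr \<beta> * b z) f0 f" "energy_conserving f0 f" and t: "0 \<le> t"
    obtain g where fl: "moment_flow b' L \<beta> M E g" and fg: "\<And>t. 0 \<le> t \<Longrightarrow> AE v in lborel. f t v = g t v"
      and f0g: "AE v in lborel. f0 v = g 0 v"
      by (rule boltzmann_moment_flow[OF ak beta N bb' _ f0(2-4) sol]) (use f0(1) in auto)
    interpret moment_flow "TYPE('a)" b' L \<beta> M E g by (rule fl)
    note r0 = regular_densityD[OF regular[OF order_refl]] and rt = regular_densityD[OF regular[OF t]]
    have "(\<integral>\<^sup>+ v. ennreal (f t v * exp (a * norm v powr s)) \<partial>lebesgue) =
      (\<integral>\<^sup>+ v. ennreal (exp (a * norm v powr s)) \<partial>density lborel (\<lambda>v. ennreal (g t v)))"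
      by (rule nn_integral_density_mult[OF fg[OF t] rt(1) _ rt(2)]) measurable
    also have "\<dots> \<le> ennreal C"
    proof (rule bound[OF s fl _ t])
      have "(\<integral>\<^sup>+ v. ennreal (f0 v * exp (a\<^sub>0 * norm v powr s)) \<partial>lebesgue) =
        (\<integral>\<^sup>+ v. ennreal (exp (a\<^sub>0 * norm v powr s)) \<partial>density lborel (\<lambda>v. ennreal (g 0 v)))"
        by (rule nn_integral_density_mult[OF f0g r0(1) _ r0(2)]) measurable
      then show "(\<integral>\<^sup>+ v. ennreal (exp (a\<^sub>0 * norm v powr s)) \<partial>density lborel (\<lambda>v. ennreal (g 0 v))) \<le> ennreal C\<^sub>0"
        using init by simp
    qed
    finally show "(\<integral>\<^sup>+ v. ennreal (f t v * exp (a * norm v powr s)) \<partial>lebesgue) \<le> ennreal C" .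
  qed
qed

end
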